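(* Suppose that $f(X)\in L^2$, $\tilde f(X_1,\dots,X_{\tilde d})\in L^2$ and $\mu>0$. Then, for both choices of sign $\pm$, as $x\to\infty$, $$\frac{\tilde U_{N_\pm(x)}-\mu^{-\tilde d}\,\tilde\mu\,(\tilde d!)^{-1}x^{\tilde d}}{x^{\tilde d-1/2}}\ \overset{\mathrm d}{\longrightarrow}\ N(0,\gamma^2),$$ where $$\gamma^2:=\mu^{1-2\tilde d}\sum_{i,j=1}^{\tilde d}\frac{(i+j-2)!\,(2\tilde d-i-j)!}{(i-1)!\,(j-1)!\,(\tilde d-i)!\,(\tilde d-j)!\,(2\tilde d-1)!}\operatorname{Cov}\bigl(\tilde f_i(X),\tilde f_j(X)\bigr)$$ $$\qquad-2\frac{\mu^{-2\tilde d}\tilde\mu}{(\tilde d-1)!\,\tilde d!}\sum_{i=1}^{\tilde d}\operatorname{Cov}\bigl(f(X),\tilde f_i(X)\bigr)+\frac{\mu^{-2\tilde d-1}\tilde\mu^2}{(\tilde d-1)!^2}\operatorname{Var}\bigl(f(X)\bigr).$$ Moreover, $$\gamma^2=0\iff\mu\tilde f_i(X)=\tilde\mu\,(f(X)-\mu)\ \text{a.s.},\qquad i=1,\dots,\tilde d.$$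
   Context: $X,X_1,X_2,\dots$ is an i.i.d. sequence of random variables with values in an arbitrary measurable space $(S,\mathcal S)$; $\tilde d\ge1$ is a fixed integer, and $f:S\to\mathbb R$, $\tilde f:S^{\tilde d}\to\mathbb R$ are measurable (no symmetry assumed). For $n\ge0$, $U_n:=\sum_{i=1}^nf(X_i)$ and $\tilde U_n:=\sum_{1\le i_1<\dots<i_{\tilde d}\le n}\tilde f(X_{i_1},\dots,X_{i_{\tilde d}})$; $\mu:=\mathbb Ef(X)$, $\tilde\mu:=\mathbb E\tilde f(X_1,\dots,X_{\tilde d})$, and $\tilde f_i(x):=\mathbb E\tilde f(X_1,\dots,X_{i-1},x,X_{i+1},\dots,X_{\tilde d})-\tilde\mu$ for $1\le i\le\tilde d$. For $x>0$, $N_-(x):=\sup\{n\ge0:U_n\le x\}$ and $N_+(x):=\inf\{n\ge0:U_n>x\}$ (a.s. finite when $\mu>0$). $N(0,0)$ is the point mass at $0$. *)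

theory Defs
  imports "HOL-Probability.Probability" "HOL-Library.Extended_Nat"
begin

definition covariance :: "'a measure \<Rightarrow> ('a \<Rightarrow> real) \<Rightarrow> ('a \<Rightarrow> real) \<Rightarrow> real" where
  "covariance M Y Z =
     integral\<^sup>L M (\<lambda>\<omega>. (Y \<omega> - integral\<^sup>L M Y) * (Z \<omega> - integral\<^sup>L M Z))"

text \<open>
  The library's \<^const>\<open>weak_conv_m\<close> only covers sequences. This is the same notion along
  an arbitrary filter; here it is used along \<^const>\<open>at_top\<close> on the reals.
\<close>

definition weak_conv_along :: "('b \<Rightarrow> real measure) \<Rightarrow> real measure \<Rightarrow> 'b filter \<Rightarrow> bool" where
  "weak_conv_along P L F \<longleftrightarrow>
     (\<forall>t. isCont (cdf L) t \<longrightarrow> ((\<lambda>x. cdf (P x) t) \<longlongrightarrow> cdf L t) F)"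

lemma weak_conv_along_sequentially: "weak_conv_along P L sequentially \<longleftrightarrow> weak_conv_m P L"
  by (simp add: weak_conv_along_def weak_conv_m_def weak_conv_def)

text \<open>
  The second argument is the variance \<open>v \<ge> 0\<close>, whereas \<^const>\<open>normal_density\<close> takes
  the standard deviation; for \<open>v = 0\<close> the law is a point mass.
\<close>

definition normal_law :: "real \<Rightarrow> real \<Rightarrow> real measure" where
  "normal_law m v =
     (if v = 0 then return borel m
      else density lborel (\<lambda>x. ennreal (normal_density m (sqrt v) x)))"

text \<open>
  Throughout, \<open>X 1, X 2, \<dots>\<close> is the sequence from which the sums are formed, and \<open>X 0\<close> is the
  generic copy \<open>X\<close>. Points of the \<open>d\<close>-fold product space are functions in the carrier
  of \<open>Pi\<^sub>M {1..d} (\<lambda>_. S)\<close>, hence \<^const>\<open>undefined\<close> outside \<open>{1..d}\<close>.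
\<close>

definition U_sum :: "('s \<Rightarrow> real) \<Rightarrow> (nat \<Rightarrow> 'a \<Rightarrow> 's) \<Rightarrow> nat \<Rightarrow> 'a \<Rightarrow> real" where
  "U_sum f X n \<omega> = (\<Sum>i=1..n. f (X i \<omega>))"

definition increasing_tuples :: "nat \<Rightarrow> nat \<Rightarrow> (nat \<Rightarrow> nat) set" where
  "increasing_tuples d n = {i \<in> {1..d} \<rightarrow>\<^sub>E {1..n}. strict_mono_on {1..d} i}"

definition U_stat ::
    "nat \<Rightarrow> ((nat \<Rightarrow> 's) \<Rightarrow> real) \<Rightarrow> (nat \<Rightarrow> 'a \<Rightarrow> 's) \<Rightarrow> nat \<Rightarrow> 'a \<Rightarrow> real" where
  "U_stat d g X n \<omega> = (\<Sum>i\<in>increasing_tuples d n. g (\<lambda>k\<in>{1..d}. X (i k) \<omega>))"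

definition U_mean ::
    "'a measure \<Rightarrow> nat \<Rightarrow> ((nat \<Rightarrow> 's) \<Rightarrow> real) \<Rightarrow> (nat \<Rightarrow> 'a \<Rightarrow> 's) \<Rightarrow> real" where
  "U_mean M d g X = integral\<^sup>L M (\<lambda>\<omega>. g (\<lambda>k\<in>{1..d}. X k \<omega>))"

definition U_proj ::
    "'a measure \<Rightarrow> nat \<Rightarrow> ((nat \<Rightarrow> 's) \<Rightarrow> real) \<Rightarrow> (nat \<Rightarrow> 'a \<Rightarrow> 's) \<Rightarrow> nat \<Rightarrow> 's \<Rightarrow> real" where
  "U_proj M d g X i x =
     integral\<^sup>L M (\<lambda>\<omega>. g (\<lambda>k\<in>{1..d}. if k = i then x else X k \<omega>)) - U_mean M d g X"

text \<open>
  Supremum and infimum are taken in \<^typ>\<open>enat\<close>, so that \<open>Sup\<close> of an unbounded set and \<open>Inf\<close> of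
  the empty set are \<open>\<infinity>\<close>. When \<open>f (X 0)\<close> has positive mean this happens with probability 0,
  so the arbitrary value of \<^term>\<open>the_enat \<infinity>\<close> does not matter.
\<close>

definition N_minus :: "('s \<Rightarrow> real) \<Rightarrow> (nat \<Rightarrow> 'a \<Rightarrow> 's) \<Rightarrow> real \<Rightarrow> 'a \<Rightarrow> enat" where
  "N_minus f X x \<omega> = Sup (enat ` {n. U_sum f X n \<omega> \<le> x})"

definition N_plus :: "('s \<Rightarrow> real) \<Rightarrow> (nat \<Rightarrow> 'a \<Rightarrow> 's) \<Rightarrow> real \<Rightarrow> 'a \<Rightarrow> enat" where
  "N_plus f X x \<omega> = Inf (enat ` {n. U_sum f X n \<omega> > x})"

definition gamma_sq ::
    "'a measure \<Rightarrow> nat \<Rightarrow> ('s \<Rightarrow> real) \<Rightarrow> ((nat \<Rightarrow> 's) \<Rightarrow> real) \<Rightarrow> (nat \<Rightarrow> 'a \<Rightarrow> 's) \<Rightarrow> real" where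
  "gamma_sq M d f g X =
    (let \<mu> = integral\<^sup>L M (\<lambda>\<omega>. f (X 0 \<omega>));
         \<nu> = U_mean M d g X;
         h = (\<lambda>i \<omega>. U_proj M d g X i (X 0 \<omega>))
     in \<mu> powi (1 - 2 * int d) *
          (\<Sum>i=1..d. \<Sum>j=1..d.
             fact (i + j - 2) * fact (2 * d - i - j) /
             (fact (i - 1) * fact (j - 1) * fact (d - i) * fact (d - j) * fact (2 * d - 1)) *
             covariance M (h i) (h j))
        - 2 * (\<mu> powi (- 2 * int d) * \<nu> / (fact (d - 1) * fact d)) *
          (\<Sum>i=1..d. covariance M (\<lambda>\<omega>. f (X 0 \<omega>)) (h i))
        + \<mu> powi (- 2 * int d - 1) * \<nu>\<^sup>2 / (fact (d - 1))\<^sup>2 *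
          prob_space.variance M (\<lambda>\<omega>. f (X 0 \<omega>)))"

end

theory Submission
  imports Defs "HOL-Real_Asymp.Real_Asymp"
begin

text \<open>
  Put \<open>\<kappa> = \<nu> / \<mu>\<close> and \<open>g* = g - \<kappa> * (\<Sum>l. f (x l))\<close>. Then \<open>U_stat g = U_stat g* + \<kappa> * (n-1 choose d-1) * U_n\<close>
  exactly, and \<open>U_N\<close> equals \<open>x\<close> up to the overshoot, which is \<open>o(sqrt x)\<close> in probability. Moreover \<open>N\<close>
  lies within \<open>O(sqrt x)\<close> of \<open>y = x / \<mu>\<close> (Hajek--Renyi), and the remaining deterministic terms
  are stationary at \<open>n = y\<close>, so that they contribute only \<open>O(x ^ (d - 1))\<close>. Hence everything
  reduces to the centred U-statistic of \<open>g*\<close> at the random index \<open>N\<close>. There \<open>N\<close> may be replaced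
  by \<open>\<lfloor>y\<rfloor>\<close>: for a nonnegative kernel the U-statistic is monotone in \<open>n\<close>, so a bounded
  number of grid points and Chebyshev's inequality suffice. At the deterministic index the central
  limit theorem follows from the Hoeffding--Hajek projection and the triangular array CLT.
  The weights of the projection converge to Bernstein polynomials, so the limiting variance is
  the integral over \<open>[0, 1]\<close> of a squared Bernstein sum with coefficients \<open>g*\<^sub>i(X)\<close>,
  which vanishes only if all these coefficients do.
\<close>

section \<open>Counting increasing tuples\<close>

text \<open>The obstacle is that N is built from the same variables as the statistic, so a limit
  theorem at fixed n cannot simply be evaluated at N. The subtracted sum is the device against this:
  each index lies in (n-1 choose d-1) of the tuples, so the sum contributes a deterministic multiple
  of \<open>U_n\<close>, and at N the value of \<open>U_n\<close> is known up to one overshoot. This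
  removes the fluctuation of N to first order without a joint limit law. The value of kappa is
  forced. For general kappa the deterministic part is (nu - d kappa mu) (n choose d) + kappa mu y
  (n-1 choose d-1), whose derivative at n = y is (nu - kappa mu) y^(d-1) / (d-1)! to leading order.
  It vanishes exactly for kappa = nu / mu. As f may be negative, the walk can cross the level x many
  times. Hence all indices beyond y + K sqrt y must be controlled at once, which is why the maximal
  inequality carries decreasing weights.\<close>

lemma increasing_tuples_finite: "finite (increasing_tuples d n)"
  unfolding increasing_tuples_def
  by (rule finite_subset[of _ "{1..d} \<rightarrow>\<^sub>E {1..n}"]) (auto intro: finite_PiE)

lemma finite_tuples: "finite {J \<in> {1..d} \<rightarrow>\<^sub>E {1..n::nat}. Q J}"
  for d :: nat
  by (rule finite_subset[of _ "{1..d} \<rightarrow>\<^sub>E {1..n}"]) (auto intro!: finite_PiE)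

lemma increasing_tuples_0: "increasing_tuples 0 n = {\<lambda>_. undefined}"
  by (auto simp: increasing_tuples_def strict_mono_on_def)

lemma increasing_tuples_Suc_0: "increasing_tuples (Suc d) 0 = {}"
  by (auto simp: increasing_tuples_def PiE_eq_empty_iff)

lemma increasing_tuples_mem:
  assumes "I \<in> increasing_tuples d n" "k \<in> {1..d}"
  shows "I k \<in> {1..n}"
  using assms by (auto simp: increasing_tuples_def PiE_iff)

lemma increasing_tuples_inj:
  assumes "I \<in> increasing_tuples d n"
  shows "inj_on I {1..d}"
  using assms strict_mono_on_imp_inj_on by (auto simp: increasing_tuples_def)

lemma increasing_tuples_mono:
  assumes "m \<le> n" shows "increasing_tuples d m \<subseteq> increasing_tuples d n"
proof -
  have "{1..d} \<rightarrow>\<^sub>E {1..m} \<subseteq> {1..d} \<rightarrow>\<^sub>E {1..n}"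
    using assms by (intro PiE_mono) auto
  then show ?thesis by (auto simp: increasing_tuples_def)
qed

text \<open>The last entry of an increasing tuple is its largest, so it alone decides whether
  \<open>Suc n\<close> occurs.\<close>

lemma increasing_tuples_Suc:
  "increasing_tuples (Suc d) (Suc n) =
     increasing_tuples (Suc d) n \<union> (\<lambda>I. I(Suc d := Suc n)) ` increasing_tuples d n"
proof (intro equalityI subsetI)
  fix I assume I: "I \<in> increasing_tuples (Suc d) (Suc n)"
  then have mono: "strict_mono_on {1..Suc d} I" and E: "I \<in> {1..Suc d} \<rightarrow>\<^sub>E {1..Suc n}"
    by (auto simp: increasing_tuples_def)
  have lt: "I k < I (Suc d)" if "k \<in> {1..d}" for k
    using mono that by (auto simp: strict_mono_on_def)
  show "I \<in> increasing_tuples (Suc d) n \<union> (\<lambda>I. I(Suc d := Suc n)) ` increasing_tuples d n"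
  proof (cases "I (Suc d) = Suc n")
    case False
    then have le: "I (Suc d) \<le> n" using E by (auto simp: PiE_iff le_Suc_eq)
    have "I k \<in> {1..n}" if "k \<in> {1..Suc d}" for k
    proof (cases "k = Suc d")
      case True then show ?thesis using le E by (auto simp: PiE_iff)
    next
      case False
      then have "k \<in> {1..d}" using that by auto
      then show ?thesis using lt[of k] le E by (auto simp: PiE_iff)
    qed
    then have "I \<in> increasing_tuples (Suc d) n"
      using mono E by (auto simp: increasing_tuples_def PiE_iff)
    then show ?thesis by blast
  next
    case True
    \<comment> \<open>Tuples are extensional functions, so the deleted position has to become
      \<open>undefined\<close>.\<close>
    define I' where "I' = I(Suc d := undefined)"
    have "I' \<in> {1..d} \<rightarrow>\<^sub>E {1..n}"
      using lt True E by (auto simp: I'_def PiE_iff extensional_def less_Suc_eq_le)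
    moreover have "strict_mono_on {1..d} I'"
      using mono by (auto simp: I'_def strict_mono_on_def)
    ultimately have "I' \<in> increasing_tuples d n" by (auto simp: increasing_tuples_def)
    moreover have "I = I'(Suc d := Suc n)" using True by (auto simp: I'_def)
    ultimately show ?thesis by blast
  qed
next
  fix I assume "I \<in> increasing_tuples (Suc d) n \<union> (\<lambda>I. I(Suc d := Suc n)) ` increasing_tuples d n"
  then show "I \<in> increasing_tuples (Suc d) (Suc n)"
  proof
    assume "I \<in> increasing_tuples (Suc d) n"
    then show ?thesis using increasing_tuples_mono[of n "Suc n"] by auto
  next
    assume "I \<in> (\<lambda>I. I(Suc d := Suc n)) ` increasing_tuples d n"
    then obtain J where J: "J \<in> increasing_tuples d n" and IJ: "I = J(Suc d := Suc n)" by auto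
    have bound: "J k < Suc n" if "k \<in> {1..d}" for k
      using increasing_tuples_mem[OF J that] by auto
    have "J \<in> {1..d} \<rightarrow>\<^sub>E {1..n}" and "strict_mono_on {1..d} J"
      using J by (auto simp: increasing_tuples_def)
    then have "I \<in> {1..Suc d} \<rightarrow>\<^sub>E {1..Suc n}"
      unfolding IJ by (auto simp: PiE_iff extensional_def le_Suc_eq)
    moreover have "strict_mono_on {1..Suc d} I"
      unfolding IJ
    proof (rule strict_mono_onI)
      fix r s assume rs: "r \<in> {1..Suc d}" "s \<in> {1..Suc d}" "r < s"
      then have r: "r \<in> {1..d}" by auto
      show "(J(Suc d := Suc n)) r < (J(Suc d := Suc n)) s"
      proof (cases "s = Suc d")
        case True
        then show ?thesis using bound[OF r] r by auto
      next
        case False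
        then show ?thesis
          using strict_mono_onD[OF \<open>strict_mono_on {1..d} J\<close> r, of s] rs r by auto
      qed
    qed
    ultimately show ?thesis by (simp add: increasing_tuples_def)
  qed
qed

lemma sum_increasing_tuples_Suc:
  fixes F :: "(nat \<Rightarrow> nat) \<Rightarrow> 'b::comm_monoid_add"
  shows "(\<Sum>I\<in>increasing_tuples (Suc d) (Suc n). F I) =
     (\<Sum>I\<in>increasing_tuples (Suc d) n. F I) + (\<Sum>I\<in>increasing_tuples d n. F (I(Suc d := Suc n)))"
proof -
  have disj: "increasing_tuples (Suc d) n \<inter> (\<lambda>I. I(Suc d := Suc n)) ` increasing_tuples d n = {}"
  proof -
    have "I (Suc d) \<le> n" if "I \<in> increasing_tuples (Suc d) n" for I
      using increasing_tuples_mem[OF that, of "Suc d"] by auto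
    then show ?thesis by force
  qed
  have inj: "inj_on (\<lambda>I. I(Suc d := Suc n)) (increasing_tuples d n)"
  proof (rule inj_onI)
    fix I J assume *: "I \<in> increasing_tuples d n" "J \<in> increasing_tuples d n"
      "I(Suc d := Suc n) = J(Suc d := Suc n)"
    \<comment> \<open>Both values are \<open>undefined\<close>, because \<open>Suc d\<close> lies
      outside the domain \<open>{1..d}\<close>.\<close>
    have "I (Suc d) = J (Suc d)"
      using *(1,2) by (auto simp: increasing_tuples_def PiE_iff extensional_def)
    with *(3) show "I = J" by (metis fun_upd_idem_iff fun_upd_upd)
  qed
  show ?thesis
    unfolding increasing_tuples_Suc
    by (subst sum.union_disjoint)
       (auto simp: increasing_tuples_finite disj sum.reindex[OF inj])
qed

lemma card_increasing_tuples: "card (increasing_tuples d n) = n choose d"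
proof -
  have "(\<Sum>I\<in>increasing_tuples d n. 1::nat) = n choose d"
  proof (induction n arbitrary: d)
    case 0
    show ?case by (cases d) (auto simp: increasing_tuples_0 increasing_tuples_Suc_0)
  next
    case (Suc n)
    show ?case
    proof (cases d)
      case 0
      then show ?thesis by (simp add: increasing_tuples_0)
    next
      case (Suc d')
      then show ?thesis using Suc.IH by (simp only: sum_increasing_tuples_Suc binomial_Suc_Suc)
    qed
  qed
  then show ?thesis by simp
qed

text \<open>Fixing entry \<open>l\<close> at \<open>m\<close> leaves an increasing choice of
  \<open>l - 1\<close> values below \<open>m\<close> and of \<open>d - l\<close> values above it.
  The induction on \<open>n\<close> reproduces this through Pascal's rule in the second
  factor.\<close>

lemma card_increasing_tuples_at:
  assumes "1 \<le> l" "l \<le> d" "1 \<le> m" "m \<le> n"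
  shows "(\<Sum>I\<in>increasing_tuples d n. of_bool (I l = m) :: nat)
       = ((m - 1) choose (l - 1)) * ((n - m) choose (d - l))"
  using assms
proof (induction n arbitrary: d)
  case 0
  then show ?case by simp
next
  case (Suc n)
  then obtain d' where d: "d = Suc d'" by (cases d) auto
  have rec: "(\<Sum>I\<in>increasing_tuples d (Suc n). of_bool (I l = m) :: nat) =
     (\<Sum>I\<in>increasing_tuples d n. of_bool (I l = m))
     + (\<Sum>I\<in>increasing_tuples d' n. of_bool ((I(Suc d' := Suc n)) l = m))"
    unfolding d by (rule sum_increasing_tuples_Suc)
  show ?case
  \<comment> \<open>The value \<open>Suc n\<close> can only sit in the last position; for
    \<open>l < d\<close> both sides vanish because 0 choose (d - l) is 0.\<close>
  proof (cases "m = Suc n")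
    case True
    have *: "I l \<noteq> Suc n" if "I \<in> increasing_tuples d n" "l \<le> d" for I d
      using increasing_tuples_mem[OF that(1), of l] that Suc.prems(1) by auto
    have z: "(\<Sum>I\<in>increasing_tuples d n. of_bool (I l = m) :: nat) = 0"
      using * Suc.prems True by auto
    show ?thesis
    proof (cases "l = d")
      case True
      then show ?thesis using rec z \<open>m = Suc n\<close> by (simp add: d card_increasing_tuples)
    next
      case False
      then have l: "l \<le> d'" using Suc.prems d by auto
      have "(\<Sum>I\<in>increasing_tuples d' n. of_bool ((I(Suc d' := Suc n)) l = m) :: nat) = 0"
        using l * \<open>m = Suc n\<close> by auto
      then show ?thesis using rec z \<open>m = Suc n\<close> l d by (simp add: binomial_eq_0)
    qed
  next
    case False
    then have mn: "m \<le> n" using Suc.prems by auto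
    note IH1 = Suc.IH[OF Suc.prems(1,2,3) mn]
    show ?thesis
    proof (cases "l = d")
      case True
      then have "(\<Sum>I\<in>increasing_tuples d' n. of_bool ((I(Suc d' := Suc n)) l = m) :: nat) = 0"
        using d mn by auto
      then show ?thesis using rec IH1 True by simp
    next
      case False
      then have l: "l \<le> d'" using Suc.prems d by auto
      have "(\<Sum>I\<in>increasing_tuples d' n. of_bool ((I(Suc d' := Suc n)) l = m) :: nat)
        = (\<Sum>I\<in>increasing_tuples d' n. of_bool (I l = m))"
        using l by (intro sum.cong) auto
      also have "\<dots> = ((m - 1) choose (l - 1)) * ((n - m) choose (d' - l))"
        by (rule Suc.IH[OF Suc.prems(1) l Suc.prems(3) mn])
      finally have "(\<Sum>I\<in>increasing_tuples d (Suc n). of_bool (I l = m) :: nat)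
        = ((m - 1) choose (l - 1)) * (((n - m) choose (d - l)) + ((n - m) choose (d' - l)))"
        using rec IH1 by (simp add: algebra_simps)
      also have "((n - m) choose (d - l)) + ((n - m) choose (d' - l)) = (Suc n - m) choose (d - l)"
        using l d mn by (simp add: Suc_diff_le)
      finally show ?thesis .
    qed
  qed
qed

text \<open>Counts the increasing (p+q+1)-tuples according to the value \<open>m\<close> of entry
  \<open>p + 1\<close>.\<close>

lemma sum_binomial_mult_binomial:
  "(\<Sum>m=1..n. ((m - 1) choose p) * ((n - m) choose q)) = n choose (p + q + 1)"
proof -
  let ?T = "increasing_tuples (p + q + 1) n"
  have "(\<Sum>m=1..n. ((m - 1) choose p) * ((n - m) choose q))
      = (\<Sum>m=1..n. \<Sum>I\<in>?T. of_bool (I (p + 1) = m))"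
    by (intro sum.cong refl, subst card_increasing_tuples_at) auto
  also have "\<dots> = (\<Sum>I\<in>?T. \<Sum>m=1..n. of_bool (I (p + 1) = m))"
    by (rule sum.swap)
  also have "\<dots> = (\<Sum>I\<in>?T. 1)"
  proof (intro sum.cong refl)
    fix I assume "I \<in> ?T"
    from increasing_tuples_mem[OF this, of "p + 1"] have "I (p + 1) \<in> {1..n}" by auto
    then show "(\<Sum>m=1..n. of_bool (I (p + 1) = m)) = (1::nat)"
      by (simp add: of_bool_def sum.delta')
  qed
  also have "\<dots> = n choose (p + q + 1)" by (simp add: card_increasing_tuples)
  finally show ?thesis .
qed

text \<open>Vandermonde's identity; both sides count the tuples that contain \<open>m\<close> at
  some position.\<close>

lemma sum_binomial_position:
  assumes "1 \<le> d" "1 \<le> m" "m \<le> n"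
  shows "(\<Sum>l=1..d. ((m - 1) choose (l - 1)) * ((n - m) choose (d - l))) = (n - 1) choose (d - 1)"
proof -
  have "(\<Sum>l=1..d. ((m - 1) choose (l - 1)) * ((n - m) choose (d - l)))
    = (\<Sum>k\<le>d-1. ((m - 1) choose k) * ((n - m) choose (d - 1 - k)))"
    by (rule sum.reindex_bij_witness[of _ Suc "\<lambda>l. l - 1"]) (use assms in auto)
  also have "\<dots> = (m - 1 + (n - m)) choose (d - 1)" by (rule vandermonde)
  finally show ?thesis using assms by simp
qed

text \<open>Regrouping by observation turns a sum over dependent tuples into a sum over single
  indices \<open>m\<close>. It yields both the Hajek projection and the multiple of
  \<open>U_sum\<close> carried by the shifted kernel.\<close>

lemma sum_over_positions:
  fixes F :: "nat \<Rightarrow> nat \<Rightarrow> real"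
  shows "(\<Sum>I\<in>increasing_tuples d n. \<Sum>l=1..d. F l (I l))
    = (\<Sum>m=1..n. \<Sum>l=1..d. real (((m - 1) choose (l - 1)) * ((n - m) choose (d - l))) * F l m)"
proof -
  have "(\<Sum>I\<in>increasing_tuples d n. \<Sum>l=1..d. F l (I l))
    = (\<Sum>l=1..d. \<Sum>I\<in>increasing_tuples d n. \<Sum>m=1..n. of_bool (I l = m) * F l m)"
    unfolding sum.swap[of _ "{1..d}"]
  proof (intro sum.cong refl)
    fix I l assume "I \<in> increasing_tuples d n" "l \<in> {1..d}"
    from increasing_tuples_mem[OF this] have "I l \<in> {1..n}" .
    then have "(\<Sum>m=1..n. of_bool (I l = m) * F l m) = (\<Sum>m=1..n. if I l = m then F l m else 0)"
      by (intro sum.cong) auto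
    also have "\<dots> = F l (I l)" using \<open>I l \<in> {1..n}\<close> by (simp add: sum.delta)
    finally show "F l (I l) = (\<Sum>m=1..n. of_bool (I l = m) * F l m)" ..
  qed
  also have "\<dots> = (\<Sum>l=1..d. \<Sum>m=1..n. (\<Sum>I\<in>increasing_tuples d n. of_bool (I l = m)) * F l m)"
    by (intro sum.cong refl, subst sum.swap) (simp only: sum_distrib_right)
  also have "\<dots> = (\<Sum>l=1..d. \<Sum>m=1..n. real (((m - 1) choose (l - 1)) * ((n - m) choose (d - l))) * F l m)"
  proof (intro sum.cong refl)
    fix l m assume "l \<in> {1..d}" "m \<in> {1..n}"
    then have "(\<Sum>I\<in>increasing_tuples d n. of_bool (I l = m) :: nat)
       = ((m - 1) choose (l - 1)) * ((n - m) choose (d - l))"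
      by (intro card_increasing_tuples_at) auto
    from arg_cong[OF this, of real]
    show "(\<Sum>I\<in>increasing_tuples d n. of_bool (I l = m)) * F l m
       = real (((m - 1) choose (l - 1)) * ((n - m) choose (d - l))) * F l m"
      by (simp only: of_nat_sum of_nat_of_bool)
  qed
  also have "\<dots> = (\<Sum>m=1..n. \<Sum>l=1..d. real (((m - 1) choose (l - 1)) * ((n - m) choose (d - l))) * F l m)"
    by (rule sum.swap)
  finally show ?thesis .
qed

section \<open>Bounds for the number of pairs of tuples that share indices\<close>

lemma card_PiE_prescribed:
  assumes "B \<subseteq> {1..d::nat}"
  shows "card {J \<in> {1..d} \<rightarrow>\<^sub>E {1..n::nat}. \<forall>b\<in>B. J b \<in> A b} \<le> n ^ (d - card B) * (\<Prod>b\<in>B. card (A b \<inter> {1..n}))"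
proof -
  have fin: "finite B" using assms finite_subset by blast
  \<comment> \<open>Without monotonicity the set is a box, whose size is a product over coordinates;
    each coordinate outside \<open>B\<close> gives a factor \<open>n\<close>.\<close>
  have "{J \<in> {1..d} \<rightarrow>\<^sub>E {1..n}. \<forall>b\<in>B. J b \<in> A b}
      = (\<Pi>\<^sub>E k\<in>{1..d}. (if k \<in> B then A k else UNIV) \<inter> {1..n})"
  proof (rule set_eqI)
    fix J
    have "(\<forall>b\<in>B. J b \<in> A b) \<longleftrightarrow> (\<forall>k\<in>{1..d}. k \<in> B \<longrightarrow> J k \<in> A k)"
      using assms by blast
    moreover have "J k \<in> (if k \<in> B then A k else UNIV) \<longleftrightarrow> (k \<in> B \<longrightarrow> J k \<in> A k)" for k
      by simp
    ultimately show "J \<in> {J \<in> {1..d} \<rightarrow>\<^sub>E {1..n}. \<forall>b\<in>B. J b \<in> A b} \<longleftrightarrow>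
        J \<in> (\<Pi>\<^sub>E k\<in>{1..d}. (if k \<in> B then A k else UNIV) \<inter> {1..n})"
      unfolding PiE_iff by blast
  qed
  then have "card {J \<in> {1..d} \<rightarrow>\<^sub>E {1..n}. \<forall>b\<in>B. J b \<in> A b}
      = (\<Prod>k\<in>{1..d}. card ((if k \<in> B then A k else UNIV) \<inter> {1..n}))"
    by (simp add: card_PiE)
  also have "\<dots> = (\<Prod>k\<in>B. card ((if k \<in> B then A k else UNIV) \<inter> {1..n}))
      * (\<Prod>k\<in>{1..d} - B. card ((if k \<in> B then A k else UNIV) \<inter> {1..n}))"
    using assms fin by (simp add: prod.subset_diff mult.commute)
  also have "(\<Prod>k\<in>{1..d} - B. card ((if k \<in> B then A k else UNIV) \<inter> {1..n})) = n ^ (d - card B)"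
    using assms fin by (simp add: card_Diff_subset)
  also have "(\<Prod>k\<in>B. card ((if k \<in> B then A k else UNIV) \<inter> {1..n})) = (\<Prod>b\<in>B. card (A b \<inter> {1..n}))"
    by (intro prod.cong) auto
  finally show ?thesis by (simp add: mult.commute)
qed

lemma card_increasing_tuples_prescribed:
  assumes "B \<subseteq> {1..d}"
  shows "card {J \<in> increasing_tuples d n. \<forall>b\<in>B. J b = \<phi> b} \<le> n ^ (d - card B)"
proof -
  have "card {J \<in> increasing_tuples d n. \<forall>b\<in>B. J b = \<phi> b}
      \<le> card {J \<in> {1..d} \<rightarrow>\<^sub>E {1..n}. \<forall>b\<in>B. J b \<in> {\<phi> b}}"
    by (intro card_mono finite_tuples) (auto simp: increasing_tuples_def)
  also have "\<dots> \<le> n ^ (d - card B) * (\<Prod>b\<in>B. card ({\<phi> b} \<inter> {1..n}))"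
    by (rule card_PiE_prescribed[OF assms])
  also have "\<dots> \<le> n ^ (d - card B) * 1"
  proof (intro mult_left_mono prod_le_1)
    fix b assume "b \<in> B"
    show "0 \<le> card ({\<phi> b} \<inter> {1..n}) \<and> card ({\<phi> b} \<inter> {1..n}) \<le> 1"
      using card_mono[of "{\<phi> b}" "{\<phi> b} \<inter> {1..n}"] by simp
  qed auto
  finally show ?thesis by simp
qed

text \<open>A tuple that is new between \<open>m\<close> and \<open>n\<close> must have its largest
  entry, the last one, above \<open>m\<close>.\<close>

lemma card_increasing_tuples_diff:
  assumes "1 \<le> d" "m \<le> n"
  shows "card (increasing_tuples d n - increasing_tuples d m) \<le> (n - m) * n ^ (d - 1)"
proof -
  have "increasing_tuples d n - increasing_tuples d m
      \<subseteq> {J \<in> {1..d} \<rightarrow>\<^sub>E {1..n}. \<forall>b\<in>{d}. J b \<in> {m<..n}}"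
  proof
    fix I assume I: "I \<in> increasing_tuples d n - increasing_tuples d m"
    then have E: "I \<in> {1..d} \<rightarrow>\<^sub>E {1..n}" and mono: "strict_mono_on {1..d} I"
      by (auto simp: increasing_tuples_def)
    have le: "I k \<le> I d" if "k \<in> {1..d}" for k
      using strict_mono_on_leD[OF mono, of k d] that assms by auto
    have "\<not> I d \<le> m"
    proof
      assume "I d \<le> m"
      then have "I \<in> {1..d} \<rightarrow>\<^sub>E {1..m}"
        using E order_trans[OF le] by (auto simp: PiE_iff)
      then show False using I mono by (auto simp: increasing_tuples_def)
    qed
    then show "I \<in> {J \<in> {1..d} \<rightarrow>\<^sub>E {1..n}. \<forall>b\<in>{d}. J b \<in> {m<..n}}"
      using E assms by (auto simp: PiE_iff)
  qed
  then have "card (increasing_tuples d n - increasing_tuples d m)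
      \<le> card {J \<in> {1..d} \<rightarrow>\<^sub>E {1..n}. \<forall>b\<in>{d}. J b \<in> {m<..n}}"
    by (intro card_mono finite_tuples)
  also have "\<dots> \<le> n ^ (d - card {d}) * (\<Prod>b\<in>{d}. card ({m<..n} \<inter> {1..n}))"
    by (rule card_PiE_prescribed) (use assms in auto)
  also have "{m<..n} \<inter> {1..n} = {m<..n}" by auto
  finally show ?thesis by (simp add: mult.commute)
qed

text \<open>A common value means \<open>I a = J b\<close> for one of d^2 pairs of positions, and
  then \<open>J\<close> has only \<open>d - 1\<close> free entries.\<close>

lemma card_meeting_pairs:
  assumes "T \<subseteq> increasing_tuples d n"
  shows "card {(I, J) \<in> T \<times> T. I ` {1..d} \<inter> J ` {1..d} \<noteq> {}} \<le> d\<^sup>2 * (card T * n ^ (d - 1))"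
proof -
  have fT: "finite T" using assms increasing_tuples_finite finite_subset by blast
  let ?P = "\<lambda>(a, b). SIGMA I:T. {J \<in> increasing_tuples d n. \<forall>b'\<in>{b}. J b' = I a}"
  have "{(I, J) \<in> T \<times> T. I ` {1..d} \<inter> J ` {1..d} \<noteq> {}} \<subseteq> (\<Union>p\<in>{1..d} \<times> {1..d}. ?P p)"
  proof
    fix p assume "p \<in> {(I, J) \<in> T \<times> T. I ` {1..d} \<inter> J ` {1..d} \<noteq> {}}"
    then obtain I J where p: "p = (I, J)" "I \<in> T" "J \<in> T" "I ` {1..d} \<inter> J ` {1..d} \<noteq> {}"
      by auto
    then obtain a b where ab: "a \<in> {1..d}" "b \<in> {1..d}" "I a = J b" by fastforce
    then show "p \<in> (\<Union>p\<in>{1..d} \<times> {1..d}. ?P p)"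
      using assms p by (intro UN_I[of "(a, b)"]) auto
  qed
  moreover have "finite (\<Union>p\<in>{1..d} \<times> {1..d}. ?P p)"
    by (rule finite_subset[of _ "T \<times> increasing_tuples d n"]) (auto simp: fT increasing_tuples_finite)
  ultimately have "card {(I, J) \<in> T \<times> T. I ` {1..d} \<inter> J ` {1..d} \<noteq> {}} \<le> card (\<Union>p\<in>{1..d} \<times> {1..d}. ?P p)"
    by (intro card_mono)
  also have "\<dots> \<le> (\<Sum>p\<in>{1..d} \<times> {1..d}. card (?P p))"
    by (rule card_UN_le) auto
  also have "\<dots> \<le> (\<Sum>p\<in>{1..d} \<times> {1..d}. card T * n ^ (d - 1))"
  proof (intro sum_mono)
    fix p assume p: "p \<in> {1..d} \<times> {1..d}"
    obtain a b where ab: "p = (a, b)" by (cases p)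
    have "card (?P p) = (\<Sum>I\<in>T. card {J \<in> increasing_tuples d n. \<forall>b'\<in>{b}. J b' = I a})"
      unfolding ab by (simp add: card_SigmaI fT increasing_tuples_finite)
    also have "\<dots> \<le> (\<Sum>I\<in>T. n ^ (d - card {b}))"
      using p ab by (intro sum_mono card_increasing_tuples_prescribed) auto
    finally show "card (?P p) \<le> card T * n ^ (d - 1)" by simp
  qed
  finally show ?thesis by (simp add: power2_eq_square)
qed

text \<open>Two common values leave \<open>J\<close> only \<open>d - 2\<close> free entries. The
  resulting order n^(2d-2) is one below the order n^(2d-1) of the variance, which makes the
  degenerate part negligible.\<close>

lemma card_twice_meeting_pairs:
  "card {(I, J) \<in> increasing_tuples d n \<times> increasing_tuples d n. card (I ` {1..d} \<inter> J ` {1..d}) \<ge> 2}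
     \<le> d ^ 4 * n ^ (2 * d - 2)"
proof (cases "d \<ge> 2")
  case False
  have "card (I ` {1..d} \<inter> J ` {1..d}) < 2" for I J :: "nat \<Rightarrow> nat"
  proof -
    have "card (I ` {1..d} \<inter> J ` {1..d}) \<le> card (I ` {1..d})" by (intro card_mono) auto
    also have "\<dots> \<le> d" using card_image_le[of "{1..d}" I] by simp
    finally show ?thesis using False by simp
  qed
  then have "{(I, J) \<in> increasing_tuples d n \<times> increasing_tuples d n. card (I ` {1..d} \<inter> J ` {1..d}) \<ge> 2} = {}"
    by (auto simp: not_le[symmetric])
  then show ?thesis by (metis card.empty le0)
next
  case True
  let ?T = "increasing_tuples d n"
  let ?D = "{1..d} \<times> {1..d} \<times> {1..d} \<times> {1..d}"
  \<comment> \<open>Two distinct common values occupy two distinct positions \<open>b\<close> and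
    \<open>b'\<close> of \<open>J\<close>, so the case \<open>b = b'\<close> may be left
    empty.\<close>
  let ?P = "\<lambda>(a, a', b, b'). if b = b' then {} else
     SIGMA I:?T. {J \<in> ?T. \<forall>c\<in>{b, b'}. J c = (if c = b then I a else I a')}"
  have "{(I, J) \<in> ?T \<times> ?T. card (I ` {1..d} \<inter> J ` {1..d}) \<ge> 2} \<subseteq> (\<Union>p\<in>?D. ?P p)"
  proof safe
    fix I J assume IJ: "I \<in> ?T" "J \<in> ?T" and c: "2 \<le> card (I ` {1..d} \<inter> J ` {1..d})"
    obtain u v where uv: "u \<in> I ` {1..d} \<inter> J ` {1..d}" "v \<in> I ` {1..d} \<inter> J ` {1..d}" "u \<noteq> v"
      using card_le_Suc0_iff_eq[of "I ` {1..d} \<inter> J ` {1..d}"] c by force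
    then obtain a a' b b' where "a \<in> {1..d}" "a' \<in> {1..d}" "b \<in> {1..d}" "b' \<in> {1..d}"
      "u = I a" "u = J b" "v = I a'" "v = J b'" by blast
    then show "(I, J) \<in> (\<Union>p\<in>?D. ?P p)"
      using IJ uv by (intro UN_I[of "(a, a', b, b')"]) auto
  qed
  moreover have "finite (\<Union>p\<in>?D. ?P p)"
    by (rule finite_subset[of _ "?T \<times> ?T"]) (auto simp: increasing_tuples_finite split: if_splits)
  ultimately have "card {(I, J) \<in> ?T \<times> ?T. card (I ` {1..d} \<inter> J ` {1..d}) \<ge> 2} \<le> card (\<Union>p\<in>?D. ?P p)"
    by (intro card_mono)
  also have "\<dots> \<le> (\<Sum>p\<in>?D. card (?P p))"
    by (rule card_UN_le) auto
  also have "\<dots> \<le> (\<Sum>p\<in>?D. n ^ (2 * d - 2))"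
  proof (intro sum_mono)
    fix p assume p: "p \<in> ?D"
    obtain a a' b b' where ab: "p = (a, a', b, b')" by (cases p) auto
    show "card (?P p) \<le> n ^ (2 * d - 2)"
    proof (cases "b = b'")
      case False
      have "card (?P p) = (\<Sum>I\<in>?T. card {J \<in> ?T. \<forall>c\<in>{b, b'}. J c = (if c = b then I a else I a')})"
        unfolding ab using False by (simp add: card_SigmaI increasing_tuples_finite)
      also have "\<dots> \<le> (\<Sum>I\<in>?T. n ^ (d - card {b, b'}))"
        using p ab by (intro sum_mono card_increasing_tuples_prescribed) auto
      also have "card {b, b'} = 2" using False by simp
      also have "(\<Sum>I\<in>?T. n ^ (d - 2)) = card ?T * n ^ (d - 2)" by simp
      also have "\<dots> \<le> n ^ d * n ^ (d - 2)"
        using card_increasing_tuples_prescribed[of "{}" d n] by (intro mult_right_mono) auto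
      also have "\<dots> = n ^ (2 * d - 2)"
        using True by (simp add: power_add[symmetric] mult_2)
      finally show ?thesis .
    qed (auto simp: ab)
  qed
  finally show ?thesis by (simp add: numeral_eq_Suc mult.assoc)
qed

section \<open>The Bernstein quadratic form\<close>

text \<open>Euler's Beta integral at integer arguments. The induction rests on t^a (1-t)^(b+1) = t^a
  (1-t)^b - t^(a+1) (1-t)^b.\<close>

lemma has_integral_beta_nat:
  "((\<lambda>t::real. t ^ a * (1 - t) ^ b) has_integral fact a * fact b / fact (a + b + 1)) {0..1}"
proof (induction b arbitrary: a)
  case 0
  have "((\<lambda>t::real. t ^ a) has_integral 1 ^ (a + 1) / real (a + 1) - 0 ^ (a + 1) / real (a + 1)) {0..1}"
  proof (intro fundamental_theorem_of_calculus)
    fix x :: real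
    from DERIV_cdivide[OF DERIV_pow[of "a + 1" x "{0..1}"], of "real (a + 1)"]
    show "((\<lambda>t. t ^ (a + 1) / real (a + 1)) has_vector_derivative x ^ a) (at x within {0..1})"
      by (simp add: has_real_derivative_iff_has_vector_derivative[symmetric] del: of_nat_Suc)
  qed simp
  moreover have "fact a * fact 0 / fact (a + 0 + 1) = 1 / real (a + 1)"
    by (simp add: divide_simps)
  ultimately show ?case by simp
next
  case (Suc b)
  have "((\<lambda>t::real. t ^ a * (1 - t) ^ b - t ^ (a + 1) * (1 - t) ^ b) has_integral
      fact a * fact b / fact (a + b + 1) - fact (a + 1) * fact b / fact (a + 1 + b + 1)) {0..1}"
    by (intro has_integral_diff Suc.IH)
  also have "(\<lambda>t::real. t ^ a * (1 - t) ^ b - t ^ (a + 1) * (1 - t) ^ b) = (\<lambda>t. t ^ a * (1 - t) ^ Suc b)"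
    by (simp add: fun_eq_iff algebra_simps)
  also have "fact a * fact b / fact (a + b + 1) - fact (a + 1) * fact b / fact (a + 1 + b + 1)
     = (fact a * fact (Suc b) / fact (a + Suc b + 1) :: real)"
  proof -
    have f: "fact (a + b + 2) = (real a + real b + 2) * (fact (a + b + 1) :: real)"
      using fact_Suc[of "a + b + 1", where 'a=real] by (simp add: algebra_simps)
    have "fact (a + b + 1) \<noteq> (0::real)" "real a + real b + 2 \<noteq> 0" by auto
    then show ?thesis using f by (simp add: divide_simps) (simp add: algebra_simps)
  qed
  finally show ?case .
qed

text \<open>The function \<open>t \<mapsto> bern d i t\<close> is the limit of the normalised number of increasing
  \<open>d\<close>-tuples from \<open>{1..n}\<close> whose \<open>i\<close>-th entry is about \<open>t n\<close>.\<close>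

definition bern :: "nat \<Rightarrow> nat \<Rightarrow> real \<Rightarrow> real" where
  "bern d i t = t ^ (i - 1) * (1 - t) ^ (d - i) / (fact (i - 1) * fact (d - i))"

text \<open>These are the coefficients of the double sum in \<open>gamma_sq\<close>; they are the
  inner products of the functions \<open>bern d i\<close> in L2 of [0,1].\<close>

definition bern_gram :: "nat \<Rightarrow> nat \<Rightarrow> nat \<Rightarrow> real" where
  "bern_gram d i j = fact (i + j - 2) * fact (2 * d - i - j) /
     (fact (i - 1) * fact (j - 1) * fact (d - i) * fact (d - j) * fact (2 * d - 1))"

lemma bern_mult:
  assumes "i \<in> {1..d}" "j \<in> {1..d}"
  shows "bern d i t * bern d j t = t ^ (i + j - 2) * (1 - t) ^ (2 * d - i - j)
     / (fact (i - 1) * fact (j - 1) * fact (d - i) * fact (d - j))"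
proof -
  have "t ^ (i - 1) * t ^ (j - 1) = t ^ (i + j - 2)"
    using assms by (simp add: power_add[symmetric] numeral_2_eq_2)
  moreover have "(1 - t) ^ (d - i) * (1 - t) ^ (d - j) = (1 - t) ^ (2 * d - i - j)"
    using assms by (simp add: power_add[symmetric] mult_2)
  moreover have "bern d i t * bern d j t = (t ^ (i - 1) * t ^ (j - 1)) * ((1 - t) ^ (d - i) * (1 - t) ^ (d - j))
     / (fact (i - 1) * fact (j - 1) * fact (d - i) * fact (d - j))"
    by (simp add: bern_def mult_ac)
  ultimately show ?thesis by simp
qed

lemma has_integral_bern_mult:
  assumes "i \<in> {1..d}" "j \<in> {1..d}"
  shows "((\<lambda>t. bern d i t * bern d j t) has_integral bern_gram d i j) {0..1}"
proof -
  have eq: "i + j - 2 + (2 * d - i - j) + 1 = 2 * d - 1" using assms by auto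
  have "((\<lambda>t::real. t ^ (i + j - 2) * (1 - t) ^ (2 * d - i - j)) has_integral
      fact (i + j - 2) * fact (2 * d - i - j) / fact (2 * d - 1)) {0..1}"
    using has_integral_beta_nat[of "i + j - 2" "2 * d - i - j"] unfolding eq .
  from has_integral_divide[OF this, of "fact (i - 1) * fact (j - 1) * fact (d - i) * fact (d - j)"]
  show ?thesis
    unfolding bern_mult[OF assms] bern_gram_def by (simp add: mult_ac)
qed

text \<open>The binomial theorem for (t + (1 - t))^(d-1): up to the factor 1/(d-1)! these functions
  are a partition of unity.\<close>

lemma sum_bern:
  assumes "1 \<le> d"
  shows "(\<Sum>i=1..d. bern d i t) = 1 / fact (d - 1)"
proof -
  have "(\<Sum>i=1..d. bern d i t) = (\<Sum>k\<le>d - 1. t ^ k * (1 - t) ^ (d - 1 - k) / (fact k * fact (d - 1 - k)))"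
    by (rule sum.reindex_bij_witness[of _ Suc "\<lambda>l. l - 1"]) (use assms in \<open>auto simp: bern_def\<close>)
  also have "\<dots> = (\<Sum>k\<le>d - 1. of_nat ((d - 1) choose k) * t ^ k * (1 - t) ^ (d - 1 - k) / fact (d - 1))"
  proof (intro sum.cong refl)
    fix k assume "k \<in> {..d - 1}"
    then have "real ((d - 1) choose k) = fact (d - 1) / (fact k * fact (d - 1 - k))"
      by (intro binomial_fact) auto
    then show "t ^ k * (1 - t) ^ (d - 1 - k) / (fact k * fact (d - 1 - k))
        = real ((d - 1) choose k) * t ^ k * (1 - t) ^ (d - 1 - k) / fact (d - 1)"
      by (simp add: field_simps)
  qed
  also have "\<dots> = (t + (1 - t)) ^ (d - 1) / fact (d - 1)"
    by (simp only: binomial_ring sum_divide_distrib)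
  finally show ?thesis by simp
qed

lemma has_integral_bern:
  assumes "i \<in> {1..d}"
  shows "((\<lambda>t. bern d i t) has_integral 1 / fact d) {0..1}"
proof -
  have eq: "i - 1 + (d - i) + 1 = d" using assms by auto
  have "((\<lambda>t::real. t ^ (i - 1) * (1 - t) ^ (d - i)) has_integral
      fact (i - 1) * fact (d - i) / fact d) {0..1}"
    using has_integral_beta_nat[of "i - 1" "d - i"] unfolding eq .
  from has_integral_divide[OF this, of "fact (i - 1) * fact (d - i)"]
  show ?thesis
    unfolding bern_def by simp
qed

text \<open>Summing over \<open>j\<close> under the integral replaces one factor by the constant
  1/(d-1)!. The constant row sums are what collapses the mixed terms of the variance to the single
  sum in \<open>gamma_sq\<close>.\<close>

lemma sum_bern_gram:
  assumes "1 \<le> d" "i \<in> {1..d}"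
  shows "(\<Sum>j=1..d. bern_gram d i j) = 1 / (fact (d - 1) * fact d)"
proof -
  have "((\<lambda>t. \<Sum>j=1..d. bern d i t * bern d j t) has_integral (\<Sum>j=1..d. bern_gram d i j)) {0..1}"
    by (intro has_integral_sum has_integral_bern_mult assms) auto
  also have "(\<lambda>t. \<Sum>j=1..d. bern d i t * bern d j t) = (\<lambda>t. bern d i t / fact (d - 1))"
    by (simp only: sum_distrib_left[symmetric] sum_bern[OF assms(1)] mult_1_right times_divide_eq_right)
  finally have *: "((\<lambda>t. bern d i t / fact (d - 1)) has_integral (\<Sum>j=1..d. bern_gram d i j)) {0..1}" .
  have "((\<lambda>t. bern d i t / fact (d - 1)) has_integral (1 / fact d) / fact (d - 1)) {0..1}"
    by (intro has_integral_divide has_integral_bern assms)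
  from has_integral_unique[OF * this] show ?thesis by simp
qed

lemma bern_gram_commute: "bern_gram d i j = bern_gram d j i"
  by (simp add: bern_gram_def add.commute diff_commute[of _ i j] mult_ac)

definition bern_form :: "nat \<Rightarrow> (nat \<Rightarrow> real) \<Rightarrow> real" where
  "bern_form d a = (\<Sum>i=1..d. \<Sum>j=1..d. bern_gram d i j * (a i * a j))"

lemma has_integral_bern_form:
  "((\<lambda>t. (\<Sum>i=1..d. bern d i t * a i)\<^sup>2) has_integral bern_form d a) {0..1}"
proof -
  have "((\<lambda>t. \<Sum>i=1..d. \<Sum>j=1..d. bern d i t * bern d j t * (a i * a j)) has_integral bern_form d a) {0..1}"
    unfolding bern_form_def
    by (intro has_integral_sum has_integral_mult_left has_integral_bern_mult) auto
  then show ?thesis by (simp add: power2_eq_square sum_product mult_ac)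
qed

lemma bern_form_nonneg: "0 \<le> bern_form d a"
  by (rule has_integral_nonneg[OF has_integral_bern_form]) auto

text \<open>A vanishing integral of a continuous nonnegative function forces the Bernstein sum to be
  0 on all of [0,1]. A rational substitution makes it a polynomial on the half-line with
  coefficients proportional to \<open>a i\<close>, and infinitely many roots make these 0.\<close>

lemma bern_form_eq_0_iff: "bern_form d a = 0 \<longleftrightarrow> (\<forall>i\<in>{1..d}. a i = 0)"
proof
  assume "bern_form d a = 0"
  then have 0: "((\<lambda>t. (\<Sum>i=1..d. bern d i t * a i)\<^sup>2) has_integral 0) (cbox 0 1)"
    using has_integral_bern_form[of d a] by (simp add: cbox_interval)
  have cont: "continuous_on (cbox 0 1) (\<lambda>t. (\<Sum>i=1..d. bern d i t * a i)\<^sup>2)"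
    unfolding bern_def by (intro continuous_intros) auto
  have zero: "(\<Sum>i=1..d. bern d i t * a i) = 0" if "t \<in> {0..1}" for t
    using has_integral_0_cbox_imp_0[OF cont _ 0, of t] that by (auto simp: cbox_interval)
  have poly0: "(\<Sum>k\<le>d. (if k < d then a (Suc k) / (fact k * fact (d - Suc k)) else 0) * u ^ k) = 0"
    if "u \<ge> 0" for u :: real
  proof -
    \<comment> \<open>With t = u/(1+u), multiplication by (1+u)^(d-1) turns t^(i-1) (1-t)^(d-i) into
      the monomial u^(i-1).\<close>
    define t where "t = u / (1 + u)"
    have t: "t \<in> {0..1}" "1 - t = 1 / (1 + u)" using that by (auto simp: t_def field_simps)
    have "(\<Sum>k\<le>d. (if k < d then a (Suc k) / (fact k * fact (d - Suc k)) else 0) * u ^ k)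
      = (\<Sum>k<d. a (Suc k) / (fact k * fact (d - Suc k)) * u ^ k)"
      by (simp add: lessThan_Suc_atMost[symmetric])
    also have "\<dots> = (\<Sum>i=1..d. a i / (fact (i - 1) * fact (d - i)) * u ^ (i - 1))"
      by (rule sum.reindex_bij_witness[of _ "\<lambda>l. l - 1" Suc]) auto
    also have "\<dots> = (\<Sum>i=1..d. (1 + u) ^ (d - 1) * (bern d i t * a i))"
    proof (intro sum.cong refl)
      fix i assume i: "i \<in> {1..d}"
      have "(1 + u) ^ (d - 1) = (1 + u) ^ (i - 1) * (1 + u) ^ (d - i)"
        using i by (simp add: power_add[symmetric])
      then have "(1 + u) ^ (d - 1) * (t ^ (i - 1) * (1 - t) ^ (d - i)) = u ^ (i - 1)"
        using that by (simp add: t(2)) (simp add: t_def power_divide)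
      then show "a i / (fact (i - 1) * fact (d - i)) * u ^ (i - 1) = (1 + u) ^ (d - 1) * (bern d i t * a i)"
        by (simp add: bern_def field_simps)
    qed
    also have "\<dots> = 0" using zero[OF t(1)] by (simp add: sum_distrib_left[symmetric])
    finally show ?thesis .
  qed
  have inf: "infinite {u::real. (\<Sum>k\<le>d. (if k < d then a (Suc k) / (fact k * fact (d - Suc k)) else 0) * u ^ k) = 0}"
  proof
    assume "finite {u::real. (\<Sum>k\<le>d. (if k < d then a (Suc k) / (fact k * fact (d - Suc k)) else 0) * u ^ k) = 0}"
    then have "finite {0::real..1}" by (rule finite_subset[rotated]) (use poly0 in auto)
    then show False using infinite_Icc[of 0 "1::real"] by simp
  qed
  have "(if k < d then a (Suc k) / (fact k * fact (d - Suc k)) else 0) = 0" if "k < d" for k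
    using polyfun_roots_finite[of "\<lambda>k. if k < d then a (Suc k) / (fact k * fact (d - Suc k)) else 0" k d] inf that
    by (meson less_imp_le)
  then have "a (Suc k) = 0" if "k < d" for k using that by simp
  then show "\<forall>i\<in>{1..d}. a i = 0"
    by (metis Suc_le_D Suc_le_eq atLeastAtMost_iff One_nat_def)
next
  assume "\<forall>i\<in>{1..d}. a i = 0"
  then show "bern_form d a = 0" by (simp add: bern_form_def)
qed

text \<open>Completes the square in the limiting variance; \<open>C\<close> stands for a covariance matrix with
  index \<open>0\<close> reserved for \<open>f\<close>.\<close>

lemma bern_gram_shift:
  fixes C :: "nat \<Rightarrow> nat \<Rightarrow> real"
  assumes "1 \<le> d" and sym: "\<And>i. i \<in> {1..d} \<Longrightarrow> C i 0 = C 0 i"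
  shows "(\<Sum>i=1..d. \<Sum>j=1..d. bern_gram d i j * (C i j - \<kappa> * C 0 i - \<kappa> * C 0 j + \<kappa>\<^sup>2 * C 0 0))
    = (\<Sum>i=1..d. \<Sum>j=1..d. bern_gram d i j * C i j)
      - 2 * \<kappa> / (fact (d - 1) * fact d) * (\<Sum>i=1..d. C 0 i) + \<kappa>\<^sup>2 / (fact (d - 1))\<^sup>2 * C 0 0"
proof -
  have A: "(\<Sum>i=1..d. \<Sum>j=1..d. bern_gram d i j * C 0 i) = (\<Sum>i=1..d. C 0 i) / (fact (d - 1) * fact d)"
    unfolding sum_distrib_right[symmetric] sum_divide_distrib
    by (intro sum.cong refl) (simp add: sum_bern_gram[OF assms(1)] del: One_nat_def)
  have B: "(\<Sum>i=1..d. \<Sum>j=1..d. bern_gram d i j * C 0 j) = (\<Sum>i=1..d. C 0 i) / (fact (d - 1) * fact d)"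
    using A by (subst sum.swap) (simp add: bern_gram_commute)
  \<comment> \<open>Each of the \<open>d\<close> rows of the Gram matrix sums to 1/((d-1)!
    d!).\<close>
  have "real d / (fact (d - 1) * fact d) = 1 / (fact (d - 1))\<^sup>2"
    using assms(1) fact_reduce[of d, where 'a=real] by (simp add: field_simps power2_eq_square)
  then have D: "(\<Sum>i=1..d. \<Sum>j=1..d. bern_gram d i j * C 0 0) = C 0 0 / (fact (d - 1))\<^sup>2"
    unfolding sum_distrib_right[symmetric]
    using assms(1) by (simp add: sum_bern_gram[OF assms(1)] field_simps del: One_nat_def)
  have "(\<Sum>i=1..d. \<Sum>j=1..d. bern_gram d i j * (C i j - \<kappa> * C 0 i - \<kappa> * C 0 j + \<kappa>\<^sup>2 * C 0 0))
    = (\<Sum>i=1..d. \<Sum>j=1..d. bern_gram d i j * C i j)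
     - \<kappa> * (\<Sum>i=1..d. \<Sum>j=1..d. bern_gram d i j * C 0 i)
     - \<kappa> * (\<Sum>i=1..d. \<Sum>j=1..d. bern_gram d i j * C 0 j)
     + \<kappa>\<^sup>2 * (\<Sum>i=1..d. \<Sum>j=1..d. bern_gram d i j * C 0 0)"
    by (simp add: sum_distrib_left sum_subtractf[symmetric] sum.distrib[symmetric] algebra_simps)
  then show ?thesis unfolding A B D by (simp add: algebra_simps)
qed

section \<open>Central limit theorem for triangular arrays\<close>

text \<open>As an image under multiplication by \<open>sqrt v\<close>, the point mass at
  \<open>v = 0\<close> is treated together with the laws that have a density.\<close>

lemma normal_law_eq_distr:
  assumes "0 \<le> v"
  shows "normal_law 0 v = distr std_normal_distribution borel (\<lambda>x. sqrt v * x)"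
proof -
  interpret N: real_distribution std_normal_distribution by (rule real_dist_normal_dist)
  show ?thesis
  proof (cases "v = 0")
    case True
    then show ?thesis by (simp add: normal_law_def N.distr_const del: N.space_eq_univ)
  next
    case False
    then have v: "0 < sqrt v" using assms by auto
    have "distributed std_normal_distribution lborel (\<lambda>x. x) std_normal_density"
      by (simp add: distributed_def distr_id2)
    from N.normal_density_affine[OF this, of "sqrt v" 0] v
    have "distributed std_normal_distribution lborel (\<lambda>x. sqrt v * x) (normal_density 0 (sqrt v))"
      by simp
    from distributed_distr_eq_density[OF this]
    have "distr std_normal_distribution lborel (\<lambda>x. sqrt v * x) = normal_law 0 v"
      using False by (simp add: normal_law_def)
    moreover have "distr std_normal_distribution lborel (\<lambda>x. sqrt v * x)
       = distr std_normal_distribution borel (\<lambda>x. sqrt v * x)"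
      by (rule distr_cong) auto
    ultimately show ?thesis by simp
  qed
qed

lemma real_distribution_normal_law: "0 \<le> v \<Longrightarrow> real_distribution (normal_law 0 v)"
  using real_distribution.axioms(1)[OF real_dist_normal_dist]
  by (auto simp: normal_law_eq_distr intro!: prob_space.real_distribution_distr)

lemma char_normal_law:
  assumes "0 \<le> v"
  shows "char (normal_law 0 v) t = complex_of_real (exp (- (t\<^sup>2 * v) / 2))"
proof -
  have "char (normal_law 0 v) t = char std_normal_distribution (t * sqrt v)"
    unfolding normal_law_eq_distr[OF assms] char_def
    by (subst integral_distr) (auto simp: mult_ac)
  then show ?thesis using assms by (simp add: char_std_normal_distribution power_mult_distrib)
qed

lemma abs_one_minus_exp_le:
  fixes a :: real
  assumes "0 \<le> a"
  shows "\<bar>1 - a - exp (- a)\<bar> \<le> a\<^sup>2"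
proof -
  have "1 - a \<le> exp (- a)" using exp_ge_add_one_self[of "- a"] by simp
  moreover have "exp (- a) \<le> 1 - a + a\<^sup>2"
  proof -
    \<comment> \<open>The product equals 1 + a^3.\<close>
    have "1 \<le> (1 + a) * (1 - a + a\<^sup>2)"
      using assms by (simp add: algebra_simps power2_eq_square)
    also have "\<dots> \<le> exp a * (1 - a + a\<^sup>2)"
    proof (rule mult_right_mono[OF exp_ge_add_one_self])
      have "0 \<le> (1 - a)\<^sup>2" "0 \<le> a\<^sup>2" by simp_all
      then show "0 \<le> 1 - a + a\<^sup>2" using assms unfolding power2_diff by simp
    qed
    finally show ?thesis by (simp add: exp_minus field_simps)
  qed
  ultimately show ?thesis by simp
qed

lemma abs_min_le:
  fixes a b :: real
  assumes "0 \<le> a" "0 \<le> b"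
  shows "\<bar>min a b\<bar> \<le> a"
  using assms by auto

text \<open>Domination by identically distributed square integrable \<open>H k\<close> replaces
  Lindeberg's condition. Each factor of the characteristic function is compared with 1 - t^2 sigma/2
  and this with a Gaussian factor; the \<open>n\<close> errors add up to something that tends to 0.
  Nothing is divided by the variance of a row, so the limit \<open>v = 0\<close> is covered.\<close>

theorem (in prob_space) triangular_array_clt:
  fixes Y :: "nat \<Rightarrow> nat \<Rightarrow> 'a \<Rightarrow> real" and H :: "nat \<Rightarrow> 'a \<Rightarrow> real"
  assumes indep: "\<And>n. indep_vars (\<lambda>_. borel) (Y n) {1..n}"
    and mean: "\<And>n k. k \<in> {1..n} \<Longrightarrow> expectation (Y n k) = 0"
    and H_rv: "\<And>k. random_variable borel (H k)"
    and H_ident: "\<And>k. distr M borel (H k) = distr M borel (H 0)"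
    and H_square: "integrable M (\<lambda>\<omega>. (H 0 \<omega>)\<^sup>2)"
    and dom: "\<And>n k \<omega>. k \<in> {1..n} \<Longrightarrow> \<omega> \<in> space M \<Longrightarrow> \<bar>Y n k \<omega>\<bar> \<le> H k \<omega>"
    and var: "(\<lambda>n. (\<Sum>k=1..n. expectation (\<lambda>\<omega>. (Y n k \<omega>)\<^sup>2)) / real n) \<longlonglongrightarrow> v"
  shows "weak_conv_m (\<lambda>n. distr M borel (\<lambda>\<omega>. (\<Sum>k=1..n. Y n k \<omega>) / sqrt (real n))) (normal_law 0 v)"
proof -
  have v: "0 \<le> v"
    by (rule LIMSEQ_le_const[OF var]) (auto intro!: divide_nonneg_nonneg sum_nonneg)
  have rv[measurable]: "random_variable borel (Y n k)" if "k \<in> {1..n}" for n k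
    using indep[of n] that by (auto simp: indep_vars_def2)
  note H_rv[measurable]
  have H_int: "integrable M (\<lambda>\<omega>. F (H k \<omega>)) \<longleftrightarrow> integrable M (\<lambda>\<omega>. F (H 0 \<omega>))"
    and H_exp: "expectation (\<lambda>\<omega>. F (H k \<omega>)) = expectation (\<lambda>\<omega>. F (H 0 \<omega>))"
    if [measurable]: "F \<in> borel_measurable borel" for F :: "real \<Rightarrow> real" and k
  proof -
    have "integrable (distr M borel (H k)) F \<longleftrightarrow> integrable (distr M borel (H 0)) F"
      "integral\<^sup>L (distr M borel (H k)) F = integral\<^sup>L (distr M borel (H 0)) F"
      unfolding H_ident[of k] by auto
    then show "integrable M (\<lambda>\<omega>. F (H k \<omega>)) \<longleftrightarrow> integrable M (\<lambda>\<omega>. F (H 0 \<omega>))"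
      "expectation (\<lambda>\<omega>. F (H k \<omega>)) = expectation (\<lambda>\<omega>. F (H 0 \<omega>))"
      by (simp_all add: integrable_distr_eq integral_distr)
  qed
  have Hk_square: "integrable M (\<lambda>\<omega>. (H k \<omega>)\<^sup>2)" for k
    using H_int[of "\<lambda>x. x\<^sup>2" k] H_square by simp
  have Y_square: "integrable M (\<lambda>\<omega>. (Y n k \<omega>)\<^sup>2)" if "k \<in> {1..n}" for n k
  proof (rule Bochner_Integration.integrable_bound[OF Hk_square[of k]])
    show "AE \<omega> in M. norm ((Y n k \<omega>)\<^sup>2) \<le> norm ((H k \<omega>)\<^sup>2)"
      using dom[OF that] by (intro AE_I2) (simp, metis abs_ge_self abs_le_square_iff order_trans)
  qed (use rv[OF that] in measurable)
  have Y_int: "integrable M (Y n k)" if "k \<in> {1..n}" for n k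
    by (rule square_integrable_imp_integrable[OF rv[OF that] Y_square[OF that]])
  define s where "s n k = expectation (\<lambda>\<omega>. (Y n k \<omega>)\<^sup>2)" for n k
  define h where "h = expectation (\<lambda>\<omega>. (H 0 \<omega>)\<^sup>2)"
  have s0: "0 \<le> s n k" for n k by (simp add: s_def)
  have sh: "s n k \<le> h" if "k \<in> {1..n}" for n k
  proof -
    have "s n k \<le> expectation (\<lambda>\<omega>. (H k \<omega>)\<^sup>2)"
      unfolding s_def
    proof (rule integral_mono[OF Y_square[OF that] Hk_square])
      fix \<omega> assume "\<omega> \<in> space M"
      from dom[OF that this] show "(Y n k \<omega>)\<^sup>2 \<le> (H k \<omega>)\<^sup>2"
        by (metis abs_ge_self abs_le_square_iff order_trans)
    qed
    also have "\<dots> = h" unfolding h_def using H_exp[of "\<lambda>x. x\<^sup>2" k] by simp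
    finally show ?thesis .
  qed
  \<comment> \<open>The Taylor remainder of \<open>n\<close> factors, expressed through
    \<open>H 0\<close>. The minimum of a quadratic and a cubic bound lets dominated convergence
    apply with second moments only.\<close>
  define e where "e = (\<lambda>t n. expectation (\<lambda>\<omega>. min (6 * (H 0 \<omega>)\<^sup>2) (\<bar>t / sqrt (real n)\<bar> * \<bar>H 0 \<omega>\<bar> ^ 3)))"
  have e_lim: "e t \<longlonglongrightarrow> 0" for t
  proof -
    have "(\<lambda>n. expectation (\<lambda>\<omega>. min (6 * (H 0 \<omega>)\<^sup>2) (\<bar>t / sqrt (real n)\<bar> * \<bar>H 0 \<omega>\<bar> ^ 3)))
        \<longlonglongrightarrow> expectation (\<lambda>\<omega>. 0)"
    proof (rule integral_dominated_convergence[where w="\<lambda>\<omega>. 6 * (H 0 \<omega>)\<^sup>2"])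
      have "(\<lambda>n. \<bar>t / sqrt (real n)\<bar> * c) \<longlonglongrightarrow> 0" for c
      proof -
        have "(\<lambda>n. t / sqrt (real n)) \<longlonglongrightarrow> 0" by real_asymp
        then show ?thesis by (intro tendsto_mult_left_zero tendsto_rabs_zero)
      qed
      then have "(\<lambda>n. min (6 * x\<^sup>2) (\<bar>t / sqrt (real n)\<bar> * c)) \<longlonglongrightarrow> min (6 * x\<^sup>2) 0" for x c :: real
        by (intro tendsto_min tendsto_const)
      then show "AE \<omega> in M. (\<lambda>n. min (6 * (H 0 \<omega>)\<^sup>2) (\<bar>t / sqrt (real n)\<bar> * \<bar>H 0 \<omega>\<bar> ^ 3)) \<longlonglongrightarrow> 0"
        by (intro AE_I2) (simp add: min_absorb2)
      fix n
      show "AE \<omega> in M. norm (min (6 * (H 0 \<omega>)\<^sup>2) (\<bar>t / sqrt (real n)\<bar> * \<bar>H 0 \<omega>\<bar> ^ 3)) \<le> 6 * (H 0 \<omega>)\<^sup>2"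
        unfolding real_norm_def by (intro AE_I2 abs_min_le) auto
    qed (use H_square in auto)
    then show ?thesis unfolding e_def by (simp only: integral_zero)
  qed
  have main: "cmod (char (distr M borel (\<lambda>\<omega>. (\<Sum>k=1..n. Y n k \<omega>) / sqrt (real n))) t
      - complex_of_real (exp (- (t\<^sup>2 * ((\<Sum>k=1..n. s n k) / real n)) / 2)))
      \<le> t\<^sup>2 / 6 * e t n + (t\<^sup>2 * h / 2)\<^sup>2 / real n" if n: "n > 0" for n t
  proof -
    define z where "z k = char (distr M borel (\<lambda>\<omega>. Y n k \<omega> / sqrt (real n))) t" for k
    define w where "w k = complex_of_real (exp (- (t\<^sup>2 * s n k / real n / 2)))" for k
    have ind: "indep_vars (\<lambda>_. borel) (\<lambda>k \<omega>. Y n k \<omega> / sqrt (real n)) {1..n}"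
      by (rule indep_vars_compose2[OF indep]) auto
    have 1: "char (distr M borel (\<lambda>\<omega>. (\<Sum>k=1..n. Y n k \<omega>) / sqrt (real n))) t = (\<Prod>k=1..n. z k)"
      unfolding z_def sum_divide_distrib by (rule char_distr_sum[OF ind])
    have 2: "complex_of_real (exp (- (t\<^sup>2 * ((\<Sum>k=1..n. s n k) / real n)) / 2)) = (\<Prod>k=1..n. w k)"
      by (simp add: w_def exp_sum[symmetric] sum_negf sum_divide_distrib sum_distrib_left flip: of_real_prod)
    have zw: "cmod (z k - w k) \<le> t\<^sup>2 / (6 * real n) * e t n + (t\<^sup>2 * h / 2)\<^sup>2 / (real n)\<^sup>2" if k: "k \<in> {1..n}" for k
    proof -
      define \<sigma> where "\<sigma> = s n k / real n"
      have [measurable]: "random_variable borel (Y n k)" using rv[OF k] .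
      have "cmod (z k - (1 - t\<^sup>2 * \<sigma> / 2)) \<le>
        (t\<^sup>2 / 6) * expectation (\<lambda>\<omega>. min (6 * (Y n k \<omega> / sqrt (real n))\<^sup>2) (\<bar>t\<bar> * \<bar>Y n k \<omega> / sqrt (real n)\<bar> ^ 3))"
        unfolding z_def
      proof (rule char_approx3'[OF _ _ _ _ _ refl])
        show "integrable M (\<lambda>\<omega>. Y n k \<omega> / sqrt (real n))" "integrable M (\<lambda>\<omega>. (Y n k \<omega> / sqrt (real n))\<^sup>2)"
          using Y_int[OF k] Y_square[OF k] by (simp_all add: power_divide)
        show m: "expectation (\<lambda>\<omega>. Y n k \<omega> / sqrt (real n)) = 0"
          using mean[OF k] by simp
        show "variance (\<lambda>\<omega>. Y n k \<omega> / sqrt (real n)) = \<sigma>"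
          unfolding m by (simp add: power_divide \<sigma>_def s_def)
      qed measurable
      also have "expectation (\<lambda>\<omega>. min (6 * (Y n k \<omega> / sqrt (real n))\<^sup>2) (\<bar>t\<bar> * \<bar>Y n k \<omega> / sqrt (real n)\<bar> ^ 3))
          \<le> expectation (\<lambda>\<omega>. min (6 * (H k \<omega>)\<^sup>2) (\<bar>t / sqrt (real n)\<bar> * \<bar>H k \<omega>\<bar> ^ 3) / real n)"
      proof (rule integral_mono)
        show "integrable M (\<lambda>\<omega>. min (6 * (Y n k \<omega> / sqrt (real n))\<^sup>2) (\<bar>t\<bar> * \<bar>Y n k \<omega> / sqrt (real n)\<bar> ^ 3))"
          by (rule Bochner_Integration.integrable_bound[where f="\<lambda>\<omega>. 6 / real n * (Y n k \<omega>)\<^sup>2"])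
             (use Y_square[OF k] n in \<open>auto simp: power_divide intro!: AE_I2 abs_min_le[THEN order_trans]\<close>)
        show "integrable M (\<lambda>\<omega>. min (6 * (H k \<omega>)\<^sup>2) (\<bar>t / sqrt (real n)\<bar> * \<bar>H k \<omega>\<bar> ^ 3) / real n)"
          by (rule Bochner_Integration.integrable_bound[where f="\<lambda>\<omega>. 6 / real n * (H k \<omega>)\<^sup>2"])
             (use Hk_square[of k] n in \<open>auto intro!: AE_I2 divide_right_mono abs_min_le\<close>)
        fix \<omega> assume "\<omega> \<in> space M"
        from dom[OF k this] have YH: "\<bar>Y n k \<omega>\<bar> \<le> \<bar>H k \<omega>\<bar>" by simp
        have sq: "sqrt (real n) ^ 3 = sqrt (real n) * real n"
          using n by (simp add: numeral_3_eq_3)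
        have "6 * (Y n k \<omega> / sqrt (real n))\<^sup>2 \<le> 6 * (H k \<omega>)\<^sup>2 / real n"
          using YH n by (simp add: power_divide divide_right_mono abs_le_square_iff)
        moreover have "\<bar>t\<bar> * \<bar>Y n k \<omega> / sqrt (real n)\<bar> ^ 3 \<le> \<bar>t / sqrt (real n)\<bar> * \<bar>H k \<omega>\<bar> ^ 3 / real n"
        proof -
          have "\<bar>Y n k \<omega>\<bar> ^ 3 \<le> \<bar>H k \<omega>\<bar> ^ 3" using YH by (intro power_mono) auto
          then have "\<bar>t\<bar> / (sqrt (real n) * real n) * \<bar>Y n k \<omega>\<bar> ^ 3 \<le> \<bar>t\<bar> / (sqrt (real n) * real n) * \<bar>H k \<omega>\<bar> ^ 3"
            by (intro mult_left_mono) auto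
          then show ?thesis using n sq by (simp add: power_divide abs_divide)
        qed
        ultimately show "min (6 * (Y n k \<omega> / sqrt (real n))\<^sup>2) (\<bar>t\<bar> * \<bar>Y n k \<omega> / sqrt (real n)\<bar> ^ 3)
          \<le> min (6 * (H k \<omega>)\<^sup>2) (\<bar>t / sqrt (real n)\<bar> * \<bar>H k \<omega>\<bar> ^ 3) / real n"
          by (auto simp: min_def)
      qed
      also have "\<dots> = e t n / real n"
        unfolding e_def using H_exp[of "\<lambda>x. min (6 * x\<^sup>2) (\<bar>t / sqrt (real n)\<bar> * \<bar>x\<bar> ^ 3)" k] by simp
      finally have A: "cmod (z k - (1 - t\<^sup>2 * \<sigma> / 2)) \<le> t\<^sup>2 / (6 * real n) * e t n"
        by (simp add: mult_left_mono)
      define a where "a = t\<^sup>2 * \<sigma> / 2"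
      have a0: "0 \<le> a" by (simp add: a_def \<sigma>_def s0)
      have "a \<le> (t\<^sup>2 * h / 2) / real n"
        using mult_left_mono[OF sh[OF k], of "t\<^sup>2 / (2 * real n)"] by (simp add: a_def \<sigma>_def mult_ac)
      then have "a\<^sup>2 \<le> ((t\<^sup>2 * h / 2) / real n)\<^sup>2" using a0 by (intro power_mono)
      then have B: "\<bar>1 - a - exp (- a)\<bar> \<le> (t\<^sup>2 * h / 2)\<^sup>2 / (real n)\<^sup>2"
        using abs_one_minus_exp_le[OF a0] by (simp add: power_divide)
      have "z k - w k = (z k - (1 - t\<^sup>2 * \<sigma> / 2)) + complex_of_real (1 - a - exp (- a))"
        by (simp add: w_def a_def \<sigma>_def)
      then have "cmod (z k - w k) \<le> cmod (z k - (1 - t\<^sup>2 * \<sigma> / 2)) + \<bar>1 - a - exp (- a)\<bar>"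
        by (metis norm_triangle_ineq norm_of_real)
      then show ?thesis using A B by linarith
    qed
    have "cmod ((\<Prod>k=1..n. z k) - (\<Prod>k=1..n. w k)) \<le> (\<Sum>k=1..n. cmod (z k - w k))"
    proof (rule norm_prod_diff)
      fix k assume k: "k \<in> {1..n}"
      have [measurable]: "random_variable borel (Y n k)" using rv[OF k] .
      have "real_distribution (distr M borel (\<lambda>\<omega>. Y n k \<omega> / sqrt (real n)))"
        by (intro real_distribution_distr) measurable
      then show "cmod (z k) \<le> 1" unfolding z_def by (rule real_distribution.cmod_char_le_1)
      show "cmod (w k) \<le> 1" using s0[of n k] by (simp add: w_def)
    qed
    also have "\<dots> \<le> (\<Sum>k=1..n. t\<^sup>2 / (6 * real n) * e t n + (t\<^sup>2 * h / 2)\<^sup>2 / (real n)\<^sup>2)"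
      by (intro sum_mono zw)
    also have "\<dots> = t\<^sup>2 / 6 * e t n + (t\<^sup>2 * h / 2)\<^sup>2 / real n"
      using n by (simp add: field_simps power2_eq_square)
    finally show ?thesis unfolding 1 2 .
  qed
  show ?thesis
  proof (rule levy_continuity)
    fix n
    have "random_variable borel (\<lambda>\<omega>. (\<Sum>k=1..n. Y n k \<omega>) / sqrt (real n))"
      by (intro borel_measurable_divide borel_measurable_sum rv) auto
    then show "real_distribution (distr M borel (\<lambda>\<omega>. (\<Sum>k=1..n. Y n k \<omega>) / sqrt (real n)))"
      by (rule real_distribution_distr)
  next
    show "real_distribution (normal_law 0 v)" by (rule real_distribution_normal_law[OF v])
  next
    fix t
    have "(\<lambda>n. t\<^sup>2 / 6 * e t n + (t\<^sup>2 * h / 2)\<^sup>2 / real n) \<longlonglongrightarrow> t\<^sup>2 / 6 * 0 + 0"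
      by (intro tendsto_intros e_lim)
    then have lim0: "(\<lambda>n. t\<^sup>2 / 6 * e t n + (t\<^sup>2 * h / 2)\<^sup>2 / real n) \<longlonglongrightarrow> 0" by simp
    have "(\<lambda>n. char (distr M borel (\<lambda>\<omega>. (\<Sum>k=1..n. Y n k \<omega>) / sqrt (real n))) t
      - complex_of_real (exp (- (t\<^sup>2 * ((\<Sum>k=1..n. s n k) / real n)) / 2))) \<longlonglongrightarrow> 0"
      by (rule Lim_null_comparison[OF _ lim0], rule eventually_mono[OF eventually_gt_at_top[of 0]])
         (rule main)
    moreover have "(\<lambda>n. complex_of_real (exp (- (t\<^sup>2 * ((\<Sum>k=1..n. s n k) / real n)) / 2)))
        \<longlonglongrightarrow> complex_of_real (exp (- (t\<^sup>2 * v) / 2))"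
      using var unfolding s_def by (intro tendsto_intros) auto
    ultimately show "(\<lambda>n. char (distr M borel (\<lambda>\<omega>. (\<Sum>k=1..n. Y n k \<omega>) / sqrt (real n))) t)
        \<longlonglongrightarrow> char (normal_law 0 v) t"
      unfolding char_normal_law[OF v] by (rule Lim_transform[rotated])
  qed
qed

text \<open>Slutsky's argument with distribution functions: outside a small event,
  \<open>W x\<close> below \<open>t\<close> forces \<open>Z x\<close> below a slightly larger point,
  and \<open>Z x\<close> below a slightly smaller point forces \<open>W x\<close> below
  \<open>t\<close>.\<close>

lemma (in prob_space) weak_conv_along_perturb:
  fixes Z W :: "'b \<Rightarrow> 'a \<Rightarrow> real"
  assumes Z[measurable]: "\<And>x. random_variable borel (Z x)"
    and W[measurable]: "\<And>x. random_variable borel (W x)"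
    and L: "real_distribution L"
    and conv: "weak_conv_along (\<lambda>x. distr M borel (Z x)) L F"
    and close: "\<And>\<epsilon>. \<epsilon> > 0 \<Longrightarrow> ((\<lambda>x. prob {\<omega> \<in> space M. \<epsilon> < \<bar>W x \<omega> - Z x \<omega>\<bar>}) \<longlongrightarrow> 0) F"
  shows "weak_conv_along (\<lambda>x. distr M borel (W x)) L F"
  unfolding weak_conv_along_def
proof (intro allI impI)
  interpret L: real_distribution L by fact
  fix t assume t: "isCont (cdf L) t"
  have cdf_eq: "cdf (distr M borel V) u = prob {\<omega> \<in> space M. V \<omega> \<le> u}"
    if [measurable]: "random_variable borel V" for V u
    by (simp add: cdf_def measure_distr vimage_def Int_def conj_commute)
  show "((\<lambda>x. cdf (distr M borel (W x)) t) \<longlongrightarrow> cdf L t) F"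
  proof (rule tendstoI)
    fix e :: real assume "0 < e"
    then obtain \<delta> where \<delta>: "\<delta> > 0" "\<And>u. dist u t < \<delta> \<Longrightarrow> dist (cdf L u) (cdf L t) < e / 3"
      using t unfolding continuous_at_eps_delta by (metis divide_pos_pos zero_less_numeral)
    \<comment> \<open>A law on the line has countably many atoms, so every interval contains
      continuity points; \<open>t1\<close> and \<open>t2\<close> are such points on the two sides of
      \<open>t\<close>.\<close>
    obtain t1 where t1: "t - \<delta> < t1" "t1 < t" "measure L {t1} = 0"
      using open_minus_countable[OF L.countable_support, of "{t - \<delta><..<t}"] \<delta>(1) by auto
    obtain t2 where t2: "t < t2" "t2 < t + \<delta>" "measure L {t2} = 0"
      using open_minus_countable[OF L.countable_support, of "{t<..<t + \<delta>}"] \<delta>(1) by auto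
    define \<epsilon> where "\<epsilon> = min (t - t1) (t2 - t)"
    have \<epsilon>: "\<epsilon> > 0" using t1 t2 by (simp add: \<epsilon>_def)
    have "((\<lambda>x. cdf (distr M borel (Z x)) t1) \<longlongrightarrow> cdf L t1) F"
      "((\<lambda>x. cdf (distr M borel (Z x)) t2) \<longlongrightarrow> cdf L t2) F"
      using conv t1(3) t2(3) by (auto simp: weak_conv_along_def L.isCont_cdf)
    then have "\<forall>\<^sub>F x in F. dist (cdf (distr M borel (Z x)) t1) (cdf L t1) < e / 3"
      "\<forall>\<^sub>F x in F. dist (cdf (distr M borel (Z x)) t2) (cdf L t2) < e / 3"
      using \<open>0 < e\<close> by (auto dest!: tendstoD[where e="e/3"])
    moreover have "\<forall>\<^sub>F x in F. dist (prob {\<omega> \<in> space M. \<epsilon> < \<bar>W x \<omega> - Z x \<omega>\<bar>}) 0 < e / 3"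
      using \<open>0 < e\<close> by (intro tendstoD[OF close[OF \<epsilon>]]) auto
    ultimately show "\<forall>\<^sub>F x in F. dist (cdf (distr M borel (W x)) t) (cdf L t) < e"
    proof eventually_elim
      case (elim x)
      let ?B = "{\<omega> \<in> space M. \<epsilon> < \<bar>W x \<omega> - Z x \<omega>\<bar>}"
      have "prob {\<omega> \<in> space M. W x \<omega> \<le> t} \<le> prob ({\<omega> \<in> space M. Z x \<omega> \<le> t2} \<union> ?B)"
        by (intro finite_measure_mono) (auto simp: \<epsilon>_def)
      also have "\<dots> \<le> prob {\<omega> \<in> space M. Z x \<omega> \<le> t2} + prob ?B"
        by (rule measure_Un_le) auto
      finally have up: "prob {\<omega> \<in> space M. W x \<omega> \<le> t} \<le> prob {\<omega> \<in> space M. Z x \<omega> \<le> t2} + prob ?B" .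
      have "prob {\<omega> \<in> space M. Z x \<omega> \<le> t1} \<le> prob ({\<omega> \<in> space M. W x \<omega> \<le> t} \<union> ?B)"
        by (intro finite_measure_mono) (auto simp: \<epsilon>_def)
      also have "\<dots> \<le> prob {\<omega> \<in> space M. W x \<omega> \<le> t} + prob ?B"
        by (rule measure_Un_le) auto
      finally have lo: "prob {\<omega> \<in> space M. Z x \<omega> \<le> t1} \<le> prob {\<omega> \<in> space M. W x \<omega> \<le> t} + prob ?B" .
      have d: "dist (cdf L t1) (cdf L t) < e / 3" "dist (cdf L t2) (cdf L t) < e / 3"
        using \<delta>(2)[of t1] \<delta>(2)[of t2] t1 t2 by (auto simp: dist_real_def)
      have bounds: "u < w + r \<and> w < u + r" if "dist u w < r" for u w r :: real
        using that unfolding dist_real_def by linarith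
      have "prob ?B < e / 3" using bounds[OF elim(3)] by simp
      then have "cdf (distr M borel (W x)) t < cdf L t + e" "cdf L t < cdf (distr M borel (W x)) t + e"
        using up lo bounds[OF elim(1)] bounds[OF elim(2)] bounds[OF d(1)] bounds[OF d(2)]
        by (simp_all add: cdf_eq)
      then show ?case unfolding dist_real_def by linarith
    qed
  qed
qed

section \<open>Limits of the projection weights\<close>

lemma binomial_quotient_bounds:
  assumes "k \<le> n" "0 < n"
  shows "0 \<le> real (k choose a) / real n ^ a" "real (k choose a) / real n ^ a \<le> 1"
proof -
  have "k choose a \<le> k ^ a"
    by (cases "a \<le> k") (auto simp: binomial_le_pow binomial_eq_0)
  also have "\<dots> \<le> n ^ a" using assms by (intro power_mono) auto
  finally have "real (k choose a) \<le> real n ^ a" by (metis of_nat_le_iff of_nat_power)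
  then show "0 \<le> real (k choose a) / real n ^ a" "real (k choose a) / real n ^ a \<le> 1"
    using assms by auto
qed

lemma power_fact_bounds:
  assumes "k \<le> n"
  shows "0 \<le> (real k / real n) ^ a / fact a" "(real k / real n) ^ a / fact a \<le> 1"
proof -
  have "(real k / real n) ^ a \<le> 1" using assms by (intro power_le_one) (auto simp: divide_le_eq_1)
  then show "0 \<le> (real k / real n) ^ a / fact a" "(real k / real n) ^ a / fact a \<le> 1"
    using fact_ge_1[of a, where 'a=real] by (auto simp: divide_le_eq intro: order_trans)
qed

text \<open>The point is uniformity in \<open>k\<close>. Induction uses (a+1) (k choose a+1) = (k-a)
  (k choose a); replacing k - a by k costs a/n, so the constant grows by \<open>a\<close> in each
  step.\<close>

lemma binomial_quotient_approx:
  "\<exists>C\<ge>0. \<forall>n k. 0 < n \<longrightarrow> k \<le> n \<longrightarrow>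
     \<bar>real (k choose a) / real n ^ a - (real k / real n) ^ a / fact a\<bar> \<le> C / real n"
proof (induction a)
  case 0
  show ?case by (intro exI[of _ 0]) auto
next
  case (Suc a)
  then obtain C where C: "C \<ge> 0" "\<And>n k. 0 < n \<Longrightarrow> k \<le> n \<Longrightarrow>
     \<bar>real (k choose a) / real n ^ a - (real k / real n) ^ a / fact a\<bar> \<le> C / real n" by blast
  show ?case
  proof (intro exI[of _ "C + real a"] conjI allI impI)
    fix n k :: nat assume n: "0 < n" and k: "k \<le> n"
    define B where "B = real (k choose a) / real n ^ a"
    define T where "T = (real k / real n) ^ a / fact a"
    define t where "t = real k / real n"
    have t: "0 \<le> t" "t \<le> 1" using n k by (auto simp: t_def)
    have "Suc a * (k choose Suc a) = (k - a) * (k choose a)"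
      using binomial_absorption[of a k] binomial_absorb_comp[of k a] by simp
    then have "real (Suc a) * real (k choose Suc a) = real (k - a) * real (k choose a)"
      by (metis of_nat_mult)
    \<comment> \<open>Truncated and real subtraction differ only for \<open>k < a\<close>, where the
      binomial coefficient is 0.\<close>
    also have "\<dots> = (real k - real a) * real (k choose a)"
      by (cases "a \<le> k") (auto simp: binomial_eq_0 of_nat_diff)
    finally have rec: "real (k choose Suc a) = (real k - real a) * real (k choose a) / real (Suc a)"
      by (simp add: field_simps del: of_nat_Suc)
    have "real (k choose Suc a) / real n ^ Suc a = B * (t - real a / real n) / real (Suc a)"
      unfolding rec B_def t_def using n by (simp add: field_simps)
    moreover have "(real k / real n) ^ Suc a / fact (Suc a) = T * t / real (Suc a)"
      unfolding T_def t_def by (simp add: field_simps)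
    ultimately have "real (k choose Suc a) / real n ^ Suc a - (real k / real n) ^ Suc a / fact (Suc a)
       = B * (t - real a / real n) / real (Suc a) - T * t / real (Suc a)"
      by (simp only:)
    also have "\<dots> = ((B - T) * t - B * real a / real n) / real (Suc a)"
      unfolding diff_divide_distrib[symmetric] by (simp add: algebra_simps)
    also have "\<bar>\<dots>\<bar> \<le> \<bar>(B - T) * t - B * real a / real n\<bar>"
      by (simp add: abs_divide divide_le_eq mult_le_cancel_left1)
    also have "\<dots> \<le> \<bar>(B - T) * t\<bar> + \<bar>B * real a / real n\<bar>" by (rule abs_triangle_ineq4)
    also have "\<bar>(B - T) * t\<bar> \<le> \<bar>B - T\<bar>"
      using t by (simp add: abs_mult mult_left_le)
    also have "\<bar>B - T\<bar> \<le> C / real n" unfolding B_def T_def by (rule C(2)[OF n k])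
    also have "\<bar>B * real a / real n\<bar> \<le> real a / real n"
    proof -
      have "B * real a \<le> 1 * real a"
        using binomial_quotient_bounds[OF k n, of a] by (intro mult_right_mono) (auto simp: B_def)
      moreover have "0 \<le> B" using binomial_quotient_bounds[OF k n, of a] by (simp add: B_def)
      ultimately show ?thesis
        using divide_right_mono[of "B * real a" "real a" "real n"] by (simp add: abs_mult)
    qed
    finally show "\<bar>real (k choose Suc a) / real n ^ Suc a - (real k / real n) ^ Suc a / fact (Suc a)\<bar>
      \<le> (C + real a) / real n" by (simp add: add_divide_distrib)
  qed (use C in auto)
qed

lemma tendsto_binomial_quotient: "(\<lambda>n. real (n choose a) / real n ^ a) \<longlonglongrightarrow> 1 / fact a"
proof -
  obtain C where C: "\<And>n k. 0 < n \<Longrightarrow> k \<le> n \<Longrightarrow>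
     \<bar>real (k choose a) / real n ^ a - (real k / real n) ^ a / fact a\<bar> \<le> C / real n"
    using binomial_quotient_approx[of a] by blast
  have "(\<lambda>n. real (n choose a) / real n ^ a - 1 / fact a) \<longlonglongrightarrow> 0"
  proof (rule Lim_null_comparison)
    show "\<forall>\<^sub>F n in sequentially. norm (real (n choose a) / real n ^ a - 1 / fact a) \<le> C / real n"
      using eventually_gt_at_top[of 0]
    proof eventually_elim
      case (elim n)
      then show ?case using C[of n n] by simp
    qed
    show "(\<lambda>n. C / real n) \<longlonglongrightarrow> 0" by (rule lim_const_over_n)
  qed
  then show ?thesis by (rule LIM_zero_cancel)
qed

text \<open>An error of this kind, O(1/n) uniformly over the positions \<open>m\<close>, disappears
  in averages over \<open>m\<close>.\<close>

definition unif_close :: "(nat \<Rightarrow> nat \<Rightarrow> real) \<Rightarrow> (nat \<Rightarrow> nat \<Rightarrow> real) \<Rightarrow> bool" where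
  "unif_close F G \<longleftrightarrow> (\<exists>C\<ge>0. \<forall>n m. 0 < n \<longrightarrow> m \<in> {1..n} \<longrightarrow> \<bar>F n m - G n m\<bar> \<le> C / real n)"

text \<open>The bounds are placed on \<open>F'\<close> and \<open>G\<close> to match the splitting F
  G - F' G' = (F - F') G + F' (G - G').\<close>

lemma unif_close_mult:
  assumes "unif_close F F'" "unif_close G G'"
    and "\<And>n m. 0 < n \<Longrightarrow> m \<in> {1..n} \<Longrightarrow> \<bar>F' n m\<bar> \<le> 1"
    and "\<And>n m. 0 < n \<Longrightarrow> m \<in> {1..n} \<Longrightarrow> \<bar>G n m\<bar> \<le> 1"
  shows "unif_close (\<lambda>n m. F n m * G n m) (\<lambda>n m. F' n m * G' n m)"
proof -
  obtain C D where C: "C \<ge> 0" "\<And>n m. 0 < n \<Longrightarrow> m \<in> {1..n} \<Longrightarrow> \<bar>F n m - F' n m\<bar> \<le> C / real n"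
    and D: "D \<ge> 0" "\<And>n m. 0 < n \<Longrightarrow> m \<in> {1..n} \<Longrightarrow> \<bar>G n m - G' n m\<bar> \<le> D / real n"
    using assms(1,2) unfolding unif_close_def by blast
  show ?thesis
    unfolding unif_close_def
  proof (intro exI[of _ "C + D"] conjI allI impI)
    fix n m :: nat assume nm: "0 < n" "m \<in> {1..n}"
    have "F n m * G n m - F' n m * G' n m = (F n m - F' n m) * G n m + F' n m * (G n m - G' n m)"
      by (simp add: algebra_simps)
    also have "\<bar>\<dots>\<bar> \<le> \<bar>F n m - F' n m\<bar> * \<bar>G n m\<bar> + \<bar>F' n m\<bar> * \<bar>G n m - G' n m\<bar>"
      by (rule order_trans[OF abs_triangle_ineq]) (simp add: abs_mult)
    also have "\<dots> \<le> \<bar>F n m - F' n m\<bar> * 1 + 1 * \<bar>G n m - G' n m\<bar>"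
      using assms(3)[OF nm] assms(4)[OF nm] by (intro add_mono mult_mono) auto
    also have "\<dots> \<le> (C + D) / real n"
      using C(2)[OF nm] D(2)[OF nm] by (simp add: add_divide_distrib)
    finally show "\<bar>F n m * G n m - F' n m * G' n m\<bar> \<le> (C + D) / real n" .
  qed (use C D in auto)
qed

lemma unif_close_sym: "unif_close F G \<Longrightarrow> unif_close G F"
  unfolding unif_close_def by (simp add: abs_minus_commute)

lemma unif_close_trans:
  assumes "unif_close F G" "unif_close G H"
  shows "unif_close F H"
proof -
  obtain C D where C: "C \<ge> 0" "\<And>n m. 0 < n \<Longrightarrow> m \<in> {1..n} \<Longrightarrow> \<bar>F n m - G n m\<bar> \<le> C / real n"
    and D: "D \<ge> 0" "\<And>n m. 0 < n \<Longrightarrow> m \<in> {1..n} \<Longrightarrow> \<bar>G n m - H n m\<bar> \<le> D / real n"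
    using assms unfolding unif_close_def by blast
  show ?thesis
    unfolding unif_close_def
  proof (intro exI[of _ "C + D"] conjI allI impI)
    fix n m :: nat assume nm: "0 < n" "m \<in> {1..n}"
    show "\<bar>F n m - H n m\<bar> \<le> (C + D) / real n"
      using C(2)[OF nm] D(2)[OF nm] by (simp add: add_divide_distrib)
  qed (use C D in auto)
qed

lemma unif_close_cmult:
  assumes "unif_close F G"
  shows "unif_close (\<lambda>n m. c * F n m) (\<lambda>n m. c * G n m)"
proof -
  obtain C where C: "C \<ge> 0" "\<And>n m. 0 < n \<Longrightarrow> m \<in> {1..n} \<Longrightarrow> \<bar>F n m - G n m\<bar> \<le> C / real n"
    using assms unfolding unif_close_def by blast
  show ?thesis
    unfolding unif_close_def
  proof (intro exI[of _ "\<bar>c\<bar> * C"] conjI allI impI)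
    fix n m :: nat assume nm: "0 < n" "m \<in> {1..n}"
    have "\<bar>c * F n m - c * G n m\<bar> = \<bar>c\<bar> * \<bar>F n m - G n m\<bar>"
      by (simp add: abs_mult right_diff_distrib[symmetric])
    also have "\<dots> \<le> \<bar>c\<bar> * (C / real n)" using C(2)[OF nm] by (intro mult_left_mono) auto
    finally show "\<bar>c * F n m - c * G n m\<bar> \<le> \<bar>c\<bar> * C / real n" by simp
  qed (use C in auto)
qed

lemma unif_close_average:
  assumes "unif_close F G" and "(\<lambda>n. (\<Sum>m=1..n. G n m) / real n) \<longlonglongrightarrow> l"
  shows "(\<lambda>n. (\<Sum>m=1..n. F n m) / real n) \<longlonglongrightarrow> l"
proof -
  obtain C where C: "C \<ge> 0" "\<And>n m. 0 < n \<Longrightarrow> m \<in> {1..n} \<Longrightarrow> \<bar>F n m - G n m\<bar> \<le> C / real n"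
    using assms(1) unfolding unif_close_def by blast
  have "(\<lambda>n. (\<Sum>m=1..n. F n m) / real n - (\<Sum>m=1..n. G n m) / real n) \<longlonglongrightarrow> 0"
  proof (rule Lim_null_comparison)
    show "\<forall>\<^sub>F n in sequentially. norm ((\<Sum>m=1..n. F n m) / real n - (\<Sum>m=1..n. G n m) / real n) \<le> C / real n"
      using eventually_gt_at_top[of 0]
    proof eventually_elim
      case (elim n)
      have "\<bar>\<Sum>m=1..n. F n m - G n m\<bar> \<le> (\<Sum>m=1..n. C / real n)"
        by (rule order_trans[OF sum_abs sum_mono]) (use C(2)[OF elim] in auto)
      also have "\<dots> = C" using elim by simp
      finally have "\<bar>\<Sum>m=1..n. F n m - G n m\<bar> / real n \<le> C / real n"
        by (intro divide_right_mono) auto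
      then show ?case by (simp add: diff_divide_distrib[symmetric] sum_subtractf)
    qed
    show "(\<lambda>n. C / real n) \<longlonglongrightarrow> 0" by (rule lim_const_over_n)
  qed
  from Lim_transform[OF assms(2) this] show ?thesis .
qed

text \<open>The count of \<open>card_increasing_tuples_at\<close>, divided by n^(d-1) so that it
  stays in [0,1]. It is the coefficient of the \<open>l\<close>-th projection at observation
  \<open>m\<close>.\<close>

definition pos_weight :: "nat \<Rightarrow> nat \<Rightarrow> nat \<Rightarrow> nat \<Rightarrow> real" where
  "pos_weight d l n m = real (((m - 1) choose (l - 1)) * ((n - m) choose (d - l))) / real n ^ (d - 1)"

lemma pos_weight_eq:
  assumes "l \<in> {1..d}"
  shows "pos_weight d l n m = real ((m - 1) choose (l - 1)) / real n ^ (l - 1) *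
    (real ((n - m) choose (d - l)) / real n ^ (d - l))"
proof -
  have "real n ^ (d - 1) = real n ^ (l - 1) * real n ^ (d - l)"
    using assms by (simp add: power_add[symmetric])
  then show ?thesis by (simp add: pos_weight_def)
qed

lemma pos_weight_bounds:
  assumes "l \<in> {1..d}" "m \<in> {1..n}"
  shows "0 \<le> pos_weight d l n m" "pos_weight d l n m \<le> 1"
proof -
  have "m - 1 \<le> n" "n - m \<le> n" "0 < n" using assms by auto
  note b = binomial_quotient_bounds[OF this(1,3), of "l - 1"] binomial_quotient_bounds[OF this(2,3), of "d - l"]
  show "0 \<le> pos_weight d l n m" "pos_weight d l n m \<le> 1"
    unfolding pos_weight_eq[OF assms(1)]
    using mult_le_one[OF b(2,3,4)] mult_nonneg_nonneg[OF b(1,3)] by simp_all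
qed

text \<open>No Riemann sum is evaluated. The product of two weights is uniformly close to a product
  of powers of (m-1)/n and (n-m)/n, and this is again uniformly close to a multiple of a single
  product of binomial coefficients, whose sum over \<open>m\<close> is known exactly from
  \<open>sum_binomial_mult_binomial\<close>.\<close>

lemma average_pos_weight_mult:
  assumes i: "i \<in> {1..d}" and j: "j \<in> {1..d}"
  shows "(\<lambda>n. (\<Sum>m=1..n. pos_weight d i n m * pos_weight d j n m) / real n) \<longlonglongrightarrow> bern_gram d i j"
proof -
  define B where "B = (\<lambda>a n m. real ((m - 1) choose a) / real n ^ a)"
  define B' where "B' = (\<lambda>a n m. real ((n - m) choose a) / real n ^ a)"
  define T where "T = (\<lambda>a n m. (real (m - 1) / real n) ^ a / fact a)"
  define T' where "T' = (\<lambda>a n m. (real (n - m) / real n) ^ a / fact a)"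
  have B: "unif_close (B a) (T a)" and B': "unif_close (B' a) (T' a)" for a
  proof -
    obtain C where C: "C \<ge> 0" "\<And>n k. 0 < n \<Longrightarrow> k \<le> n \<Longrightarrow>
       \<bar>real (k choose a) / real n ^ a - (real k / real n) ^ a / fact a\<bar> \<le> C / real n"
      using binomial_quotient_approx[of a] by blast
    show "unif_close (B a) (T a)" "unif_close (B' a) (T' a)"
      unfolding unif_close_def B_def B'_def T_def T'_def
      by (intro exI[of _ C] conjI allI impI C; auto)+
  qed
  have B1: "\<bar>B a n m\<bar> \<le> 1" "\<bar>B' a n m\<bar> \<le> 1" "\<bar>T a n m\<bar> \<le> 1" "\<bar>T' a n m\<bar> \<le> 1"
    if "0 < n" "m \<in> {1..n}" for a n m
    using that binomial_quotient_bounds[of "m - 1" n a] binomial_quotient_bounds[of "n - m" n a]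
      power_fact_bounds[of "m - 1" n a] power_fact_bounds[of "n - m" n a]
    by (auto simp: B_def B'_def T_def T'_def)
  have mult1: "\<bar>x * y\<bar> \<le> 1" if "\<bar>x\<bar> \<le> 1" "\<bar>y\<bar> \<le> 1" for x y :: real
    using that by (auto simp: abs_mult intro: mult_le_one)
  have pw: "unif_close (pos_weight d l) (\<lambda>n m. T (l - 1) n m * T' (d - l) n m)" if "l \<in> {1..d}" for l
  proof -
    have "pos_weight d l = (\<lambda>n m. B (l - 1) n m * B' (d - l) n m)"
      by (intro ext) (simp add: pos_weight_eq[OF that] B_def B'_def)
    then show ?thesis by (simp, intro unif_close_mult B B' B1)
  qed
  have one: "unif_close (\<lambda>n m. pos_weight d i n m * pos_weight d j n m)
      (\<lambda>n m. (T (i - 1) n m * T' (d - i) n m) * (T (j - 1) n m * T' (d - j) n m))"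
  proof (intro unif_close_mult pw mult1 B1 i j)
    fix n m :: nat assume "m \<in> {1..n}"
    then show "\<bar>pos_weight d j n m\<bar> \<le> 1" by (simp add: pos_weight_bounds[OF j] del: One_nat_def)
  qed
  \<comment> \<open>The factorials that remain when two powers divided by factorials are merged into
    one.\<close>
  define c where "c = fact (i + j - 2) * fact (2 * d - i - j) /
     (fact (i - 1) * fact (j - 1) * fact (d - i) * fact (d - j) :: real)"
  have two: "(\<lambda>n m. (T (i - 1) n m * T' (d - i) n m) * (T (j - 1) n m * T' (d - j) n m))
      = (\<lambda>n m. c * (T (i + j - 2) n m * T' (2 * d - i - j) n m))"
  proof (intro ext)
    fix n m
    have e1: "i - 1 + (j - 1) = i + j - 2" using i j by auto
    have e2: "d - i + (d - j) = 2 * d - i - j" using i j by auto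
    show "(T (i - 1) n m * T' (d - i) n m) * (T (j - 1) n m * T' (d - j) n m)
      = c * (T (i + j - 2) n m * T' (2 * d - i - j) n m)"
      unfolding e1[symmetric] e2[symmetric] c_def T_def T'_def power_add
      by (simp add: field_simps)
  qed
  have three: "unif_close (\<lambda>n m. c * (B (i + j - 2) n m * B' (2 * d - i - j) n m))
      (\<lambda>n m. c * (T (i + j - 2) n m * T' (2 * d - i - j) n m))"
    by (intro unif_close_cmult unif_close_mult B B' B1)
  have close: "unif_close (\<lambda>n m. pos_weight d i n m * pos_weight d j n m)
     (\<lambda>n m. c * (B (i + j - 2) n m * B' (2 * d - i - j) n m))"
    using unif_close_trans[OF one[unfolded two] unif_close_sym[OF three]] .
  have e3: "i + j - 2 + (2 * d - i - j) + 1 = 2 * d - 1" using i j by auto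
  have "(\<Sum>m=1..n. c * (B (i + j - 2) n m * B' (2 * d - i - j) n m)) / real n
    = c * (real (n choose (2 * d - 1)) / real n ^ (2 * d - 1))" for n
  proof -
    have "real n ^ (2 * d - 1) = real n ^ (i + j - 2) * real n ^ (2 * d - i - j) * real n"
      unfolding e3[symmetric] by (simp add: power_add)
    moreover have "real (n choose (2 * d - 1)) =
        (\<Sum>m=1..n. real ((m - 1) choose (i + j - 2)) * real ((n - m) choose (2 * d - i - j)))"
      by (subst e3[symmetric], subst sum_binomial_mult_binomial[symmetric]) simp
    ultimately show ?thesis
      by (simp add: B_def B'_def sum_distrib_left[symmetric] sum_divide_distrib[symmetric])
  qed
  moreover have "(\<lambda>n. c * (real (n choose (2 * d - 1)) / real n ^ (2 * d - 1))) \<longlonglongrightarrow> c * (1 / fact (2 * d - 1))"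
    by (intro tendsto_intros tendsto_binomial_quotient)
  moreover have "c * (1 / fact (2 * d - 1)) = bern_gram d i j"
    by (simp add: c_def bern_gram_def)
  ultimately show ?thesis
    by (intro unif_close_average[OF close]) simp
qed

section \<open>Kernels and projections of an i.i.d. sequence\<close>

text \<open>Otherwise \<open>{1..d}\<close> is rewritten to \<open>{Suc 0..d}\<close>, which hides the product spaces
  \<open>Pi\<^sub>M {1..d}\<close> from the measurability rules.\<close>

declare One_nat_def [simp del]

text \<open>By independence the joint law is a product, so an iterated integral over two separate
  points of \<open>M\<close> takes the place of a conditional expectation.\<close>

lemma (in prob_space) indep_var_fubini:
  fixes h :: "'b \<times> 'b \<Rightarrow> real"
  assumes ind: "indep_var N1 Z N2 Y" and h[measurable]: "h \<in> borel_measurable (N1 \<Otimes>\<^sub>M N2)"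
    and int: "integrable M (\<lambda>\<omega>. h (Z \<omega>, Y \<omega>))"
  shows indep_var_AE_integrable: "AE \<omega> in M. integrable M (\<lambda>\<omega>'. h (Z \<omega>, Y \<omega>'))"
    and indep_var_integrable_section: "integrable M (\<lambda>\<omega>. \<integral>\<omega>'. h (Z \<omega>, Y \<omega>') \<partial>M)"
    and indep_var_integral_section: "(\<integral>\<omega>. (\<integral>\<omega>'. h (Z \<omega>, Y \<omega>') \<partial>M) \<partial>M) = (\<integral>\<omega>. h (Z \<omega>, Y \<omega>) \<partial>M)"
proof -
  have Z[measurable]: "Z \<in> measurable M N1" and Y[measurable]: "Y \<in> measurable M N2"
    and D: "distr M N1 Z \<Otimes>\<^sub>M distr M N2 Y = distr M (N1 \<Otimes>\<^sub>M N2) (\<lambda>x. (Z x, Y x))"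
    using ind by (auto simp: indep_var_distribution_eq)
  interpret D1: prob_space "distr M N1 Z" by (rule prob_space_distr) simp
  interpret D2: prob_space "distr M N2 Y" by (rule prob_space_distr) simp
  interpret P: pair_sigma_finite "distr M N1 Z" "distr M N2 Y" ..
  have int': "integrable (distr M N1 Z \<Otimes>\<^sub>M distr M N2 Y) h"
    unfolding D using int by (subst integrable_distr_eq) auto
  have sec: "integrable (distr M N2 Y) (\<lambda>y. h (z, y)) \<longleftrightarrow> integrable M (\<lambda>\<omega>'. h (z, Y \<omega>'))"
    "(\<integral>y. h (z, y) \<partial>distr M N2 Y) = (\<integral>\<omega>'. h (z, Y \<omega>') \<partial>M)" if z[simp]: "z \<in> space N1" for z
    by (simp_all add: integrable_distr_eq integral_distr)
  have Zsp: "Z \<omega> \<in> space N1" if "\<omega> \<in> space M" for \<omega> using measurable_space[OF Z that] .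
  have "AE \<omega> in M. integrable (distr M N2 Y) (\<lambda>y. h (Z \<omega>, y))"
    by (rule AE_distrD[OF Z P.AE_integrable_fst'[OF int']])
  then show "AE \<omega> in M. integrable M (\<lambda>\<omega>'. h (Z \<omega>, Y \<omega>'))"
    using AE_space by eventually_elim (simp add: sec Zsp)
  have "integrable M (\<lambda>\<omega>. \<integral>y. h (Z \<omega>, y) \<partial>distr M N2 Y)"
    using P.integrable_fst'[OF int'] by (rule integrable_distr[OF Z])
  then show "integrable M (\<lambda>\<omega>. \<integral>\<omega>'. h (Z \<omega>, Y \<omega>') \<partial>M)"
    by (rule Bochner_Integration.integrable_cong[THEN iffD1, rotated -1]) (auto simp: sec Zsp)
  have "(\<integral>\<omega>. (\<integral>\<omega>'. h (Z \<omega>, Y \<omega>') \<partial>M) \<partial>M) = (\<integral>\<omega>. (\<integral>y. h (Z \<omega>, y) \<partial>distr M N2 Y) \<partial>M)"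
    by (intro Bochner_Integration.integral_cong) (auto simp: sec Zsp)
  also have "\<dots> = (\<integral>z. (\<integral>y. h (z, y) \<partial>distr M N2 Y) \<partial>distr M N1 Z)"
    using P.integrable_fst'[OF int'] by (subst integral_distr[OF Z]) (auto dest: borel_measurable_integrable)
  also have "\<dots> = integral\<^sup>L (distr M N1 Z \<Otimes>\<^sub>M distr M N2 Y) h"
    by (rule P.integral_fst'[OF int'])
  also have "\<dots> = (\<integral>\<omega>. h (Z \<omega>, Y \<omega>) \<partial>M)"
    unfolding D by (subst integral_distr) auto
  finally show "(\<integral>\<omega>. (\<integral>\<omega>'. h (Z \<omega>, Y \<omega>') \<partial>M) \<partial>M) = (\<integral>\<omega>. h (Z \<omega>, Y \<omega>) \<partial>M)" .
qed

lemma (in prob_space) square_expectation_le: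
  fixes Y :: "'a \<Rightarrow> real"
  assumes "random_variable borel Y" "integrable M (\<lambda>\<omega>. (Y \<omega>)\<^sup>2)"
  shows "(expectation Y)\<^sup>2 \<le> expectation (\<lambda>\<omega>. (Y \<omega>)\<^sup>2)"
proof -
  have "integrable M Y" using assms by (rule square_integrable_imp_integrable)
  then have "variance Y = expectation (\<lambda>\<omega>. (Y \<omega>)\<^sup>2) - (expectation Y)\<^sup>2"
    using assms by (intro variance_eq) auto
  then show ?thesis using variance_positive[of Y] by linarith
qed

lemma square_integrable_mult:
  fixes Y Z :: "'a \<Rightarrow> real"
  assumes [measurable]: "Y \<in> borel_measurable M" "Z \<in> borel_measurable M"
    and "integrable M (\<lambda>\<omega>. (Y \<omega>)\<^sup>2)" "integrable M (\<lambda>\<omega>. (Z \<omega>)\<^sup>2)"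
  shows "integrable M (\<lambda>\<omega>. Y \<omega> * Z \<omega>)"
    and "\<bar>\<integral>\<omega>. Y \<omega> * Z \<omega> \<partial>M\<bar> \<le> ((\<integral>\<omega>. (Y \<omega>)\<^sup>2 \<partial>M) + (\<integral>\<omega>. (Z \<omega>)\<^sup>2 \<partial>M)) / 2"
proof -
  have le: "\<bar>a * b\<bar> \<le> (a\<^sup>2 + b\<^sup>2) / 2" for a b :: real
    using sum_squares_bound[of "\<bar>a\<bar>" "\<bar>b\<bar>"] by (simp add: abs_mult field_simps)
  have dom: "integrable M (\<lambda>\<omega>. ((Y \<omega>)\<^sup>2 + (Z \<omega>)\<^sup>2) / 2)"
    using assms by simp
  show int: "integrable M (\<lambda>\<omega>. Y \<omega> * Z \<omega>)"
  proof (rule Bochner_Integration.integrable_bound[OF dom])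
    show "AE \<omega> in M. norm (Y \<omega> * Z \<omega>) \<le> norm (((Y \<omega>)\<^sup>2 + (Z \<omega>)\<^sup>2) / 2)"
      unfolding real_norm_def by (intro AE_I2 order_trans[OF le abs_ge_self])
  qed measurable
  have "\<bar>\<integral>\<omega>. Y \<omega> * Z \<omega> \<partial>M\<bar> \<le> (\<integral>\<omega>. \<bar>Y \<omega> * Z \<omega>\<bar> \<partial>M)"
    by (rule integral_abs_bound)
  also have "\<dots> \<le> (\<integral>\<omega>. ((Y \<omega>)\<^sup>2 + (Z \<omega>)\<^sup>2) / 2 \<partial>M)"
    using int dom le by (intro integral_mono) auto
  also have "\<dots> = ((\<integral>\<omega>. (Y \<omega>)\<^sup>2 \<partial>M) + (\<integral>\<omega>. (Z \<omega>)\<^sup>2 \<partial>M)) / 2"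
    using assms by simp
  finally show "\<bar>\<integral>\<omega>. Y \<omega> * Z \<omega> \<partial>M\<bar> \<le> ((\<integral>\<omega>. (Y \<omega>)\<^sup>2 \<partial>M) + (\<integral>\<omega>. (Z \<omega>)\<^sup>2 \<partial>M)) / 2" .
qed

lemma square_integrable_add:
  fixes Y Z :: "'a \<Rightarrow> real"
  assumes [measurable]: "Y \<in> borel_measurable M" "Z \<in> borel_measurable M"
    and "integrable M (\<lambda>\<omega>. (Y \<omega>)\<^sup>2)" "integrable M (\<lambda>\<omega>. (Z \<omega>)\<^sup>2)"
  shows "integrable M (\<lambda>\<omega>. (Y \<omega> + Z \<omega>)\<^sup>2)"
  unfolding power2_sum
  using assms square_integrable_mult(1)[OF assms] by (auto simp: mult.assoc)

lemma square_integrable_sum: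
  fixes Y :: "'i \<Rightarrow> 'a \<Rightarrow> real"
  assumes "finite A" "\<And>i. i \<in> A \<Longrightarrow> Y i \<in> borel_measurable M"
    and "\<And>i. i \<in> A \<Longrightarrow> integrable M (\<lambda>\<omega>. (Y i \<omega>)\<^sup>2)"
  shows "integrable M (\<lambda>\<omega>. (\<Sum>i\<in>A. Y i \<omega>)\<^sup>2)"
  using assms
proof (induction A rule: finite_induct)
  case (insert i A)
  then have "integrable M (\<lambda>\<omega>. (Y i \<omega> + (\<Sum>i\<in>A. Y i \<omega>))\<^sup>2)"
    by (intro square_integrable_add) auto
  then show ?case using insert.hyps by simp
qed simp

section \<open>Tuples of an i.i.d. sequence and square integrable kernels\<close>

locale iid_sequence = prob_space M for M :: "'a measure" +
  fixes S :: "'s measure" and X :: "nat \<Rightarrow> 'a \<Rightarrow> 's"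
  assumes indep: "indep_vars (\<lambda>_. S) X UNIV"
    and ident: "\<And>n. distr M S (X n) = distr M S (X 0)"
begin

lemma X_measurable[measurable]: "X n \<in> measurable M S"
  using indep by (auto simp: indep_vars_def2)

lemma X_space: "\<omega> \<in> space M \<Longrightarrow> X n \<omega> \<in> space S"
  using measurable_space[OF X_measurable] .

text \<open>Injectivity makes the selected variables distinct. The law of the whole sequence is an
  infinite power, and the tuple is a reindexed marginal of it, with a law that does not depend on
  \<open>I\<close>.\<close>

lemma distr_tuple:
  fixes I :: "nat \<Rightarrow> nat"
  assumes "inj_on I K"
  shows "distr M (Pi\<^sub>M K (\<lambda>_. S)) (\<lambda>\<omega>. \<lambda>k\<in>K. X (I k) \<omega>) = Pi\<^sub>M K (\<lambda>_. distr M S (X 0))"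
proof -
  let ?P = "distr M S (X 0)"
  have "distr M (Pi\<^sub>M UNIV (\<lambda>_. S)) (\<lambda>\<omega>. \<lambda>i\<in>UNIV. X i \<omega>) = Pi\<^sub>M UNIV (\<lambda>i. distr M S (X i))"
    using indep_vars_iff_distr_eq_PiM[of UNIV X "\<lambda>_. S"] indep by auto
  then have joint: "distr M (Pi\<^sub>M UNIV (\<lambda>_. S)) (\<lambda>\<omega>. \<lambda>i\<in>UNIV. X i \<omega>) = Pi\<^sub>M UNIV (\<lambda>_. ?P)"
    unfolding ext[of "\<lambda>i. distr M S (X i)" "\<lambda>_. ?P", OF ident] .
  have sets: "sets (Pi\<^sub>M A (\<lambda>_. ?P)) = sets (Pi\<^sub>M A (\<lambda>_. S))" for A :: "nat set"
    by (rule sets_PiM_cong) auto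
  have "Pi\<^sub>M K (\<lambda>_. ?P) = distr (Pi\<^sub>M UNIV (\<lambda>_. ?P)) (Pi\<^sub>M K (\<lambda>_. ?P)) (\<lambda>x. \<lambda>n\<in>K. x (I n))"
    by (rule distr_PiM_reindex[symmetric]) (auto intro!: prob_space_distr assms)
  also have "\<dots> = distr (distr M (Pi\<^sub>M UNIV (\<lambda>_. S)) (\<lambda>\<omega>. \<lambda>i\<in>UNIV. X i \<omega>)) (Pi\<^sub>M K (\<lambda>_. S)) (\<lambda>x. \<lambda>n\<in>K. x (I n))"
    unfolding joint by (rule distr_cong) (simp_all add: sets)
  also have "\<dots> = distr M (Pi\<^sub>M K (\<lambda>_. S)) ((\<lambda>x. \<lambda>n\<in>K. x (I n)) \<circ> (\<lambda>\<omega>. \<lambda>i\<in>UNIV. X i \<omega>))"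
    by (rule distr_distr) (auto intro!: measurable_restrict measurable_component_singleton)
  also have "(\<lambda>x. \<lambda>n\<in>K. x (I n)) \<circ> (\<lambda>\<omega>. \<lambda>i\<in>UNIV. X i \<omega>) = (\<lambda>\<omega>. \<lambda>k\<in>K. X (I k) \<omega>)"
    by (auto simp: fun_eq_iff)
  finally show ?thesis by (rule sym)
qed

lemma tuple_measurable[measurable]: "(\<lambda>\<omega>. \<lambda>k\<in>K. X (I k) \<omega>) \<in> measurable M (Pi\<^sub>M K (\<lambda>_. S))"
  by (intro measurable_restrict) simp

lemma
  fixes I J :: "nat \<Rightarrow> nat" and F :: "(nat \<Rightarrow> 's) \<Rightarrow> real"
  assumes I: "inj_on I K" and J: "inj_on J K" and F[measurable]: "F \<in> borel_measurable (Pi\<^sub>M K (\<lambda>_. S))"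
  shows integrable_tuple: "integrable M (\<lambda>\<omega>. F (\<lambda>k\<in>K. X (I k) \<omega>)) \<longleftrightarrow> integrable M (\<lambda>\<omega>. F (\<lambda>k\<in>K. X (J k) \<omega>))"
    and expectation_tuple: "expectation (\<lambda>\<omega>. F (\<lambda>k\<in>K. X (I k) \<omega>)) = expectation (\<lambda>\<omega>. F (\<lambda>k\<in>K. X (J k) \<omega>))"
  using integrable_distr_eq[OF tuple_measurable F, of I] integrable_distr_eq[OF tuple_measurable F, of J]
    integral_distr[OF tuple_measurable F, of I] integral_distr[OF tuple_measurable F, of J]
  by (simp_all add: distr_tuple[OF I] distr_tuple[OF J])

lemma
  fixes F :: "'s \<Rightarrow> real"
  assumes F[measurable]: "F \<in> borel_measurable S"
  shows integrable_X: "integrable M (\<lambda>\<omega>. F (X n \<omega>)) \<longleftrightarrow> integrable M (\<lambda>\<omega>. F (X 0 \<omega>))"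
    and expectation_X: "expectation (\<lambda>\<omega>. F (X n \<omega>)) = expectation (\<lambda>\<omega>. F (X 0 \<omega>))"
  using integrable_distr_eq[OF X_measurable F, of n] integrable_distr_eq[OF X_measurable F, of 0]
    integral_distr[OF X_measurable F, of n] integral_distr[OF X_measurable F, of 0]
  by (simp_all add: ident[of n])

lemma AE_X:
  assumes "{x \<in> space S. Q x} \<in> sets S"
  shows "(AE \<omega> in M. Q (X n \<omega>)) \<longleftrightarrow> (AE \<omega> in M. Q (X 0 \<omega>))"
  using AE_distr_iff[OF X_measurable assms, of n] AE_distr_iff[OF X_measurable assms, of 0]
  unfolding ident[of n] by simp

text \<open>Square integrability is asked for the indices 1 to \<open>d\<close>; by
  \<open>kernel_square_integrable\<close> it passes to every injective choice of indices.\<close>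

definition kernel :: "nat \<Rightarrow> ((nat \<Rightarrow> 's) \<Rightarrow> real) \<Rightarrow> bool" where
  "kernel d g \<longleftrightarrow> g \<in> borel_measurable (Pi\<^sub>M {1..d} (\<lambda>_. S)) \<and>
     integrable M (\<lambda>\<omega>. (g (\<lambda>k\<in>{1..d}. X k \<omega>))\<^sup>2)"

lemma kernel_measurable: "kernel d g \<Longrightarrow> g \<in> borel_measurable (Pi\<^sub>M {1..d} (\<lambda>_. S))"
  by (simp add: kernel_def)

lemma kernel_rv:
  assumes "kernel d g"
  shows "random_variable borel (\<lambda>\<omega>. g (\<lambda>k\<in>{1..d}. X (I k) \<omega>))"
  using measurable_compose[OF tuple_measurable kernel_measurable[OF assms]] .

lemma
  assumes g: "kernel d g" and I: "inj_on I {1..d}"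
  shows kernel_square_integrable: "integrable M (\<lambda>\<omega>. (g (\<lambda>k\<in>{1..d}. X (I k) \<omega>))\<^sup>2)"
    and kernel_integrable: "integrable M (\<lambda>\<omega>. g (\<lambda>k\<in>{1..d}. X (I k) \<omega>))"
    and kernel_square: "expectation (\<lambda>\<omega>. (g (\<lambda>k\<in>{1..d}. X (I k) \<omega>))\<^sup>2)
      = expectation (\<lambda>\<omega>. (g (\<lambda>k\<in>{1..d}. X k \<omega>))\<^sup>2)"
    and kernel_expectation: "expectation (\<lambda>\<omega>. g (\<lambda>k\<in>{1..d}. X (I k) \<omega>)) = U_mean M d g X"
proof -
  have [measurable]: "g \<in> borel_measurable (Pi\<^sub>M {1..d} (\<lambda>_. S))" using kernel_measurable[OF g] .
  show *: "integrable M (\<lambda>\<omega>. (g (\<lambda>k\<in>{1..d}. X (I k) \<omega>))\<^sup>2)"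
    using integrable_tuple[OF I, of "\<lambda>k. k" "\<lambda>x. (g x)\<^sup>2"] g by (auto simp: kernel_def)
  show "integrable M (\<lambda>\<omega>. g (\<lambda>k\<in>{1..d}. X (I k) \<omega>))"
    by (rule square_integrable_imp_integrable[OF kernel_rv[OF g] *])
  show "expectation (\<lambda>\<omega>. (g (\<lambda>k\<in>{1..d}. X (I k) \<omega>))\<^sup>2) = expectation (\<lambda>\<omega>. (g (\<lambda>k\<in>{1..d}. X k \<omega>))\<^sup>2)"
    by (rule expectation_tuple[OF I, where J="\<lambda>k. k" and F="\<lambda>x. (g x)\<^sup>2"]) auto
  show "expectation (\<lambda>\<omega>. g (\<lambda>k\<in>{1..d}. X (I k) \<omega>)) = U_mean M d g X"
    unfolding U_mean_def by (rule expectation_tuple[OF I, where J="\<lambda>k. k"]) auto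
qed

lemma kernel_const: "kernel d (\<lambda>_. c)"
  by (simp add: kernel_def)

lemma kernel_add:
  assumes "kernel d g" "kernel d h"
  shows "kernel d (\<lambda>x. g x + h x)"
proof -
  have "inj_on (\<lambda>k. k) {1..d}" by simp
  note sq = kernel_square_integrable[OF assms(1) this] kernel_square_integrable[OF assms(2) this]
  show ?thesis
    unfolding kernel_def
  proof
    show "(\<lambda>x. g x + h x) \<in> borel_measurable (Pi\<^sub>M {1..d} (\<lambda>_. S))"
      using assms by (auto simp: kernel_def)
    show "integrable M (\<lambda>\<omega>. (g (\<lambda>k\<in>{1..d}. X k \<omega>) + h (\<lambda>k\<in>{1..d}. X k \<omega>))\<^sup>2)"
      by (rule square_integrable_add[OF kernel_rv[OF assms(1)] kernel_rv[OF assms(2)] sq])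
  qed
qed

lemma kernel_cmult: "kernel d g \<Longrightarrow> kernel d (\<lambda>x. c * g x)"
  by (auto simp: kernel_def power_mult_distrib)

lemma kernel_diff: "kernel d g \<Longrightarrow> kernel d h \<Longrightarrow> kernel d (\<lambda>x. g x - h x)"
  using kernel_add[of d g "\<lambda>x. (-1) * h x"] kernel_cmult[of d h "-1"] by simp

lemma kernel_sum:
  assumes "finite A" "\<And>i. i \<in> A \<Longrightarrow> kernel d (g i)"
  shows "kernel d (\<lambda>x. \<Sum>i\<in>A. g i x)"
  using assms
proof (induction A rule: finite_induct)
  case empty then show ?case using kernel_const[of d 0] by simp
next
  case (insert i A)
  then show ?case using kernel_add[of d "g i" "\<lambda>x. \<Sum>i\<in>A. g i x"] by simp
qed

lemma kernel_component:
  assumes "F \<in> borel_measurable S" "integrable M (\<lambda>\<omega>. (F (X 0 \<omega>))\<^sup>2)" "l \<in> {1..d}"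
  shows "kernel d (\<lambda>x. F (x l))"
  unfolding kernel_def
proof
  note [measurable] = assms(1)
  show "(\<lambda>x. F (x l)) \<in> borel_measurable (Pi\<^sub>M {1..d} (\<lambda>_. S))"
    using assms(3) by measurable
  show "integrable M (\<lambda>\<omega>. (F ((\<lambda>k\<in>{1..d}. X k \<omega>) l))\<^sup>2)"
    using integrable_X[of "\<lambda>x. (F x)\<^sup>2" l] assms by simp
qed

lemma kernel_max0:
  assumes "kernel d g"
  shows "kernel d (\<lambda>x. max 0 (g x))"
  unfolding kernel_def
proof
  note [measurable] = kernel_measurable[OF assms]
  show "(\<lambda>x. max 0 (g x)) \<in> borel_measurable (Pi\<^sub>M {1..d} (\<lambda>_. S))" by measurable
  show "integrable M (\<lambda>\<omega>. (max 0 (g (\<lambda>k\<in>{1..d}. X k \<omega>)))\<^sup>2)"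
  proof (rule Bochner_Integration.integrable_bound[of M "\<lambda>\<omega>. (g (\<lambda>k\<in>{1..d}. X k \<omega>))\<^sup>2"])
    show "integrable M (\<lambda>\<omega>. (g (\<lambda>k\<in>{1..d}. X k \<omega>))\<^sup>2)" using assms by (simp add: kernel_def)
    show "AE \<omega> in M. norm ((max 0 (g (\<lambda>k\<in>{1..d}. X k \<omega>)))\<^sup>2) \<le> norm ((g (\<lambda>k\<in>{1..d}. X k \<omega>))\<^sup>2)"
      by (auto simp: max_def)
  qed measurable
qed

text \<open>The squared sum is expanded over pairs of tuples; only the pairs in \<open>B\<close> contribute.\<close>

lemma second_moment_sum_kernel:
  assumes g: "kernel d g" and T: "finite T" "\<And>I. I \<in> T \<Longrightarrow> inj_on I {1..d}"
    and orth: "\<And>I J. I \<in> T \<Longrightarrow> J \<in> T \<Longrightarrow> (I, J) \<notin> B \<Longrightarrow>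
      expectation (\<lambda>\<omega>. g (\<lambda>k\<in>{1..d}. X (I k) \<omega>) * g (\<lambda>k\<in>{1..d}. X (J k) \<omega>)) = 0"
    and B: "B \<subseteq> T \<times> T"
  shows "expectation (\<lambda>\<omega>. (\<Sum>I\<in>T. g (\<lambda>k\<in>{1..d}. X (I k) \<omega>))\<^sup>2)
     \<le> real (card B) * expectation (\<lambda>\<omega>. (g (\<lambda>k\<in>{1..d}. X k \<omega>))\<^sup>2)"
proof -
  let ?g = "\<lambda>I \<omega>. g (\<lambda>k\<in>{1..d}. X (I k) \<omega>)"
  let ?q = "expectation (\<lambda>\<omega>. (g (\<lambda>k\<in>{1..d}. X k \<omega>))\<^sup>2)"
  have int: "integrable M (\<lambda>\<omega>. ?g I \<omega> * ?g J \<omega>)"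
    and le: "expectation (\<lambda>\<omega>. ?g I \<omega> * ?g J \<omega>) \<le> ?q" if "I \<in> T" "J \<in> T" for I J
  proof -
    note * = square_integrable_mult[OF kernel_rv[OF g, of I] kernel_rv[OF g, of J]
        kernel_square_integrable[OF g T(2)[OF that(1)]] kernel_square_integrable[OF g T(2)[OF that(2)]]]
    show "integrable M (\<lambda>\<omega>. ?g I \<omega> * ?g J \<omega>)" by (rule *(1))
    show "expectation (\<lambda>\<omega>. ?g I \<omega> * ?g J \<omega>) \<le> ?q"
      using abs_le_D1[OF *(2)]
      unfolding kernel_square[OF g T(2)[OF that(1)]] kernel_square[OF g T(2)[OF that(2)]] by simp
  qed
  have "expectation (\<lambda>\<omega>. (\<Sum>I\<in>T. ?g I \<omega>)\<^sup>2) = expectation (\<lambda>\<omega>. \<Sum>p\<in>T \<times> T. ?g (fst p) \<omega> * ?g (snd p) \<omega>)"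
    by (simp add: power2_eq_square sum_product sum.cartesian_product case_prod_beta)
  also have "\<dots> = (\<Sum>p\<in>T \<times> T. expectation (\<lambda>\<omega>. ?g (fst p) \<omega> * ?g (snd p) \<omega>))"
    by (intro Bochner_Integration.integral_sum) (auto intro: int)
  also have "\<dots> = (\<Sum>p\<in>B. expectation (\<lambda>\<omega>. ?g (fst p) \<omega> * ?g (snd p) \<omega>))"
    using B T(1) by (intro sum.mono_neutral_right) (auto intro!: orth)
  also have "\<dots> \<le> (\<Sum>p\<in>B. ?q)"
    using B by (intro sum_mono le) auto
  finally show ?thesis by simp
qed

end

lemma measurable_if_const:
  "(c \<Longrightarrow> f \<in> measurable N L) \<Longrightarrow> (\<not> c \<Longrightarrow> h \<in> measurable N L)
    \<Longrightarrow> (\<lambda>x. if c then f x else h x) \<in> measurable N L"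
  by (cases c) simp_all

lemma measurable_fst_component: "i \<in> A \<Longrightarrow> (\<lambda>p. fst p i) \<in> measurable (Pi\<^sub>M A S \<Otimes>\<^sub>M N) (S i)"
  by (rule measurable_compose[OF measurable_fst measurable_component_singleton])

lemma measurable_snd_component: "i \<in> A \<Longrightarrow> (\<lambda>p. snd p i) \<in> measurable (N \<Otimes>\<^sub>M Pi\<^sub>M A S) (S i)"
  by (rule measurable_compose[OF measurable_snd measurable_component_singleton])

section \<open>Sections, first projections and orthogonality\<close>

context iid_sequence begin

lemma section_measurable:
  assumes [measurable]: "g \<in> borel_measurable (Pi\<^sub>M {1..d} (\<lambda>_. S))"
  shows "(\<lambda>(x, \<omega>). g (\<lambda>k\<in>{1..d}. if k = i then x else X (I k) \<omega>)) \<in> borel_measurable (S \<Otimes>\<^sub>M M)"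
proof -
  have "(\<lambda>p. \<lambda>k\<in>{1..d}. if k = i then fst p else X (I k) (snd p)) \<in> measurable (S \<Otimes>\<^sub>M M) (Pi\<^sub>M {1..d} (\<lambda>_. S))"
    by (intro measurable_restrict) simp
  from measurable_compose[OF this assms] show ?thesis by (simp add: case_prod_beta)
qed

lemma U_proj_measurable:
  assumes "g \<in> borel_measurable (Pi\<^sub>M {1..d} (\<lambda>_. S))"
  shows "U_proj M d g X i \<in> borel_measurable S"
  unfolding U_proj_def[abs_def]
  using borel_measurable_lebesgue_integral[OF section_measurable[OF assms, of i "\<lambda>k. k"]] by simp

lemma restrict_section:
  "(\<lambda>k\<in>{1..d}. if k = i then x else (\<lambda>k\<in>{1..d} - {i}. y k) k) = (\<lambda>k\<in>{1..d}. if k = i then x else y k)"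
  by (rule restrict_ext) simp

text \<open>The integrand ignores coordinate \<open>i\<close>, and the remaining coordinates have
  the same law for every injective choice of indices.\<close>

lemma section_reindex:
  assumes g[measurable]: "g \<in> borel_measurable (Pi\<^sub>M {1..d} (\<lambda>_. S))"
    and i: "i \<in> {1..d}" and I: "inj_on I {1..d}" and x[measurable]: "x \<in> space S"
  shows "expectation (\<lambda>\<omega>. g (\<lambda>k\<in>{1..d}. if k = i then x else X (I k) \<omega>)) = U_proj M d g X i x + U_mean M d g X"
proof -
  let ?F = "\<lambda>y. g (\<lambda>k\<in>{1..d}. if k = i then x else y k)"
  have "(\<lambda>y. \<lambda>k\<in>{1..d}. if k = i then x else y k) \<in> measurable (Pi\<^sub>M ({1..d} - {i}) (\<lambda>_. S)) (Pi\<^sub>M {1..d} (\<lambda>_. S))"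
  proof (intro measurable_restrict)
    fix k assume "k \<in> {1..d}"
    then show "(\<lambda>y. if k = i then x else y k) \<in> measurable (Pi\<^sub>M ({1..d} - {i}) (\<lambda>_. S)) S"
      using x by (cases "k = i") auto
  qed
  from measurable_compose[OF this g] have F: "?F \<in> borel_measurable (Pi\<^sub>M ({1..d} - {i}) (\<lambda>_. S))" .
  have "inj_on I ({1..d} - {i})" "inj_on (\<lambda>k. k) ({1..d} - {i})"
    using inj_on_subset[OF I, of "{1..d} - {i}"] by simp_all
  from expectation_tuple[OF this F] show ?thesis
    unfolding restrict_section U_proj_def by simp
qed

lemma indep_var_split:
  assumes "A \<inter> B = {}"
  shows "indep_var (Pi\<^sub>M A (\<lambda>_. S)) (\<lambda>\<omega>. \<lambda>k\<in>A. X k \<omega>) (Pi\<^sub>M B (\<lambda>_. S)) (\<lambda>\<omega>. \<lambda>k\<in>B. X k \<omega>)"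
  by (rule indep_var_restrict[OF indep assms]) auto

text \<open>Fubini's theorem with \<open>X i\<close> split off from the other coordinates.
  Afterwards \<open>X i\<close> is exchanged for \<open>X 0\<close>, the copy at which projections
  are evaluated.\<close>

lemma section_fubini:
  assumes g[measurable]: "g \<in> borel_measurable (Pi\<^sub>M {1..d} (\<lambda>_. S))"
    and int: "integrable M (\<lambda>\<omega>. g (\<lambda>k\<in>{1..d}. X k \<omega>))" and i: "i \<in> {1..d}"
  shows section_AE_integrable: "AE \<omega> in M. integrable M (\<lambda>\<omega>'. g (\<lambda>k\<in>{1..d}. if k = i then X 0 \<omega> else X k \<omega>'))"
    and section_integral: "(\<integral>\<omega>. (\<integral>\<omega>'. g (\<lambda>k\<in>{1..d}. if k = i then X 0 \<omega> else X k \<omega>') \<partial>M) \<partial>M) = U_mean M d g X"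
    and section_integrable: "integrable M (\<lambda>\<omega>. \<integral>\<omega>'. g (\<lambda>k\<in>{1..d}. if k = i then X 0 \<omega> else X k \<omega>') \<partial>M)"
proof -
  let ?A = "{i}" and ?B = "{1..d} - {i}"
  define h where "h = (\<lambda>(z, y). g (\<lambda>k\<in>{1..d}. if k = i then z i else y k))"
  let ?Z = "\<lambda>\<omega>. \<lambda>k\<in>?A. X k \<omega>" and ?Y = "\<lambda>\<omega>. \<lambda>k\<in>?B. X k \<omega>"
  have "(\<lambda>p. \<lambda>k\<in>{1..d}. if k = i then fst p i else snd p k)
      \<in> measurable (Pi\<^sub>M ?A (\<lambda>_. S) \<Otimes>\<^sub>M Pi\<^sub>M ?B (\<lambda>_. S)) (Pi\<^sub>M {1..d} (\<lambda>_. S))"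
    by (intro measurable_restrict measurable_if_const measurable_fst_component measurable_snd_component) auto
  from measurable_compose[OF this g]
  have h: "h \<in> borel_measurable (Pi\<^sub>M ?A (\<lambda>_. S) \<Otimes>\<^sub>M Pi\<^sub>M ?B (\<lambda>_. S))"
    by (simp add: h_def case_prod_beta)
  have hZY: "h (?Z \<omega>, ?Y \<omega>') = g (\<lambda>k\<in>{1..d}. if k = i then X i \<omega> else X k \<omega>')" for \<omega> \<omega>'
  proof -
    have "(\<lambda>k\<in>{1..d}. if k = i then ?Z \<omega> i else ?Y \<omega>' k) = (\<lambda>k\<in>{1..d}. if k = i then X i \<omega> else X k \<omega>')"
      by (rule restrict_ext) auto
    then show ?thesis unfolding h_def prod.case by (rule arg_cong)
  qed
  have diag: "(\<lambda>k\<in>{1..d}. if k = i then X i \<omega> else X k \<omega>) = (\<lambda>k\<in>{1..d}. X k \<omega>)" for \<omega>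
    by (auto simp: restrict_def)
  have "integrable M (\<lambda>\<omega>. h (?Z \<omega>, ?Y \<omega>))" unfolding hZY diag by (rule int)
  note fub = indep_var_fubini[OF indep_var_split h this, unfolded hZY diag]
  let ?\<Phi> = "\<lambda>x. \<integral>\<omega>'. g (\<lambda>k\<in>{1..d}. if k = i then x else X k \<omega>') \<partial>M"
  have \<Phi>: "?\<Phi> \<in> borel_measurable S"
    using borel_measurable_lebesgue_integral[OF section_measurable[OF g, of i "\<lambda>k. k"]] by simp
  have "Measurable.pred S (\<lambda>x. integrable M (\<lambda>\<omega>'. g (\<lambda>k\<in>{1..d}. if k = i then x else X k \<omega>')))"
    using borel_measurable_lebesgue_integrable[OF section_measurable[OF g, of i "\<lambda>k. k"]] by simp
  then have "{x \<in> space S. integrable M (\<lambda>\<omega>'. g (\<lambda>k\<in>{1..d}. if k = i then x else X k \<omega>'))} \<in> sets S"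
    by (simp add: pred_def)
  from AE_X[OF this, of i] show "AE \<omega> in M. integrable M (\<lambda>\<omega>'. g (\<lambda>k\<in>{1..d}. if k = i then X 0 \<omega> else X k \<omega>'))"
    using fub(1) by auto
  show "(\<integral>\<omega>. ?\<Phi> (X 0 \<omega>) \<partial>M) = U_mean M d g X"
    using fub(3) expectation_X[OF \<Phi>, of i] by (simp add: U_mean_def)
  show "integrable M (\<lambda>\<omega>. ?\<Phi> (X 0 \<omega>))"
    using fub(2) integrable_X[OF \<Phi>, of i] by simp
qed

lemma
  assumes g: "kernel d g" and i: "i \<in> {1..d}"
  shows expectation_U_proj: "expectation (\<lambda>\<omega>. U_proj M d g X i (X n \<omega>)) = 0"
    and U_proj_square_integrable: "integrable M (\<lambda>\<omega>. (U_proj M d g X i (X n \<omega>))\<^sup>2)"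
    and U_proj_AE_integrable: "AE \<omega> in M. integrable M (\<lambda>\<omega>'. g (\<lambda>k\<in>{1..d}. if k = i then X 0 \<omega> else X k \<omega>'))"
proof -
  note gm[measurable] = kernel_measurable[OF g]
  have int: "integrable M (\<lambda>\<omega>. g (\<lambda>k\<in>{1..d}. X k \<omega>))" using kernel_integrable[OF g, of "\<lambda>k. k"] by simp
  note pm = U_proj_measurable[OF gm, of i]
  show AEi: "AE \<omega> in M. integrable M (\<lambda>\<omega>'. g (\<lambda>k\<in>{1..d}. if k = i then X 0 \<omega> else X k \<omega>'))"
    by (rule section_AE_integrable[OF gm int i])
  have "expectation (\<lambda>\<omega>. U_proj M d g X i (X 0 \<omega>)) = 0"
    using Bochner_Integration.integral_diff[OF section_integrable[OF gm int i] integrable_const[of "U_mean M d g X"]]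
    unfolding U_proj_def section_integral[OF gm int i] lebesgue_integral_const prob_space
    by (rule trans) (simp only: scaleR_one diff_self)
  then show "expectation (\<lambda>\<omega>. U_proj M d g X i (X n \<omega>)) = 0"
    using expectation_X[OF pm, of n] by simp
  let ?g2 = "\<lambda>x. (g x)\<^sup>2"
  have g2m: "?g2 \<in> borel_measurable (Pi\<^sub>M {1..d} (\<lambda>_. S))" by measurable
  have int2: "integrable M (\<lambda>\<omega>. ?g2 (\<lambda>k\<in>{1..d}. X k \<omega>))" using g by (simp add: kernel_def)
  let ?\<Phi> = "\<lambda>\<omega>. \<integral>\<omega>'. g (\<lambda>k\<in>{1..d}. if k = i then X 0 \<omega> else X k \<omega>') \<partial>M"
  have sec: "(\<lambda>\<omega>'. g (\<lambda>k\<in>{1..d}. if k = i then X 0 \<omega> else X k \<omega>')) \<in> borel_measurable M" if "\<omega> \<in> space M" for \<omega>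
    using measurable_compose[OF measurable_Pair1'[OF X_space[OF that, of 0]] section_measurable[OF gm, of i "\<lambda>k. k"]]
    by simp
  \<comment> \<open>The square of a section mean is at most the section mean of the square, which is
    integrable by Fubini for g^2.\<close>
  have "integrable M (\<lambda>\<omega>. (?\<Phi> \<omega>)\<^sup>2)"
  proof (rule Bochner_Integration.integrable_bound[OF section_integrable[OF g2m int2 i]])
    have "?\<Phi> \<in> borel_measurable M" using section_integrable[OF gm int i] by (rule borel_measurable_integrable)
    then show "(\<lambda>\<omega>. (?\<Phi> \<omega>)\<^sup>2) \<in> borel_measurable M" by measurable
    show "AE \<omega> in M. norm ((?\<Phi> \<omega>)\<^sup>2) \<le> norm (\<integral>\<omega>'. (g (\<lambda>k\<in>{1..d}. if k = i then X 0 \<omega> else X k \<omega>'))\<^sup>2 \<partial>M)"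
      using section_AE_integrable[OF g2m int2 i] AE_space
    proof eventually_elim
      case (elim \<omega>)
      show ?case
        unfolding real_norm_def abs_power2
        by (rule order_trans[OF square_expectation_le[OF sec[OF elim(2)] elim(1)] abs_ge_self])
    qed
  qed
  moreover have "?\<Phi> \<in> borel_measurable M" using section_integrable[OF gm int i] by (rule borel_measurable_integrable)
  ultimately have "integrable M (\<lambda>\<omega>. (?\<Phi> \<omega> + (- U_mean M d g X))\<^sup>2)"
    by (intro square_integrable_add) auto
  then have "integrable M (\<lambda>\<omega>. (U_proj M d g X i (X 0 \<omega>))\<^sup>2)"
    by (simp add: U_proj_def)
  then show "integrable M (\<lambda>\<omega>. (U_proj M d g X i (X n \<omega>))\<^sup>2)"
    using integrable_X[of "\<lambda>x. (U_proj M d g X i x)\<^sup>2" n] pm by simp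
qed

lemma U_proj_rv: "kernel d g \<Longrightarrow> random_variable borel (\<lambda>\<omega>. U_proj M d g X i (X n \<omega>))"
  using measurable_compose[OF X_measurable U_proj_measurable[OF kernel_measurable]] .

lemma U_proj_integrable:
  "kernel d g \<Longrightarrow> i \<in> {1..d} \<Longrightarrow> integrable M (\<lambda>\<omega>. U_proj M d g X i (X n \<omega>))"
  by (rule square_integrable_imp_integrable[OF U_proj_rv U_proj_square_integrable])

text \<open>If two tuples share at most the index at position \<open>a\<close> of the first, then the remaining
  variables of the first can be integrated out first, which produces the projection at \<open>a\<close>.\<close>

lemma kernel_orthogonal:
  assumes g: "kernel d g" and I: "inj_on I {1..d}" and J: "inj_on J {1..d}" and a: "a \<in> {1..d}"
    and disj: "I ` ({1..d} - {a}) \<inter> J ` {1..d} = {}"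
    and zero: "AE \<omega> in M. U_proj M d g X a (X 0 \<omega>) + U_mean M d g X = 0"
  shows "expectation (\<lambda>\<omega>. g (\<lambda>k\<in>{1..d}. X (I k) \<omega>) * g (\<lambda>k\<in>{1..d}. X (J k) \<omega>)) = 0"
proof -
  note gm[measurable] = kernel_measurable[OF g]
  \<comment> \<open>\<open>I a\<close> is placed in the same block as all indices of
    \<open>J\<close>, whether or not it is one of them. The other block carries exactly the
    variables to be integrated out first.\<close>
  let ?B = "I ` ({1..d} - {a})" and ?A = "insert (I a) (J ` {1..d})"
  have "I a \<notin> ?B" using inj_on_image_mem_iff[OF I a, of "{1..d} - {a}"] by blast
  then have AB: "?A \<inter> ?B = {}" using disj by blast
  define h where "h = (\<lambda>(z, y). g (\<lambda>k\<in>{1..d}. if k = a then z (I a) else y (I k)) * g (\<lambda>k\<in>{1..d}. z (J k)))"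
  let ?Z = "\<lambda>\<omega>. \<lambda>k\<in>?A. X k \<omega>" and ?Y = "\<lambda>\<omega>. \<lambda>k\<in>?B. X k \<omega>"
  let ?N = "Pi\<^sub>M ?A (\<lambda>_. S) \<Otimes>\<^sub>M Pi\<^sub>M ?B (\<lambda>_. S)"
  have "(\<lambda>p. \<lambda>k\<in>{1..d}. if k = a then fst p (I a) else snd p (I k)) \<in> measurable ?N (Pi\<^sub>M {1..d} (\<lambda>_. S))"
    by (intro measurable_restrict measurable_if_const measurable_fst_component measurable_snd_component) auto
  from measurable_compose[OF this gm]
  have m1: "(\<lambda>p. g (\<lambda>k\<in>{1..d}. if k = a then fst p (I a) else snd p (I k))) \<in> borel_measurable ?N" .
  have "(\<lambda>p. \<lambda>k\<in>{1..d}. fst p (J k)) \<in> measurable ?N (Pi\<^sub>M {1..d} (\<lambda>_. S))"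
    by (intro measurable_restrict measurable_fst_component insertI2 imageI)
  from measurable_compose[OF this gm]
  have m2: "(\<lambda>p. g (\<lambda>k\<in>{1..d}. fst p (J k))) \<in> borel_measurable ?N" .
  have h: "h \<in> borel_measurable ?N"
    using borel_measurable_times[OF m1 m2] by (simp add: h_def case_prod_beta)
  have r1: "(\<lambda>k\<in>{1..d}. if k = a then ?Z \<omega> (I a) else ?Y \<omega>' (I k))
      = (\<lambda>k\<in>{1..d}. if k = a then X (I a) \<omega> else X (I k) \<omega>')" for \<omega> \<omega>'
  proof (rule restrict_ext)
    fix k assume "k \<in> {1..d}"
    then have "k \<noteq> a \<Longrightarrow> I k \<in> ?B" by blast
    then show "(if k = a then ?Z \<omega> (I a) else ?Y \<omega>' (I k)) = (if k = a then X (I a) \<omega> else X (I k) \<omega>')"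
      by (cases "k = a") (simp_all only: restrict_apply insertI1 if_True if_False not_False_eq_True simp_thms)
  qed
  have r2: "(\<lambda>k\<in>{1..d}. ?Z \<omega> (J k)) = (\<lambda>k\<in>{1..d}. X (J k) \<omega>)" for \<omega>
    by (rule restrict_ext) (simp only: restrict_apply imageI insertI2 if_True)
  have r3: "(\<lambda>k\<in>{1..d}. if k = a then X (I a) \<omega> else X (I k) \<omega>) = (\<lambda>k\<in>{1..d}. X (I k) \<omega>)" for \<omega>
    by (rule restrict_ext) simp
  have hZY: "h (?Z \<omega>, ?Y \<omega>') = g (\<lambda>k\<in>{1..d}. if k = a then X (I a) \<omega> else X (I k) \<omega>') * g (\<lambda>k\<in>{1..d}. X (J k) \<omega>)" for \<omega> \<omega>'
    unfolding h_def prod.case r1 r2 ..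
  have int: "integrable M (\<lambda>\<omega>. h (?Z \<omega>, ?Y \<omega>))"
    unfolding hZY r3
    by (intro square_integrable_mult kernel_rv[OF g] kernel_square_integrable[OF g] I J)
  have "expectation (\<lambda>\<omega>. g (\<lambda>k\<in>{1..d}. X (I k) \<omega>) * g (\<lambda>k\<in>{1..d}. X (J k) \<omega>))
    = (\<integral>\<omega>. (\<integral>\<omega>'. g (\<lambda>k\<in>{1..d}. if k = a then X (I a) \<omega> else X (I k) \<omega>') * g (\<lambda>k\<in>{1..d}. X (J k) \<omega>) \<partial>M) \<partial>M)"
    using indep_var_integral_section[OF indep_var_split[OF AB] h int] unfolding hZY r3 by (rule sym)
  also have "\<dots> = (\<integral>\<omega>. (U_proj M d g X a (X (I a) \<omega>) + U_mean M d g X) * g (\<lambda>k\<in>{1..d}. X (J k) \<omega>) \<partial>M)"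
    by (intro Bochner_Integration.integral_cong refl)
       (simp add: section_reindex[OF gm a I X_space])
  also have "\<dots> = (\<integral>\<omega>. 0 \<partial>M)"
  proof (rule integral_cong_AE)
    have "{x \<in> space S. U_proj M d g X a x + U_mean M d g X = 0} \<in> sets S"
      using U_proj_measurable[OF gm, of a] by measurable
    from AE_X[OF this, of "I a"] zero
    have "AE \<omega> in M. U_proj M d g X a (X (I a) \<omega>) + U_mean M d g X = 0" by simp
    then show "AE \<omega> in M. (U_proj M d g X a (X (I a) \<omega>) + U_mean M d g X) * g (\<lambda>k\<in>{1..d}. X (J k) \<omega>) = 0"
      by eventually_elim simp
    show "(\<lambda>\<omega>. (U_proj M d g X a (X (I a) \<omega>) + U_mean M d g X) * g (\<lambda>k\<in>{1..d}. X (J k) \<omega>)) \<in> borel_measurable M"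
      using U_proj_rv[OF g, of a "I a"] kernel_rv[OF g, of J] by measurable
  qed simp
  finally show ?thesis by simp
qed

lemma kernel_orthogonal_disjoint:
  assumes g: "kernel d g" and I: "inj_on I {1..d}" and J: "inj_on J {1..d}"
    and disj: "I ` {1..d} \<inter> J ` {1..d} = {}" and zero: "U_mean M d g X = 0"
  shows "expectation (\<lambda>\<omega>. g (\<lambda>k\<in>{1..d}. X (I k) \<omega>) * g (\<lambda>k\<in>{1..d}. X (J k) \<omega>)) = 0"
proof -
  let ?Z = "\<lambda>K \<omega>. \<lambda>k\<in>K ` {1..d}. X k \<omega>" and ?F = "\<lambda>K x. g (\<lambda>k\<in>{1..d}. x (K k))"
  have m: "?F K \<in> borel_measurable (Pi\<^sub>M (K ` {1..d}) (\<lambda>_. S))" for K :: "nat \<Rightarrow> nat"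
    by (rule measurable_compose[OF _ kernel_measurable[OF g]])
       (intro measurable_restrict measurable_component_singleton, auto)
  have eq: "?F K \<circ> ?Z K = (\<lambda>\<omega>. g (\<lambda>k\<in>{1..d}. X (K k) \<omega>))" for K :: "nat \<Rightarrow> nat"
    by (rule ext) (auto intro!: arg_cong[where f=g] restrict_ext)
  have "indep_var borel (?F I \<circ> ?Z I) borel (?F J \<circ> ?Z J)"
    by (rule indep_var_compose[OF indep_var_split[OF disj] m m])
  then have "indep_var borel (\<lambda>\<omega>. g (\<lambda>k\<in>{1..d}. X (I k) \<omega>)) borel (\<lambda>\<omega>. g (\<lambda>k\<in>{1..d}. X (J k) \<omega>))"
    unfolding eq .
  from indep_var_lebesgue_integral[OF this kernel_integrable[OF g I] kernel_integrable[OF g J]]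
  show ?thesis using kernel_expectation[OF g I] zero by simp
qed

end

section \<open>Asymptotic normality at a deterministic index\<close>

lemma integral_double_sum:
  fixes F :: "'i \<Rightarrow> 'j \<Rightarrow> 'a \<Rightarrow> real"
  assumes "\<And>i j. i \<in> A \<Longrightarrow> j \<in> B \<Longrightarrow> integrable M (F i j)"
  shows "(\<integral>\<omega>. (\<Sum>i\<in>A. \<Sum>j\<in>B. c i j * F i j \<omega>) \<partial>M) = (\<Sum>i\<in>A. \<Sum>j\<in>B. c i j * (\<integral>\<omega>. F i j \<omega> \<partial>M))"
  using assms by (simp add: Bochner_Integration.integral_sum Bochner_Integration.integrable_sum)

context iid_sequence begin

definition U_centred :: "nat \<Rightarrow> ((nat \<Rightarrow> 's) \<Rightarrow> real) \<Rightarrow> nat \<Rightarrow> 'a \<Rightarrow> real" where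
  "U_centred d g n \<omega> = U_stat d g X n \<omega> - real (n choose d) * U_mean M d g X"

lemma U_centred_eq:
  "U_centred d g n \<omega> = (\<Sum>I\<in>increasing_tuples d n. g (\<lambda>k\<in>{1..d}. X (I k) \<omega>) - U_mean M d g X)"
  by (simp add: U_centred_def U_stat_def sum_subtractf card_increasing_tuples)

lemma U_stat_rv: "kernel d g \<Longrightarrow> random_variable borel (U_stat d g X n)"
  unfolding U_stat_def[abs_def] by (intro borel_measurable_sum kernel_rv)

lemma U_centred_rv: "kernel d g \<Longrightarrow> random_variable borel (U_centred d g n)"
  unfolding U_centred_def[abs_def]
  by (intro borel_measurable_diff U_stat_rv borel_measurable_const)

lemma kernel_centred: "kernel d g \<Longrightarrow> kernel d (\<lambda>x. g x - c)"
  by (rule kernel_diff[OF _ kernel_const])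

lemma U_mean_add:
  assumes "kernel d g" "kernel d h"
  shows "U_mean M d (\<lambda>x. g x + h x) X = U_mean M d g X + U_mean M d h X"
  using kernel_integrable[OF assms(1), of "\<lambda>k. k"] kernel_integrable[OF assms(2), of "\<lambda>k. k"]
  unfolding U_mean_def by (intro Bochner_Integration.integral_add) auto

lemma U_mean_cmult: "U_mean M d (\<lambda>x. c * g x) X = c * U_mean M d g X"
  unfolding U_mean_def by simp

lemma U_mean_const: "U_mean M d (\<lambda>x. c) X = c"
  unfolding U_mean_def lebesgue_integral_const prob_space by simp

lemma U_mean_diff:
  assumes "kernel d g" "kernel d h"
  shows "U_mean M d (\<lambda>x. g x - h x) X = U_mean M d g X - U_mean M d h X"
  using U_mean_add[OF assms(1) kernel_cmult[OF assms(2), of "-1"]] U_mean_cmult[of d "-1" h] by simp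

lemma U_mean_sum:
  assumes "finite A" "\<And>l. l \<in> A \<Longrightarrow> kernel d (G l)"
  shows "U_mean M d (\<lambda>x. \<Sum>l\<in>A. G l x) X = (\<Sum>l\<in>A. U_mean M d (G l) X)"
  using kernel_integrable[OF assms(2), of _ "\<lambda>k. k"] unfolding U_mean_def
  by (intro Bochner_Integration.integral_sum) auto

lemma U_mean_component:
  assumes "l \<in> {1..d}" "F \<in> borel_measurable S"
  shows "U_mean M d (\<lambda>x. F (x l)) X = expectation (\<lambda>\<omega>. F (X 0 \<omega>))"
  using assms expectation_X[OF assms(2), of l] by (simp add: U_mean_def)

text \<open>The increment is a sum over the new tuples. Pairs without a common index are
  uncorrelated, and counting the other pairs gives a bound linear in \<open>n - m\<close>.\<close>

lemma increment_second_moment: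
  assumes g: "kernel d g" and d: "1 \<le> d" and mn: "m \<le> n"
  shows "expectation (\<lambda>\<omega>. (U_centred d g n \<omega> - U_centred d g m \<omega>)\<^sup>2)
    \<le> real (d\<^sup>2 * ((n - m) * n ^ (2 * d - 2))) * expectation (\<lambda>\<omega>. (g (\<lambda>k\<in>{1..d}. X k \<omega>) - U_mean M d g X)\<^sup>2)"
proof -
  let ?T = "increasing_tuples d n - increasing_tuples d m"
  let ?g = "\<lambda>x. g x - U_mean M d g X"
  let ?B = "{(I, J) \<in> ?T \<times> ?T. I ` {1..d} \<inter> J ` {1..d} \<noteq> {}}"
  have gk: "kernel d ?g" by (rule kernel_centred[OF g])
  have mean0: "U_mean M d ?g X = 0"
    using U_mean_diff[OF g kernel_const] by (simp add: U_mean_const)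
  have "U_centred d g n \<omega> - U_centred d g m \<omega> = (\<Sum>I\<in>?T. ?g (\<lambda>k\<in>{1..d}. X (I k) \<omega>))" for \<omega>
    unfolding U_centred_eq using increasing_tuples_mono[OF mn, of d]
    by (subst sum_diff) (auto simp: increasing_tuples_finite)
  then have "expectation (\<lambda>\<omega>. (U_centred d g n \<omega> - U_centred d g m \<omega>)\<^sup>2)
     = expectation (\<lambda>\<omega>. (\<Sum>I\<in>?T. ?g (\<lambda>k\<in>{1..d}. X (I k) \<omega>))\<^sup>2)" by simp
  also have "\<dots> \<le> real (card ?B) * expectation (\<lambda>\<omega>. (?g (\<lambda>k\<in>{1..d}. X k \<omega>))\<^sup>2)"
  proof (rule second_moment_sum_kernel[OF gk])
    show "finite ?T" by (simp add: increasing_tuples_finite)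
    show inj: "inj_on I {1..d}" if "I \<in> ?T" for I
      using that by (intro increasing_tuples_inj[of I d n]) auto
    show "expectation (\<lambda>\<omega>. ?g (\<lambda>k\<in>{1..d}. X (I k) \<omega>) * ?g (\<lambda>k\<in>{1..d}. X (J k) \<omega>)) = 0"
      if "I \<in> ?T" "J \<in> ?T" "(I, J) \<notin> ?B" for I J
    proof (rule kernel_orthogonal_disjoint[OF gk _ _ _ mean0])
      show "inj_on I {1..d}" "inj_on J {1..d}" using inj that by blast+
      show "I ` {1..d} \<inter> J ` {1..d} = {}" using that by blast
    qed
  qed auto
  also have "\<dots> \<le> real (d\<^sup>2 * ((n - m) * n ^ (2 * d - 2))) * expectation (\<lambda>\<omega>. (?g (\<lambda>k\<in>{1..d}. X k \<omega>))\<^sup>2)"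
  proof (intro mult_right_mono)
    have "card ?B \<le> d\<^sup>2 * (card ?T * n ^ (d - 1))" by (rule card_meeting_pairs[of _ d n]) auto
    also have "\<dots> \<le> d\<^sup>2 * (((n - m) * n ^ (d - 1)) * n ^ (d - 1))"
      by (intro mult_left_mono mult_right_mono card_increasing_tuples_diff d mn) auto
    also have "n ^ (2 * d - 2) = n ^ (d - 1) * n ^ (d - 1)"
      using d by (simp add: power_add[symmetric] mult_2 numeral_2_eq_2)
    then have "d\<^sup>2 * (((n - m) * n ^ (d - 1)) * n ^ (d - 1)) = d\<^sup>2 * ((n - m) * n ^ (2 * d - 2))"
      by (simp add: mult.assoc)
    finally show "real (card ?B) \<le> real (d\<^sup>2 * ((n - m) * n ^ (2 * d - 2)))" by (rule of_nat_mono)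
  qed simp
  finally show ?thesis .
qed

lemma U_centred_square_integrable:
  assumes "kernel d g"
  shows "integrable M (\<lambda>\<omega>. (U_centred d g n \<omega> - U_centred d g m \<omega>)\<^sup>2)"
proof -
  have sq: "integrable M (\<lambda>\<omega>. (U_centred d g n \<omega>)\<^sup>2)" for n
    unfolding U_centred_eq
    using kernel_rv[OF kernel_centred[OF assms]] kernel_square_integrable[OF kernel_centred[OF assms] increasing_tuples_inj]
    by (intro square_integrable_sum increasing_tuples_finite) auto
  have "integrable M (\<lambda>\<omega>. (U_centred d g n \<omega> + (- U_centred d g m \<omega>))\<^sup>2)"
    using sq U_centred_rv[OF assms] by (intro square_integrable_add) auto
  then show ?thesis by simp
qed

text \<open>The remainder of the Hoeffding decomposition after its constant and linear terms; its
  own first projections vanish.\<close>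

definition degenerate_part :: "nat \<Rightarrow> ((nat \<Rightarrow> 's) \<Rightarrow> real) \<Rightarrow> (nat \<Rightarrow> 's) \<Rightarrow> real" where
  "degenerate_part d g x = g x - U_mean M d g X - (\<Sum>l=1..d. U_proj M d g X l (x l))"

lemma kernel_U_proj: "kernel d g \<Longrightarrow> l \<in> {1..d} \<Longrightarrow> kernel d (\<lambda>x. U_proj M d g X l (x l))"
  by (intro kernel_component U_proj_measurable kernel_measurable U_proj_square_integrable)

lemma kernel_degenerate_part: "kernel d g \<Longrightarrow> kernel d (degenerate_part d g)"
  unfolding degenerate_part_def[abs_def]
  by (intro kernel_diff kernel_centred kernel_sum kernel_U_proj) auto

lemma degenerate_part_mean:
  assumes g: "kernel d g"
  shows "U_mean M d (degenerate_part d g) X = 0"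
proof -
  have "U_mean M d (degenerate_part d g) X
    = U_mean M d g X - U_mean M d g X - (\<Sum>l=1..d. U_mean M d (\<lambda>x. U_proj M d g X l (x l)) X)"
    unfolding degenerate_part_def[abs_def]
    by (subst U_mean_diff, intro kernel_centred g, intro kernel_sum kernel_U_proj g, auto)
       (auto simp: U_mean_diff[OF g kernel_const] U_mean_const intro!: U_mean_sum kernel_U_proj g)
  also have "(\<Sum>l=1..d. U_mean M d (\<lambda>x. U_proj M d g X l (x l)) X) = 0"
    using U_mean_component U_proj_measurable[OF kernel_measurable[OF g]] expectation_U_proj[OF g]
    by (intro sum.neutral) auto
  finally show ?thesis by simp
qed

text \<open>The sum of projection and mean is the raw section mean, the quantity that appears in
  \<open>kernel_orthogonal\<close>. The claim is almost sure because the sections of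
  \<open>g\<close> are only almost surely integrable.\<close>

lemma degenerate_part_proj:
  assumes g: "kernel d g" and a: "a \<in> {1..d}"
  shows "AE \<omega> in M. U_proj M d (degenerate_part d g) X a (X 0 \<omega>) + U_mean M d (degenerate_part d g) X = 0"
  using U_proj_AE_integrable[OF g a] AE_space
proof eventually_elim
  case (elim \<omega>)
  let ?y = "\<lambda>\<omega>'. \<lambda>k\<in>{1..d}. if k = a then X 0 \<omega> else X k \<omega>'"
  let ?p = "\<lambda>l. U_proj M d g X l" and ?m = "U_mean M d g X"
  have pint: "integrable M (\<lambda>\<omega>'. ?p l (?y \<omega>' l))"
    and pexp: "expectation (\<lambda>\<omega>'. ?p l (?y \<omega>' l)) = (if l = a then ?p a (X 0 \<omega>) else 0)"
    if l: "l \<in> {1..d}" for l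
  proof -
    have "(\<lambda>\<omega>'. ?p l (?y \<omega>' l)) = (if l = a then (\<lambda>_. ?p a (X 0 \<omega>)) else (\<lambda>\<omega>'. ?p l (X l \<omega>')))"
      using l by auto
    then show "integrable M (\<lambda>\<omega>'. ?p l (?y \<omega>' l))"
      "expectation (\<lambda>\<omega>'. ?p l (?y \<omega>' l)) = (if l = a then ?p a (X 0 \<omega>) else 0)"
      using U_proj_integrable[OF g l, of l] expectation_U_proj[OF g l, of l]
      by (auto simp: prob_space)
  qed
  have "expectation (\<lambda>\<omega>'. degenerate_part d g (?y \<omega>'))
     = expectation (\<lambda>\<omega>'. g (?y \<omega>') - ?m) - expectation (\<lambda>\<omega>'. \<Sum>l=1..d. ?p l (?y \<omega>' l))"
    unfolding degenerate_part_def
    by (intro Bochner_Integration.integral_diff Bochner_Integration.integrable_diff elim(1)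
        integrable_const Bochner_Integration.integrable_sum pint)
  also have "expectation (\<lambda>\<omega>'. g (?y \<omega>') - ?m) = expectation (\<lambda>\<omega>'. g (?y \<omega>')) - ?m"
    using Bochner_Integration.integral_diff[OF elim(1) integrable_const[of ?m]]
    unfolding lebesgue_integral_const prob_space scaleR_one .
  also have "\<dots> = ?p a (X 0 \<omega>)"
    unfolding U_proj_def ..
  also have "expectation (\<lambda>\<omega>'. \<Sum>l=1..d. ?p l (?y \<omega>' l)) = (\<Sum>l=1..d. if l = a then ?p a (X 0 \<omega>) else 0)"
  proof (rule trans)
    show "expectation (\<lambda>\<omega>'. \<Sum>l=1..d. ?p l (?y \<omega>' l)) = (\<Sum>l=1..d. expectation (\<lambda>\<omega>'. ?p l (?y \<omega>' l)))"
      by (rule Bochner_Integration.integral_sum) (rule pint)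
    show "(\<Sum>l=1..d. expectation (\<lambda>\<omega>'. ?p l (?y \<omega>' l))) = (\<Sum>l=1..d. if l = a then ?p a (X 0 \<omega>) else 0)"
      by (rule sum.cong[OF refl pexp])
  qed
  also have "\<dots> = ?p a (X 0 \<omega>)" using a by simp
  finally show ?case unfolding U_proj_def[of _ _ "degenerate_part d g"] diff_add_cancel
    by (rule trans) (rule diff_self)
qed

text \<open>The linear terms of all tuples, grouped by observation: summands for different
  \<open>m\<close> are independent, though not identically distributed.\<close>

definition hajek_part :: "nat \<Rightarrow> ((nat \<Rightarrow> 's) \<Rightarrow> real) \<Rightarrow> nat \<Rightarrow> 'a \<Rightarrow> real" where
  "hajek_part d g n \<omega> = (\<Sum>m=1..n. \<Sum>l=1..d.
     real (((m - 1) choose (l - 1)) * ((n - m) choose (d - l))) * U_proj M d g X l (X m \<omega>))"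

lemma hajek_part_rv: "kernel d g \<Longrightarrow> random_variable borel (hajek_part d g n)"
  unfolding hajek_part_def[abs_def]
  by (intro borel_measurable_sum borel_measurable_times borel_measurable_const U_proj_rv)

lemma U_centred_minus_hajek_part:
  "U_centred d g n \<omega> - hajek_part d g n \<omega>
    = (\<Sum>I\<in>increasing_tuples d n. degenerate_part d g (\<lambda>k\<in>{1..d}. X (I k) \<omega>))"
proof -
  have "hajek_part d g n \<omega> = (\<Sum>I\<in>increasing_tuples d n. \<Sum>l=1..d. U_proj M d g X l (X (I l) \<omega>))"
    unfolding hajek_part_def by (rule sum_over_positions[symmetric])
  moreover have "degenerate_part d g (\<lambda>k\<in>{1..d}. X (I k) \<omega>)
    = (g (\<lambda>k\<in>{1..d}. X (I k) \<omega>) - U_mean M d g X) - (\<Sum>l=1..d. U_proj M d g X l (X (I l) \<omega>))" for I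
    unfolding degenerate_part_def by simp
  ultimately show ?thesis unfolding U_centred_eq by (simp add: sum_subtractf)
qed

lemma residual_square_integrable:
  assumes "kernel d g"
  shows "integrable M (\<lambda>\<omega>. (U_centred d g n \<omega> - hajek_part d g n \<omega>)\<^sup>2)"
  unfolding U_centred_minus_hajek_part
  using kernel_rv[OF kernel_degenerate_part[OF assms]]
    kernel_square_integrable[OF kernel_degenerate_part[OF assms] increasing_tuples_inj]
  by (intro square_integrable_sum increasing_tuples_finite) auto

text \<open>Pairs with exactly one common index are now uncorrelated too, since integrating out the
  other variables of one tuple leaves a vanishing section mean. Only pairs that meet twice
  remain.\<close>

lemma residual_second_moment:
  assumes g: "kernel d g"
  shows "expectation (\<lambda>\<omega>. (U_centred d g n \<omega> - hajek_part d g n \<omega>)\<^sup>2)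
    \<le> real (d ^ 4 * n ^ (2 * d - 2)) * expectation (\<lambda>\<omega>. (degenerate_part d g (\<lambda>k\<in>{1..d}. X k \<omega>))\<^sup>2)"
proof -
  let ?T = "increasing_tuples d n" and ?g = "degenerate_part d g"
  let ?B = "{(I, J) \<in> ?T \<times> ?T. card (I ` {1..d} \<inter> J ` {1..d}) \<ge> 2}"
  note gk = kernel_degenerate_part[OF g]
  have "expectation (\<lambda>\<omega>. (U_centred d g n \<omega> - hajek_part d g n \<omega>)\<^sup>2)
    = expectation (\<lambda>\<omega>. (\<Sum>I\<in>?T. ?g (\<lambda>k\<in>{1..d}. X (I k) \<omega>))\<^sup>2)"
    unfolding U_centred_minus_hajek_part ..
  also have "\<dots> \<le> real (card ?B) * expectation (\<lambda>\<omega>. (?g (\<lambda>k\<in>{1..d}. X k \<omega>))\<^sup>2)"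
  proof (rule second_moment_sum_kernel[OF gk increasing_tuples_finite increasing_tuples_inj])
    fix I J assume IJ: "I \<in> ?T" "J \<in> ?T" "(I, J) \<notin> ?B"
    note inj = increasing_tuples_inj[OF IJ(1)] increasing_tuples_inj[OF IJ(2)]
    show "expectation (\<lambda>\<omega>. ?g (\<lambda>k\<in>{1..d}. X (I k) \<omega>) * ?g (\<lambda>k\<in>{1..d}. X (J k) \<omega>)) = 0"
    proof (cases "I ` {1..d} \<inter> J ` {1..d} = {}")
      case True
      show ?thesis
        by (rule kernel_orthogonal_disjoint[OF gk inj True degenerate_part_mean[OF g]])
    next
      case False
      then obtain a where a: "a \<in> {1..d}" "I a \<in> J ` {1..d}" by blast
      have "card (I ` {1..d} \<inter> J ` {1..d}) \<le> Suc 0" using IJ by auto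
      then have single: "u = v" if "u \<in> I ` {1..d} \<inter> J ` {1..d}" "v \<in> I ` {1..d} \<inter> J ` {1..d}" for u v
        using that card_le_Suc0_iff_eq[of "I ` {1..d} \<inter> J ` {1..d}"] by blast
      have "I ` ({1..d} - {a}) \<inter> J ` {1..d} = {}"
      proof (rule ccontr)
        assume "I ` ({1..d} - {a}) \<inter> J ` {1..d} \<noteq> {}"
        then obtain b where b: "b \<in> {1..d}" "b \<noteq> a" "I b \<in> J ` {1..d}" by blast
        then have "I b = I a" using single[of "I b" "I a"] a by blast
        then show False using inj_onD[OF inj(1) _ b(1) a(1)] b(2) by blast
      qed
      then show ?thesis
        by (rule kernel_orthogonal[OF gk inj a(1) _ degenerate_part_proj[OF g a(1)]])
    qed
  qed auto
  also have "\<dots> \<le> real (d ^ 4 * n ^ (2 * d - 2)) * expectation (\<lambda>\<omega>. (?g (\<lambda>k\<in>{1..d}. X k \<omega>))\<^sup>2)"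
    by (intro mult_right_mono of_nat_mono card_twice_meeting_pairs) simp
  finally show ?thesis .
qed

lemma chebyshev:
  assumes "random_variable borel Y" "integrable M (\<lambda>\<omega>. (Y \<omega>)\<^sup>2)" "0 < \<epsilon>"
    and "expectation (\<lambda>\<omega>. (Y \<omega>)\<^sup>2) \<le> B"
  shows "prob {\<omega> \<in> space M. \<epsilon> \<le> \<bar>Y \<omega>\<bar>} \<le> B / \<epsilon>\<^sup>2"
  using second_moment_method[OF assms(1,2,3)] divide_right_mono[OF assms(4), of "\<epsilon>\<^sup>2"] by simp

text \<open>The Hajek part is a triangular array of independent variables and the remainder is
  negligible by Chebyshev's inequality. The factor \<open>c\<close> is carried along for the later
  change of scale from x to x / mu.\<close>

theorem U_statistic_clt:
  assumes g: "kernel d g" and d: "1 \<le> d"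
  shows "weak_conv_m (\<lambda>n. distr M borel (\<lambda>\<omega>. c * U_centred d g n \<omega> / (real n ^ (d - 1) * sqrt (real n))))
    (normal_law 0 (c\<^sup>2 * expectation (\<lambda>\<omega>. bern_form d (\<lambda>l. U_proj M d g X l (X 0 \<omega>)))))"
proof -
  let ?p = "\<lambda>l m \<omega>. U_proj M d g X l (X m \<omega>)"
  define Y where "Y n m \<omega> = c * (\<Sum>l=1..d. pos_weight d l n m * ?p l m \<omega>)" for n m \<omega>
  \<comment> \<open>The weights lie in [0,1], so this dominates \<open>Y n m\<close> for every
    \<open>n\<close>.\<close>
  define H where "H m \<omega> = \<bar>c\<bar> * (\<Sum>l=1..d. \<bar>?p l m \<omega>\<bar>)" for m \<omega>
  define v where "v = c\<^sup>2 * expectation (\<lambda>\<omega>. bern_form d (\<lambda>l. ?p l 0 \<omega>))"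
  note pm = U_proj_measurable[OF kernel_measurable[OF g]]
  have pint: "integrable M (\<lambda>\<omega>. ?p i m \<omega> * ?p j m \<omega>)" if "i \<in> {1..d}" "j \<in> {1..d}" for i j m
    by (intro square_integrable_mult U_proj_rv[OF g] U_proj_square_integrable[OF g] that)
  have pexp: "expectation (\<lambda>\<omega>. ?p i m \<omega> * ?p j m \<omega>) = expectation (\<lambda>\<omega>. ?p i 0 \<omega> * ?p j 0 \<omega>)" for i j m
    by (rule expectation_X[OF borel_measurable_times[OF pm pm]])
  have Z: "c * hajek_part d g n \<omega> / (real n ^ (d - 1) * sqrt (real n)) = (\<Sum>k=1..n. Y n k \<omega>) / sqrt (real n)" for n \<omega>
    by (simp add: hajek_part_def Y_def pos_weight_def sum_distrib_left sum_divide_distrib mult_ac)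
  have v_eq: "v = (\<Sum>i=1..d. \<Sum>j=1..d. c\<^sup>2 * (bern_gram d i j * expectation (\<lambda>\<omega>. ?p i 0 \<omega> * ?p j 0 \<omega>)))"
    unfolding v_def bern_form_def
    by (subst integral_double_sum[OF pint]) (simp_all add: sum_distrib_left)
  have clt: "weak_conv_m (\<lambda>n. distr M borel (\<lambda>\<omega>. (\<Sum>k=1..n. Y n k \<omega>) / sqrt (real n))) (normal_law 0 v)"
  proof (rule triangular_array_clt)
    show "indep_vars (\<lambda>_. borel) (Y n) {1..n}" for n
      unfolding Y_def[abs_def]
      by (rule indep_vars_compose2[OF indep_vars_subset[OF indep]])
         (auto intro!: borel_measurable_sum borel_measurable_times pm)
    show "expectation (Y n k) = 0" for n k
      unfolding Y_def[abs_def]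
      using expectation_U_proj[OF g] U_proj_integrable[OF g] by (simp add: Bochner_Integration.integral_sum)
    have Hm: "(\<lambda>x. \<bar>c\<bar> * (\<Sum>l=1..d. \<bar>U_proj M d g X l x\<bar>)) \<in> borel_measurable S"
      using pm by measurable
    show "random_variable borel (H k)" for k
      unfolding H_def[abs_def] using measurable_compose[OF X_measurable Hm] .
    have "distr M borel (H k) = distr (distr M S (X k)) borel (\<lambda>x. \<bar>c\<bar> * (\<Sum>l=1..d. \<bar>U_proj M d g X l x\<bar>))" for k
      by (subst distr_distr[OF Hm X_measurable]) (simp add: H_def[abs_def] comp_def)
    then show "distr M borel (H k) = distr M borel (H 0)" for k
      by (simp only: ident[of k])
    have "integrable M (\<lambda>\<omega>. (\<Sum>l=1..d. \<bar>?p l 0 \<omega>\<bar>)\<^sup>2)"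
      using U_proj_rv[OF g] U_proj_square_integrable[OF g] by (intro square_integrable_sum) auto
    then show "integrable M (\<lambda>\<omega>. (H 0 \<omega>)\<^sup>2)"
      unfolding H_def by (simp add: power_mult_distrib)
    show "\<bar>Y n k \<omega>\<bar> \<le> H k \<omega>" if "k \<in> {1..n}" for n k \<omega>
    proof -
      have "\<bar>\<Sum>l=1..d. pos_weight d l n k * ?p l k \<omega>\<bar> \<le> (\<Sum>l=1..d. \<bar>?p l k \<omega>\<bar>)"
      proof (rule order_trans[OF sum_abs sum_mono])
        fix l assume "l \<in> {1..d}"
        from pos_weight_bounds[OF this that] show "\<bar>pos_weight d l n k * ?p l k \<omega>\<bar> \<le> \<bar>?p l k \<omega>\<bar>"
          by (simp add: abs_mult mult_left_le_one_le)
      qed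
      then show ?thesis unfolding Y_def H_def by (simp add: abs_mult mult_left_mono)
    qed
    have "expectation (\<lambda>\<omega>. (Y n k \<omega>)\<^sup>2) = (\<Sum>i=1..d. \<Sum>j=1..d. c\<^sup>2 * expectation (\<lambda>\<omega>. ?p i 0 \<omega> * ?p j 0 \<omega>)
        * (pos_weight d i n k * pos_weight d j n k))" for n k
    proof -
      have "expectation (\<lambda>\<omega>. (Y n k \<omega>)\<^sup>2) = expectation (\<lambda>\<omega>. \<Sum>i=1..d. \<Sum>j=1..d.
          (c\<^sup>2 * (pos_weight d i n k * pos_weight d j n k)) * (?p i k \<omega> * ?p j k \<omega>))"
        unfolding Y_def power_mult_distrib power2_eq_square sum_product
        by (intro Bochner_Integration.integral_cong refl) (simp add: sum_distrib_left mult_ac)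
      also have "\<dots> = (\<Sum>i=1..d. \<Sum>j=1..d.
          (c\<^sup>2 * (pos_weight d i n k * pos_weight d j n k)) * expectation (\<lambda>\<omega>. ?p i k \<omega> * ?p j k \<omega>))"
        by (rule integral_double_sum[OF pint])
      finally show ?thesis unfolding pexp[of _ k] by (simp add: mult_ac)
    qed
    then have "(\<Sum>k=1..n. expectation (\<lambda>\<omega>. (Y n k \<omega>)\<^sup>2)) / real n
       = (\<Sum>i=1..d. \<Sum>j=1..d. c\<^sup>2 * expectation (\<lambda>\<omega>. ?p i 0 \<omega> * ?p j 0 \<omega>)
          * ((\<Sum>k=1..n. pos_weight d i n k * pos_weight d j n k) / real n))" for n
      by (simp add: sum.swap[of _ "{1..n}"] sum_distrib_left sum_divide_distrib)
    moreover have "(\<lambda>n. \<Sum>i=1..d. \<Sum>j=1..d. c\<^sup>2 * expectation (\<lambda>\<omega>. ?p i 0 \<omega> * ?p j 0 \<omega>)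
          * ((\<Sum>k=1..n. pos_weight d i n k * pos_weight d j n k) / real n))
       \<longlonglongrightarrow> (\<Sum>i=1..d. \<Sum>j=1..d. c\<^sup>2 * expectation (\<lambda>\<omega>. ?p i 0 \<omega> * ?p j 0 \<omega>) * bern_gram d i j)"
      by (intro tendsto_sum tendsto_mult_left average_pos_weight_mult)
    ultimately show "(\<lambda>n. (\<Sum>k=1..n. expectation (\<lambda>\<omega>. (Y n k \<omega>)\<^sup>2)) / real n) \<longlonglongrightarrow> v"
      unfolding v_eq by (simp add: mult_ac)
  qed
  have v0: "0 \<le> v"
    unfolding v_def by (intro mult_nonneg_nonneg Bochner_Integration.integral_nonneg bern_form_nonneg) auto
  show ?thesis
    unfolding weak_conv_along_sequentially[symmetric] v_def[symmetric]
  proof (rule weak_conv_along_perturb)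
    show "weak_conv_along (\<lambda>n. distr M borel (\<lambda>\<omega>. c * hajek_part d g n \<omega> / (real n ^ (d - 1) * sqrt (real n))))
      (normal_law 0 v) sequentially"
      unfolding Z weak_conv_along_sequentially by (rule clt)
    show "real_distribution (normal_law 0 v)" by (rule real_distribution_normal_law[OF v0])
    show "random_variable borel (\<lambda>\<omega>. c * hajek_part d g n \<omega> / (real n ^ (d - 1) * sqrt (real n)))"
      "random_variable borel (\<lambda>\<omega>. c * U_centred d g n \<omega> / (real n ^ (d - 1) * sqrt (real n)))" for n
      using hajek_part_rv[OF g] U_centred_rv[OF g] by measurable
    fix \<epsilon> :: real assume \<epsilon>: "0 < \<epsilon>"
    define E where "E = expectation (\<lambda>\<omega>. (degenerate_part d g (\<lambda>k\<in>{1..d}. X k \<omega>))\<^sup>2)"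
    have bound: "prob {\<omega> \<in> space M. \<epsilon> < \<bar>c * U_centred d g n \<omega> / (real n ^ (d - 1) * sqrt (real n))
        - c * hajek_part d g n \<omega> / (real n ^ (d - 1) * sqrt (real n))\<bar>}
        \<le> c\<^sup>2 * (real d ^ 4 * E) / \<epsilon>\<^sup>2 / real n" if n: "0 < n" for n
    proof -
      define b where "b = c / (real n ^ (d - 1) * sqrt (real n))"
      have R: "random_variable borel (\<lambda>\<omega>. b * (U_centred d g n \<omega> - hajek_part d g n \<omega>))"
        using hajek_part_rv[OF g] U_centred_rv[OF g] by measurable
      have eq: "c * U_centred d g n \<omega> / (real n ^ (d - 1) * sqrt (real n))
        - c * hajek_part d g n \<omega> / (real n ^ (d - 1) * sqrt (real n))
        = b * (U_centred d g n \<omega> - hajek_part d g n \<omega>)" for \<omega>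
        by (simp add: b_def right_diff_distrib)
      have b2: "b\<^sup>2 * real n ^ (2 * d - 2) = c\<^sup>2 / real n"
      proof -
        have "(real n ^ (d - 1))\<^sup>2 = real n ^ (2 * d - 2)"
          using d by (simp add: power_mult[symmetric] diff_mult_distrib mult.commute)
        then show ?thesis using n by (simp add: b_def power_divide power_mult_distrib)
      qed
      have "prob {\<omega> \<in> space M. \<epsilon> < \<bar>b * (U_centred d g n \<omega> - hajek_part d g n \<omega>)\<bar>}
          \<le> prob {\<omega> \<in> space M. \<epsilon> \<le> \<bar>b * (U_centred d g n \<omega> - hajek_part d g n \<omega>)\<bar>}"
        using R by (intro finite_measure_mono) auto
      also have "\<dots> \<le> (b\<^sup>2 * (real (d ^ 4 * n ^ (2 * d - 2)) * E)) / \<epsilon>\<^sup>2"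
      proof (rule chebyshev[OF R _ \<epsilon>])
        show "integrable M (\<lambda>\<omega>. (b * (U_centred d g n \<omega> - hajek_part d g n \<omega>))\<^sup>2)"
          using residual_square_integrable[OF g] by (simp add: power_mult_distrib)
        show "expectation (\<lambda>\<omega>. (b * (U_centred d g n \<omega> - hajek_part d g n \<omega>))\<^sup>2)
           \<le> b\<^sup>2 * (real (d ^ 4 * n ^ (2 * d - 2)) * E)"
          using mult_left_mono[OF residual_second_moment[OF g, of n], of "b\<^sup>2"]
          by (simp add: power_mult_distrib E_def)
      qed
      also have "b\<^sup>2 * (real (d ^ 4 * n ^ (2 * d - 2)) * E) = c\<^sup>2 / real n * (real d ^ 4 * E)"
        unfolding b2[symmetric] by (simp add: mult_ac)
      finally show ?thesis unfolding eq by (simp add: mult_ac)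
    qed
    show "(\<lambda>n. prob {\<omega> \<in> space M. \<epsilon> < \<bar>c * U_centred d g n \<omega> / (real n ^ (d - 1) * sqrt (real n))
        - c * hajek_part d g n \<omega> / (real n ^ (d - 1) * sqrt (real n))\<bar>}) \<longlonglongrightarrow> 0"
    proof (rule tendsto_sandwich[OF _ _ tendsto_const lim_const_over_n])
      show "\<forall>\<^sub>F n in sequentially. prob {\<omega> \<in> space M. \<epsilon> < \<bar>c * U_centred d g n \<omega> / (real n ^ (d - 1) * sqrt (real n))
        - c * hajek_part d g n \<omega> / (real n ^ (d - 1) * sqrt (real n))\<bar>}
        \<le> c\<^sup>2 * (real d ^ 4 * E) / \<epsilon>\<^sup>2 / real n"
        using eventually_gt_at_top[of 0] by eventually_elim (rule bound)
    qed auto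
  qed
qed

end

section \<open>A maximal inequality and the crossing times\<close>

text \<open>The Hajek--Renyi inequality. The induction controls the probability that the bound has
  failed before time \<open>n\<close> together with the second moment of \<open>c n * S n\<close> on the event that
  it has not.\<close>

lemma (in prob_space) hajek_renyi:
  fixes Y :: "nat \<Rightarrow> 'a \<Rightarrow> real" and c :: "nat \<Rightarrow> real"
  assumes indep: "indep_vars (\<lambda>_. borel) Y UNIV"
    and mean: "\<And>n. expectation (Y n) = 0"
    and sq: "\<And>n. integrable M (\<lambda>\<omega>. (Y n \<omega>)\<^sup>2)"
    and var: "\<And>n. expectation (\<lambda>\<omega>. (Y n \<omega>)\<^sup>2) \<le> s"
    and c0: "\<And>n. 0 \<le> c n" and dec: "\<And>n. c (Suc n) \<le> c n"
  shows "prob {\<omega> \<in> space M. \<exists>k\<le>n. 1 \<le> c k * \<bar>\<Sum>j=1..k. Y j \<omega>\<bar>} \<le> s * (\<Sum>k=1..n. (c k)\<^sup>2)"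
proof -
  define W where "W k \<omega> = (\<Sum>j=1..k. Y j \<omega>)" for k \<omega>
  \<comment> \<open>The indicator that the bound has held up to time \<open>n\<close>; as a product
    it gains one factor in each step.\<close>
  define I where "I n \<omega> = (\<Prod>k\<le>n. of_bool (c k * \<bar>W k \<omega>\<bar> < 1) :: real)" for n \<omega>
  have Y[measurable]: "random_variable borel (Y n)" for n
    using indep by (auto simp: indep_vars_def2)
  have W[measurable]: "random_variable borel (W n)" for n
    unfolding W_def[abs_def] by measurable
  have I[measurable]: "random_variable borel (I n)" for n
    unfolding I_def[abs_def] by measurable
  have I01: "0 \<le> I n \<omega>" "I n \<omega> \<le> 1" for n \<omega>
    unfolding I_def by (auto intro!: prod_nonneg prod_le_1)
  have Wsq: "integrable M (\<lambda>\<omega>. (W n \<omega>)\<^sup>2)" for n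
    unfolding W_def by (intro square_integrable_sum sq Y) auto
  have I_int: "integrable M (\<lambda>\<omega>. I n \<omega> * F \<omega>)" if "integrable M F" for n and F :: "'a \<Rightarrow> real"
  proof (rule Bochner_Integration.integrable_bound[OF that])
    show "AE \<omega> in M. norm (I n \<omega> * F \<omega>) \<le> norm (F \<omega>)"
      using I01 by (intro AE_I2) (simp add: abs_mult mult_left_le_one_le)
  qed (use that in measurable)
  have I_int1: "integrable M (I n)" for n
    using I_int[of "\<lambda>_. 1"] by simp
  \<comment> \<open>\<open>I n\<close> and \<open>W n\<close> depend on the first \<open>n\<close>
    variables only, so the mixed term of the expanded square has mean 0.\<close>
  have cross: "expectation (\<lambda>\<omega>. (I n \<omega> * W n \<omega>) * Y (Suc n) \<omega>) = 0" for n
  proof -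
    let ?w = "\<lambda>k (y :: nat \<Rightarrow> real). \<Sum>j=1..k. y j"
    let ?F = "\<lambda>y. (\<Prod>k\<le>n. of_bool (c k * \<bar>?w k y\<bar> < 1)) * ?w n y :: real"
    have w: "?w k \<in> borel_measurable (Pi\<^sub>M {1..n} (\<lambda>_. borel))" if "k \<le> n" for k
      by (rule borel_measurable_sum[where f="\<lambda>j y. y j"], rule measurable_component_singleton) (use that in auto)
    have F: "?F \<in> borel_measurable (Pi\<^sub>M {1..n} (\<lambda>_. borel))"
    proof (intro borel_measurable_times borel_measurable_prod w)
      fix k assume "k \<in> {..n}"
      then have [measurable]: "?w k \<in> borel_measurable (Pi\<^sub>M {1..n} (\<lambda>_. borel))" by (intro w) auto
      show "(\<lambda>y. of_bool (c k * \<bar>?w k y\<bar> < 1) :: real) \<in> borel_measurable (Pi\<^sub>M {1..n} (\<lambda>_. borel))"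
        by measurable
    qed simp
    have "indep_var (Pi\<^sub>M {1..n} (\<lambda>_. borel)) (\<lambda>\<omega>. \<lambda>i\<in>{1..n}. Y i \<omega>) (Pi\<^sub>M {Suc n} (\<lambda>_. borel)) (\<lambda>\<omega>. \<lambda>i\<in>{Suc n}. Y i \<omega>)"
      by (rule indep_var_restrict[OF indep]) auto
    from indep_var_compose[OF this F measurable_component_singleton[of "Suc n" "{Suc n}"]]
    have ind: "indep_var borel (?F \<circ> (\<lambda>\<omega>. \<lambda>i\<in>{1..n}. Y i \<omega>)) borel ((\<lambda>y. y (Suc n)) \<circ> (\<lambda>\<omega>. \<lambda>i\<in>{Suc n}. Y i \<omega>))"
      by simp
    have w_eq: "?w k (\<lambda>i\<in>{1..n}. Y i \<omega>) = W k \<omega>" if "k \<le> n" for k \<omega>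
      using that by (auto simp: W_def intro!: sum.cong)
    have "?F \<circ> (\<lambda>\<omega>. \<lambda>i\<in>{1..n}. Y i \<omega>) = (\<lambda>\<omega>. I n \<omega> * W n \<omega>)"
      unfolding comp_def I_def by (intro ext arg_cong2[where f="(*)"] prod.cong refl) (simp_all only: w_eq atMost_iff order_refl)
    moreover have "(\<lambda>y. y (Suc n)) \<circ> (\<lambda>\<omega>. \<lambda>i\<in>{Suc n}. Y i \<omega>) = Y (Suc n)"
      by (simp add: fun_eq_iff)
    ultimately have "indep_var borel (\<lambda>\<omega>. I n \<omega> * W n \<omega>) borel (Y (Suc n))" using ind by simp
    moreover have "integrable M (\<lambda>\<omega>. I n \<omega> * W n \<omega>)"
      by (intro I_int square_integrable_imp_integrable[OF W Wsq])
    ultimately have "expectation (\<lambda>\<omega>. (I n \<omega> * W n \<omega>) * Y (Suc n) \<omega>)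
      = expectation (\<lambda>\<omega>. I n \<omega> * W n \<omega>) * expectation (Y (Suc n))"
      by (intro indep_var_lebesgue_integral square_integrable_imp_integrable[OF Y sq])
    then show ?thesis using mean by simp
  qed
  have main: "1 - expectation (I n) + expectation (\<lambda>\<omega>. I n \<omega> * (c n * W n \<omega>)\<^sup>2) \<le> s * (\<Sum>k=1..n. (c k)\<^sup>2)" for n
  proof (induction n)
    case 0
    show ?case by (simp add: I_def W_def prob_space)
  next
    case (Suc n)
    let ?q = "\<lambda>\<omega>. (c (Suc n) * W (Suc n) \<omega>)\<^sup>2"
    have q: "integrable M ?q" using Wsq by (simp add: power_mult_distrib)
    \<comment> \<open>Where the bound first fails at \<open>Suc n\<close>, \<open>?q\<close> is at
      least 1 and pays for the drop of the indicator; where it holds at \<open>Suc n\<close> the two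
      indicators agree.\<close>
    have "expectation (\<lambda>\<omega>. I (Suc n) \<omega> * ?q \<omega> - I (Suc n) \<omega>) \<le> expectation (\<lambda>\<omega>. I n \<omega> * ?q \<omega> - I n \<omega>)"
    proof (rule integral_mono)
      fix \<omega>
      show "I (Suc n) \<omega> * ?q \<omega> - I (Suc n) \<omega> \<le> I n \<omega> * ?q \<omega> - I n \<omega>"
      proof (cases "c (Suc n) * \<bar>W (Suc n) \<omega>\<bar> < 1")
        case True
        then show ?thesis by (simp add: I_def)
      next
        case False
        then have "1 \<le> \<bar>c (Suc n) * W (Suc n) \<omega>\<bar>" using c0 by (simp add: abs_mult)
        then have "1 \<le> ?q \<omega>" using power_mono[of 1 "\<bar>c (Suc n) * W (Suc n) \<omega>\<bar>" 2] by simp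
        then have "I n \<omega> * 1 \<le> I n \<omega> * ?q \<omega>" using I01 by (intro mult_left_mono)
        then show ?thesis using False by (simp add: I_def)
      qed
    qed (intro Bochner_Integration.integrable_diff I_int I_int1 q)+
    moreover have "expectation (\<lambda>\<omega>. I (Suc n) \<omega> * ?q \<omega> - I (Suc n) \<omega>)
        = expectation (\<lambda>\<omega>. I (Suc n) \<omega> * ?q \<omega>) - expectation (I (Suc n))"
      by (intro Bochner_Integration.integral_diff I_int I_int1 q)
    moreover have "expectation (\<lambda>\<omega>. I n \<omega> * ?q \<omega> - I n \<omega>)
        = expectation (\<lambda>\<omega>. I n \<omega> * ?q \<omega>) - expectation (I n)"
      by (intro Bochner_Integration.integral_diff I_int I_int1 q)
    moreover have "expectation (\<lambda>\<omega>. I n \<omega> * ?q \<omega>) \<le> expectation (\<lambda>\<omega>. I n \<omega> * (c n * W n \<omega>)\<^sup>2) + (c (Suc n))\<^sup>2 * s"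
    proof -
      have IW: "integrable M (\<lambda>\<omega>. I n \<omega> * (W n \<omega>)\<^sup>2)" by (intro I_int Wsq)
      have IY: "integrable M (\<lambda>\<omega>. I n \<omega> * (Y (Suc n) \<omega>)\<^sup>2)" by (intro I_int sq)
      have WY: "integrable M (\<lambda>\<omega>. W n \<omega> * Y (Suc n) \<omega>)" by (rule square_integrable_mult[OF W Y Wsq sq])
      have IWY: "integrable M (\<lambda>\<omega>. I n \<omega> * W n \<omega> * Y (Suc n) \<omega>)" using I_int[OF WY] by (simp add: mult.assoc)
      have "I n \<omega> * ?q \<omega> = (c (Suc n))\<^sup>2 * (I n \<omega> * (W n \<omega>)\<^sup>2 + 2 * (I n \<omega> * W n \<omega> * Y (Suc n) \<omega>) + I n \<omega> * (Y (Suc n) \<omega>)\<^sup>2)" for \<omega>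
        by (simp add: W_def power2_eq_square algebra_simps)
      then have "expectation (\<lambda>\<omega>. I n \<omega> * ?q \<omega>) = (c (Suc n))\<^sup>2 * (expectation (\<lambda>\<omega>. I n \<omega> * (W n \<omega>)\<^sup>2)
          + expectation (\<lambda>\<omega>. I n \<omega> * (Y (Suc n) \<omega>)\<^sup>2))"
        using IW IY IWY cross[of n] by simp
      also have "\<dots> \<le> (c n)\<^sup>2 * expectation (\<lambda>\<omega>. I n \<omega> * (W n \<omega>)\<^sup>2) + (c (Suc n))\<^sup>2 * s"
      proof -
        have "(c (Suc n))\<^sup>2 * expectation (\<lambda>\<omega>. I n \<omega> * (W n \<omega>)\<^sup>2) \<le> (c n)\<^sup>2 * expectation (\<lambda>\<omega>. I n \<omega> * (W n \<omega>)\<^sup>2)"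
          using c0 dec I01 by (intro mult_right_mono power_mono Bochner_Integration.integral_nonneg) auto
        moreover have "expectation (\<lambda>\<omega>. I n \<omega> * (Y (Suc n) \<omega>)\<^sup>2) \<le> expectation (\<lambda>\<omega>. (Y (Suc n) \<omega>)\<^sup>2)"
          using I01 by (intro integral_mono IY sq mult_left_le_one_le) auto
        then have "(c (Suc n))\<^sup>2 * expectation (\<lambda>\<omega>. I n \<omega> * (Y (Suc n) \<omega>)\<^sup>2) \<le> (c (Suc n))\<^sup>2 * s"
          using var[of "Suc n"] by (intro mult_left_mono) auto
        ultimately show ?thesis by (simp add: distrib_left)
      qed
      also have "(c n)\<^sup>2 * expectation (\<lambda>\<omega>. I n \<omega> * (W n \<omega>)\<^sup>2) = expectation (\<lambda>\<omega>. I n \<omega> * (c n * W n \<omega>)\<^sup>2)"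
        by (subst Bochner_Integration.integral_mult_right_zero[symmetric]) (simp add: power_mult_distrib mult_ac)
      finally show ?thesis .
    qed
    ultimately show ?case using Suc.IH by (simp add: distrib_left mult.commute)
  qed
  have "prob {\<omega> \<in> space M. \<exists>k\<le>n. 1 \<le> c k * \<bar>W k \<omega>\<bar>} = 1 - prob {\<omega> \<in> space M. \<forall>k\<le>n. c k * \<bar>W k \<omega>\<bar> < 1}"
    by (subst prob_compl[symmetric]) (auto intro!: arg_cong[where f=prob] simp: not_less not_le)
  also have "prob {\<omega> \<in> space M. \<forall>k\<le>n. c k * \<bar>W k \<omega>\<bar> < 1} = expectation (I n)"
  proof -
    have "expectation (I n) = expectation (indicator {\<omega> \<in> space M. \<forall>k\<le>n. c k * \<bar>W k \<omega>\<bar> < 1})"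
    proof (intro Bochner_Integration.integral_cong refl)
      fix \<omega> assume "\<omega> \<in> space M"
      then show "I n \<omega> = indicator {\<omega> \<in> space M. \<forall>k\<le>n. c k * \<bar>W k \<omega>\<bar> < 1} \<omega>"
        by (auto simp: I_def indicator_def prod_zero_iff)
    qed
    then show ?thesis by simp
  qed
  also have "1 - expectation (I n) \<le> s * (\<Sum>k=1..n. (c k)\<^sup>2)"
  proof -
    have "0 \<le> expectation (\<lambda>\<omega>. I n \<omega> * (c n * W n \<omega>)\<^sup>2)"
      using I01 by (intro Bochner_Integration.integral_nonneg) auto
    then show ?thesis using main[of n] by linarith
  qed
  finally show ?thesis unfolding W_def .
qed

text \<open>The terms up to \<open>a\<close> are frozen at their value there, since the maximal
  inequality needs nonincreasing weights. Beyond \<open>a\<close> the sum telescopes through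
  1/(n+1-y)^2 \<le> 1/(n-y) - 1/(n+1-y); the last summand of the bound keeps the induction
  going.\<close>

lemma sum_inverse_square_le:
  fixes y :: real
  assumes "y < real a" "a \<le> n"
  shows "(\<Sum>k=1..n. (1 / (real (max k a) - y))\<^sup>2) \<le> real a / (real a - y)\<^sup>2 + 1 / (real a - y) - 1 / (real n - y)"
  using assms(2)
proof (induction n rule: dec_induct)
  case base
  have "(\<Sum>k=1..a. (1 / (real (max k a) - y))\<^sup>2) = (\<Sum>k=1..a. 1 / (real a - y)\<^sup>2)"
    by (intro sum.cong) (auto simp: max_def power_divide)
  then show ?case by simp
next
  case (step n)
  have n: "y < real n" using assms(1) step.hyps by (auto intro: less_le_trans)
  have "(1 / (real (Suc n) - y))\<^sup>2 = 1 / ((real (Suc n) - y) * (real (Suc n) - y))"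
    by (simp add: power2_eq_square)
  also have "\<dots> \<le> 1 / ((real n - y) * (real (Suc n) - y))"
    using n by (intro divide_left_mono mult_right_mono mult_pos_pos) auto
  also have "\<dots> = 1 / (real n - y) - 1 / (real (Suc n) - y)"
    using n by (simp add: field_simps)
  finally have "(1 / (real (max (Suc n) a) - y))\<^sup>2 \<le> 1 / (real n - y) - 1 / (real (Suc n) - y)"
    using step.hyps by (simp add: max_def)
  then show ?case using step.IH by simp
qed

section \<open>Tail bounds for crossing a level early or late\<close>

context iid_sequence begin

context
  fixes f :: "'s \<Rightarrow> real" and \<mu> :: real
  assumes f[measurable]: "f \<in> borel_measurable S" and fsq: "integrable M (\<lambda>\<omega>. (f (X 0 \<omega>))\<^sup>2)"
    and \<mu>: "\<mu> = expectation (\<lambda>\<omega>. f (X 0 \<omega>))" and \<mu>_pos: "0 < \<mu>"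
begin

lemma f_square_integrable: "integrable M (\<lambda>\<omega>. (f (X n \<omega>))\<^sup>2)"
  using integrable_X[of "\<lambda>x. (f x)\<^sup>2" n] fsq by simp

lemma centred_f:
  shows "indep_vars (\<lambda>_. borel) (\<lambda>n \<omega>. f (X n \<omega>) - \<mu>) UNIV"
    and "expectation (\<lambda>\<omega>. f (X n \<omega>) - \<mu>) = 0"
    and "integrable M (\<lambda>\<omega>. (f (X n \<omega>) - \<mu>)\<^sup>2)"
    and "expectation (\<lambda>\<omega>. (f (X n \<omega>) - \<mu>)\<^sup>2) = variance (\<lambda>\<omega>. f (X 0 \<omega>))"
proof -
  show "indep_vars (\<lambda>_. borel) (\<lambda>n \<omega>. f (X n \<omega>) - \<mu>) UNIV"
    by (rule indep_vars_compose2[OF indep]) measurable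
  have int: "integrable M (\<lambda>\<omega>. f (X n \<omega>))"
    by (rule square_integrable_imp_integrable[OF _ f_square_integrable]) measurable
  then show "expectation (\<lambda>\<omega>. f (X n \<omega>) - \<mu>) = 0"
    using expectation_X[OF f, of n] by (simp add: prob_space \<mu>)
  have "integrable M (\<lambda>\<omega>. (f (X n \<omega>) + (- \<mu>))\<^sup>2)"
    by (rule square_integrable_add) (use f_square_integrable in auto)
  then show "integrable M (\<lambda>\<omega>. (f (X n \<omega>) - \<mu>)\<^sup>2)" by simp
  show "expectation (\<lambda>\<omega>. (f (X n \<omega>) - \<mu>)\<^sup>2) = variance (\<lambda>\<omega>. f (X 0 \<omega>))"
    using expectation_X[of "\<lambda>x. (f x - \<mu>)\<^sup>2" n] by (simp add: \<mu>)
qed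

lemma U_sum_rv[measurable]: "random_variable borel (U_sum f X n)"
  unfolding U_sum_def[abs_def] by measurable

lemma U_sum_centred: "(\<Sum>j=1..n. f (X j \<omega>) - \<mu>) = U_sum f X n \<omega> - \<mu> * real n"
  by (simp add: U_sum_def sum_subtractf mult.commute)

text \<open>Exceeding \<open>\<mu> * y\<close> at such an \<open>n\<close> requires a deviation from
  the mean of at least mu K sqrt y, and only indices up to \<open>y\<close> matter. With constant
  weights the maximal inequality is Kolmogorov's.\<close>

lemma prob_early_crossing:
  assumes K: "0 < K" and y: "1 \<le> y"
  shows "prob {\<omega> \<in> space M. \<exists>n. real n \<le> y - K * sqrt y \<and> \<mu> * y < U_sum f X n \<omega>}
    \<le> variance (\<lambda>\<omega>. f (X 0 \<omega>)) / (\<mu>\<^sup>2 * K\<^sup>2)"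
proof -
  let ?\<sigma> = "variance (\<lambda>\<omega>. f (X 0 \<omega>))"
  define c where "c = 1 / (\<mu> * K * sqrt y)"
  define n where "n = nat \<lfloor>y\<rfloor>"
  have c: "0 \<le> c" using K \<mu>_pos y by (simp add: c_def)
  have "{\<omega> \<in> space M. \<exists>n. real n \<le> y - K * sqrt y \<and> \<mu> * y < U_sum f X n \<omega>}
      \<subseteq> {\<omega> \<in> space M. \<exists>k\<le>n. 1 \<le> c * \<bar>\<Sum>j=1..k. f (X j \<omega>) - \<mu>\<bar>}"
  proof clarify
    fix \<omega> k assume "\<omega> \<in> space M" and k: "real k \<le> y - K * sqrt y" and cr: "\<mu> * y < U_sum f X k \<omega>"
    have "0 \<le> K * sqrt y" using K y by simp
    then have "real k \<le> y" using k by linarith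
    then have "k \<le> n" unfolding n_def by linarith
    moreover have "\<mu> * (K * sqrt y) \<le> \<mu> * (y - real k)"
      using k \<mu>_pos by (intro mult_left_mono) auto
    then have "\<mu> * K * sqrt y \<le> \<bar>U_sum f X k \<omega> - \<mu> * real k\<bar>"
      using cr by (simp add: algebra_simps)
    then have "1 \<le> c * \<bar>\<Sum>j=1..k. f (X j \<omega>) - \<mu>\<bar>"
      using K \<mu>_pos y unfolding U_sum_centred c_def by (simp add: field_simps)
    ultimately show "\<exists>k\<le>n. 1 \<le> c * \<bar>\<Sum>j=1..k. f (X j \<omega>) - \<mu>\<bar>" by blast
  qed
  then have "prob {\<omega> \<in> space M. \<exists>n. real n \<le> y - K * sqrt y \<and> \<mu> * y < U_sum f X n \<omega>}
      \<le> prob {\<omega> \<in> space M. \<exists>k\<le>n. 1 \<le> c * \<bar>\<Sum>j=1..k. f (X j \<omega>) - \<mu>\<bar>}"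
    by (intro finite_measure_mono) auto
  also have "\<dots> \<le> ?\<sigma> * (\<Sum>k=1..n. c\<^sup>2)"
    by (rule hajek_renyi[where c="\<lambda>_. c"]) (use centred_f c in auto)
  also have "\<dots> = ?\<sigma> * (real n * c\<^sup>2)" by simp
  also have "\<dots> \<le> ?\<sigma> * (1 / (\<mu>\<^sup>2 * K\<^sup>2))"
  proof (intro mult_left_mono variance_positive)
    have "real n \<le> y" using y by (simp add: n_def)
    then have "real n * c\<^sup>2 \<le> y * c\<^sup>2" by (intro mult_right_mono) auto
    also have "\<dots> = 1 / (\<mu>\<^sup>2 * K\<^sup>2)"
      using y by (simp add: c_def power_divide power_mult_distrib)
    finally show "real n * c\<^sup>2 \<le> 1 / (\<mu>\<^sup>2 * K\<^sup>2)" .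
  qed
  finally show ?thesis by simp
qed

text \<open>Here the horizon is infinite, but staying below \<open>\<mu> * y\<close> at index n
  needs a deviation mu (n - y), which grows with n. Weights that decay like its inverse make the sum
  of their squares of order 1/K uniformly in the horizon.\<close>

lemma prob_late_crossing:
  assumes K: "1 \<le> K" and y: "1 \<le> y"
  shows "prob {\<omega> \<in> space M. \<exists>n. y + K * sqrt y \<le> real n \<and> U_sum f X n \<omega> \<le> \<mu> * y}
    \<le> 3 * variance (\<lambda>\<omega>. f (X 0 \<omega>)) / (\<mu>\<^sup>2 * K)"
proof -
  let ?\<sigma> = "variance (\<lambda>\<omega>. f (X 0 \<omega>))"
  define a where "a = nat \<lceil>y + K * sqrt y\<rceil>"
  have sy: "1 \<le> sqrt y" using y by simp
  have Ks: "1 \<le> K * sqrt y" using mult_mono[of 1 K 1 "sqrt y"] K sy by simp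
  have a: "K * sqrt y \<le> real a - y" unfolding a_def by linarith
  then have ya: "y < real a" using Ks by linarith
  \<comment> \<open>Frozen below \<open>a\<close>, the first integer at or beyond y + K sqrt y,
    where 1/(k-y) would be too large or even negative.\<close>
  define c where "c k = 1 / (\<mu> * (real (max k a) - y))" for k
  have c0: "0 \<le> c k" for k
  proof -
    have "y < real (max k a)" using ya by (auto simp: max_def)
    then show ?thesis using \<mu>_pos by (simp add: c_def)
  qed
  have dec: "c (Suc k) \<le> c k" for k
  proof -
    have "y < real (max k a)" using ya by (auto simp: max_def)
    moreover have le: "real (max k a) \<le> real (max (Suc k) a)" by simp
    ultimately have "y < real (max (Suc k) a)" by linarith
    with le \<open>y < real (max k a)\<close> show ?thesis unfolding c_def
      using \<mu>_pos by (intro divide_left_mono mult_left_mono mult_pos_pos) auto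
  qed
  define B where "B n = {\<omega> \<in> space M. \<exists>k\<le>n. 1 \<le> c k * \<bar>\<Sum>j=1..k. f (X j \<omega>) - \<mu>\<bar>}" for n
  have Bm: "B n \<in> events" for n unfolding B_def by measurable
  have bound: "prob (B n) \<le> 3 * ?\<sigma> / (\<mu>\<^sup>2 * K)" if "a \<le> n" for n
  proof -
    have "prob (B n) \<le> ?\<sigma> * (\<Sum>k=1..n. (c k)\<^sup>2)"
      unfolding B_def by (rule hajek_renyi) (use centred_f c0 dec in auto)
    also have "\<dots> \<le> ?\<sigma> * (3 / (\<mu>\<^sup>2 * K))"
    proof (intro mult_left_mono variance_positive)
      define r where "r = real a - y"
      have r: "0 < r" "K * sqrt y \<le> r" "1 \<le> r" using ya a Ks by (auto simp: r_def)
      have "(\<Sum>k=1..n. (c k)\<^sup>2) = (\<Sum>k=1..n. (1 / (real (max k a) - y))\<^sup>2) / \<mu>\<^sup>2"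
        unfolding sum_divide_distrib by (intro sum.cong refl) (simp add: c_def power_divide power_mult_distrib)
      also have "\<dots> \<le> (real a / r\<^sup>2 + 1 / r) / \<mu>\<^sup>2"
      proof (rule divide_right_mono)
        have "0 \<le> 1 / (real n - y)" using ya that by simp
        then show "(\<Sum>k=1..n. (1 / (real (max k a) - y))\<^sup>2) \<le> real a / r\<^sup>2 + 1 / r"
          using sum_inverse_square_le[OF ya that] unfolding r_def by linarith
      qed simp
      \<comment> \<open>Here a = y + r.\<close>
      also have "real a / r\<^sup>2 + 1 / r = y / r\<^sup>2 + 2 / r"
        using r by (simp add: r_def[symmetric] field_simps power2_eq_square) (simp add: r_def)
      also have "\<dots> \<le> 1 / K + 2 / K"
      proof (rule add_mono)
        have "K * y \<le> K * K * y" using K y by (intro mult_right_mono) auto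
        also have "\<dots> = (K * sqrt y)\<^sup>2" using y by (simp add: power_mult_distrib power2_eq_square[of K])
        also have "\<dots> \<le> r\<^sup>2" using r Ks by (intro power_mono) auto
        finally show "y / r\<^sup>2 \<le> 1 / K" using r K by (simp add: field_simps)
        have "K * 1 \<le> K * sqrt y" using K sy by (intro mult_left_mono) auto
        then have "K \<le> r" using r by linarith
        then show "2 / r \<le> 2 / K" using r K by (intro divide_left_mono) auto
      qed
      finally show "(\<Sum>k=1..n. (c k)\<^sup>2) \<le> 3 / (\<mu>\<^sup>2 * K)"
        using \<mu>_pos by (simp add: divide_right_mono field_simps)
    qed
    finally show ?thesis by (simp add: mult.commute)
  qed
  \<comment> \<open>The bound is free of the horizon \<open>n\<close>, so continuity from below
    carries it to the union.\<close>
  have "incseq B" unfolding B_def incseq_def by (auto intro: order_trans)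
  then have "(\<lambda>n. prob (B n)) \<longlonglongrightarrow> prob (\<Union>n. B n)"
    using Bm by (intro finite_Lim_measure_incseq) auto
  then have "prob (\<Union>n. B n) \<le> 3 * ?\<sigma> / (\<mu>\<^sup>2 * K)"
    by (rule LIMSEQ_le_const2) (use bound in blast)
  moreover have "{\<omega> \<in> space M. \<exists>n. y + K * sqrt y \<le> real n \<and> U_sum f X n \<omega> \<le> \<mu> * y} \<subseteq> (\<Union>n. B n)"
  proof clarify
    fix \<omega> n assume \<omega>: "\<omega> \<in> space M" and n: "y + K * sqrt y \<le> real n" and late: "U_sum f X n \<omega> \<le> \<mu> * y"
    have an: "a \<le> n" using n unfolding a_def by linarith
    then have yn: "y < real n" using ya by linarith
    have "\<mu> * (real n - y) \<le> \<bar>U_sum f X n \<omega> - \<mu> * real n\<bar>"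
      using late by (simp add: algebra_simps)
    then have "1 \<le> c n * \<bar>\<Sum>j=1..n. f (X j \<omega>) - \<mu>\<bar>"
      unfolding U_sum_centred c_def using an yn \<mu>_pos by (simp add: max_def divide_simps)
    then show "\<omega> \<in> (\<Union>n. B n)" using \<omega> unfolding B_def by blast
  qed
  then have "prob {\<omega> \<in> space M. \<exists>n. y + K * sqrt y \<le> real n \<and> U_sum f X n \<omega> \<le> \<mu> * y} \<le> prob (\<Union>n. B n)"
    using Bm by (intro finite_measure_mono) auto
  ultimately show ?thesis by linarith
qed

end

end

section \<open>Uniform control in a window\<close>

text \<open>The half-width is of order sqrt y, the scale on which the crossing times
  fluctuate.\<close>

definition window :: "real \<Rightarrow> real \<Rightarrow> nat set" where
  "window L y = {n. \<bar>real n - y\<bar> \<le> L * sqrt y}"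

lemma nat_floor_bounds:
  fixes x :: real
  assumes "0 \<le> x"
  shows "real (nat \<lfloor>x\<rfloor>) \<le> x" "x < real (nat \<lfloor>x\<rfloor>) + 1"
proof -
  have "real (nat \<lfloor>x\<rfloor>) = of_int \<lfloor>x\<rfloor>" using assms by simp
  then show "real (nat \<lfloor>x\<rfloor>) \<le> x" "x < real (nat \<lfloor>x\<rfloor>) + 1" using floor_correct[of x] by auto
qed

lemma eventually_const_over_sqrt_le:
  fixes C \<eta> :: real
  assumes "0 < \<eta>"
  shows "\<forall>\<^sub>F y in at_top. C / sqrt y \<le> \<eta>"
proof -
  have "((\<lambda>y. C / sqrt y) \<longlongrightarrow> 0) at_top" by real_asymp
  from order_tendstoD(2)[OF this assms] show ?thesis by eventually_elim simp
qed

lemma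
  assumes "0 \<le> L" "1 \<le> y"
  shows finite_window: "finite (window L y)" and card_window: "real (card (window L y)) \<le> (2 * L + 1) * sqrt y"
proof -
  define a where "a = max 0 (y - L * sqrt y)"
  define b where "b = y + L * sqrt y"
  have b: "0 \<le> b" "a \<le> b" using assms by (auto simp: b_def a_def)
  have sub: "window L y \<subseteq> {nat \<lceil>a\<rceil>..nat \<lfloor>b\<rfloor>}"
  proof
    fix n assume "n \<in> window L y"
    then have "a \<le> real n" "real n \<le> b" by (auto simp: window_def a_def b_def)
    then show "n \<in> {nat \<lceil>a\<rceil>..nat \<lfloor>b\<rfloor>}" by (auto simp: le_nat_floor nat_le_iff ceiling_le_iff)
  qed
  then show "finite (window L y)" by (rule finite_subset) simp
  have "real (card (window L y)) \<le> real (card {nat \<lceil>a\<rceil>..nat \<lfloor>b\<rfloor>})"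
    using sub by (intro of_nat_mono card_mono) auto
  also have "\<dots> \<le> b - a + 1"
  proof (cases "nat \<lceil>a\<rceil> \<le> Suc (nat \<lfloor>b\<rfloor>)")
    case True
    then have "real (card {nat \<lceil>a\<rceil>..nat \<lfloor>b\<rfloor>}) = real (nat \<lfloor>b\<rfloor>) + 1 - real (nat \<lceil>a\<rceil>)"
      by (simp add: of_nat_diff)
    moreover have "real (nat \<lfloor>b\<rfloor>) \<le> b" "a \<le> real (nat \<lceil>a\<rceil>)" using b by (auto simp: a_def)
    ultimately show ?thesis by linarith
  next
    case False
    then show ?thesis using b by simp
  qed
  also have "\<dots> \<le> 2 * L * sqrt y + 1" by (simp add: a_def b_def)
  also have "\<dots> \<le> (2 * L + 1) * sqrt y" using assms by (simp add: distrib_right)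
  finally show "real (card (window L y)) \<le> (2 * L + 1) * sqrt y" .
qed

section \<open>Statements that hold with probability tending to 1\<close>

context prob_space
begin

text \<open>The failure of \<open>Q y\<close> only has to be covered by a small event, so statements
  quantified over a whole window can be used without proving them measurable.\<close>

definition whp :: "(real \<Rightarrow> 'a \<Rightarrow> bool) \<Rightarrow> bool" where
  "whp Q \<longleftrightarrow> (\<forall>\<eta>>0. \<forall>\<^sub>F y in at_top. \<exists>A\<in>events. prob A \<le> \<eta> \<and> (\<forall>\<omega>\<in>space M - A. Q y \<omega>))"

lemma whp_conj:
  assumes "whp Q" "whp R"
  shows "whp (\<lambda>y \<omega>. Q y \<omega> \<and> R y \<omega>)"
  unfolding whp_def
proof (intro allI impI)
  fix \<eta> :: real assume "0 < \<eta>"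
  then have "\<forall>\<^sub>F y in at_top. \<exists>A\<in>events. prob A \<le> \<eta> / 2 \<and> (\<forall>\<omega>\<in>space M - A. Q y \<omega>)"
    "\<forall>\<^sub>F y in at_top. \<exists>A\<in>events. prob A \<le> \<eta> / 2 \<and> (\<forall>\<omega>\<in>space M - A. R y \<omega>)"
    using assms unfolding whp_def by (auto dest!: spec[of _ "\<eta> / 2"])
  then show "\<forall>\<^sub>F y in at_top. \<exists>A\<in>events. prob A \<le> \<eta> \<and> (\<forall>\<omega>\<in>space M - A. Q y \<omega> \<and> R y \<omega>)"
  proof eventually_elim
    case (elim y)
    then obtain A B where A: "A \<in> events" "prob A \<le> \<eta> / 2" "\<forall>\<omega>\<in>space M - A. Q y \<omega>"
      and B: "B \<in> events" "prob B \<le> \<eta> / 2" "\<forall>\<omega>\<in>space M - B. R y \<omega>" by blast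
    have "prob (A \<union> B) \<le> \<eta>" using measure_Un_le[OF A(1) B(1)] A(2) B(2) by linarith
    then show ?case using A B by (intro bexI[of _ "A \<union> B"]) auto
  qed
qed

lemma whp_mono:
  assumes "whp Q" "\<forall>\<^sub>F y in at_top. \<forall>\<omega>\<in>space M. Q y \<omega> \<longrightarrow> R y \<omega>"
  shows "whp R"
  unfolding whp_def
proof (intro allI impI)
  fix \<eta> :: real assume "0 < \<eta>"
  then have "\<forall>\<^sub>F y in at_top. \<exists>A\<in>events. prob A \<le> \<eta> \<and> (\<forall>\<omega>\<in>space M - A. Q y \<omega>)"
    using assms(1) unfolding whp_def by auto
  then show "\<forall>\<^sub>F y in at_top. \<exists>A\<in>events. prob A \<le> \<eta> \<and> (\<forall>\<omega>\<in>space M - A. R y \<omega>)"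
    using assms(2)
  proof eventually_elim
    case (elim y)
    then obtain A where "A \<in> events" "prob A \<le> \<eta>" "\<forall>\<omega>\<in>space M - A. Q y \<omega>" by blast
    then show ?case using elim(2) by (intro bexI[of _ A]) auto
  qed
qed

lemma whp_union_bound:
  fixes B :: "real \<Rightarrow> 'i \<Rightarrow> 'a set"
  assumes "\<forall>\<^sub>F y in at_top. finite (J y) \<and> (\<forall>j\<in>J y. B y j \<in> events) \<and> (\<Sum>j\<in>J y. prob (B y j)) \<le> C / sqrt y"
  shows "whp (\<lambda>y \<omega>. \<forall>j\<in>J y. \<omega> \<notin> B y j)"
  unfolding whp_def
proof (intro allI impI)
  fix \<eta> :: real assume "0 < \<eta>"
  from eventually_const_over_sqrt_le[OF this, of C] assms
  show "\<forall>\<^sub>F y in at_top. \<exists>A\<in>events. prob A \<le> \<eta> \<and> (\<forall>\<omega>\<in>space M - A. \<forall>j\<in>J y. \<omega> \<notin> B y j)"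
  proof eventually_elim
    case (elim y)
    have "prob (\<Union>j\<in>J y. B y j) \<le> (\<Sum>j\<in>J y. prob (B y j))"
      using elim by (intro finite_measure_subadditive_finite) auto
    then show ?case using elim by (intro bexI[of _ "\<Union>j\<in>J y. B y j"]) auto
  qed
qed

lemma whp_imp_tendsto:
  fixes D :: "real \<Rightarrow> 'a \<Rightarrow> real"
  assumes "whp (\<lambda>y \<omega>. \<bar>D y \<omega>\<bar> \<le> \<epsilon>)"
  shows "((\<lambda>y. prob {\<omega> \<in> space M. \<epsilon> < \<bar>D y \<omega>\<bar>}) \<longlongrightarrow> 0) at_top"
proof (rule tendstoI)
  fix e :: real assume "0 < e"
  then have "\<forall>\<^sub>F y in at_top. \<exists>A\<in>events. prob A \<le> e / 2 \<and> (\<forall>\<omega>\<in>space M - A. \<bar>D y \<omega>\<bar> \<le> \<epsilon>)"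
    using assms unfolding whp_def by (auto dest!: spec[of _ "e / 2"])
  then show "\<forall>\<^sub>F y in at_top. dist (prob {\<omega> \<in> space M. \<epsilon> < \<bar>D y \<omega>\<bar>}) 0 < e"
  proof eventually_elim
    case (elim y)
    then obtain A where A: "A \<in> events" "prob A \<le> e / 2" "\<forall>\<omega>\<in>space M - A. \<bar>D y \<omega>\<bar> \<le> \<epsilon>" by blast
    have "prob {\<omega> \<in> space M. \<epsilon> < \<bar>D y \<omega>\<bar>} \<le> prob A"
      using A by (intro finite_measure_mono) force+
    then show ?case using A(2) \<open>0 < e\<close> by (simp add: dist_real_def)
  qed
qed

end

section \<open>Oscillation of the walk and of the statistic within a window\<close>

context iid_sequence begin

text \<open>A union bound: the window has O(sqrt y) indices and by Chebyshev's inequality each fails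
  with probability O(1/y). It later bounds the overshoot at the crossing.\<close>

lemma whp_window_small:
  assumes f[measurable]: "f \<in> borel_measurable S" and fsq: "integrable M (\<lambda>\<omega>. (f (X 0 \<omega>))\<^sup>2)"
    and L: "0 \<le> L" and \<epsilon>: "0 < \<epsilon>"
  shows "whp (\<lambda>y \<omega>. \<forall>k\<in>window L y. \<bar>f (X k \<omega>)\<bar> \<le> \<epsilon> * sqrt y)"
proof -
  let ?q = "expectation (\<lambda>\<omega>. (f (X 0 \<omega>))\<^sup>2)"
  define B where "B = (\<lambda>y k. {\<omega> \<in> space M. \<epsilon> * sqrt y \<le> \<bar>f (X k \<omega>)\<bar>})"
  have "whp (\<lambda>y \<omega>. \<forall>k\<in>window L y. \<omega> \<notin> B y k)"
  proof (rule whp_union_bound[where C="(2 * L + 1) * (?q / \<epsilon>\<^sup>2)"])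
    show "\<forall>\<^sub>F y in at_top. finite (window L y) \<and> (\<forall>k\<in>window L y. B y k \<in> events) \<and>
      (\<Sum>k\<in>window L y. prob (B y k)) \<le> (2 * L + 1) * (?q / \<epsilon>\<^sup>2) / sqrt y"
      using eventually_ge_at_top[of 1]
    proof eventually_elim
      case (elim y)
      have "(\<Sum>k\<in>window L y. prob (B y k)) \<le> (\<Sum>k\<in>window L y. ?q / (\<epsilon> * sqrt y)\<^sup>2)"
      proof (rule sum_mono)
        fix k
        show "prob (B y k) \<le> ?q / (\<epsilon> * sqrt y)\<^sup>2"
          unfolding B_def
        proof (rule chebyshev)
          show "integrable M (\<lambda>\<omega>. (f (X k \<omega>))\<^sup>2)" "expectation (\<lambda>\<omega>. (f (X k \<omega>))\<^sup>2) \<le> ?q"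
            using fsq integrable_X[of "\<lambda>x. (f x)\<^sup>2" k] expectation_X[of "\<lambda>x. (f x)\<^sup>2" k] by auto
          show "0 < \<epsilon> * sqrt y" using \<epsilon> elim by simp
        qed measurable
      qed
      also have "\<dots> = real (card (window L y)) * (?q / (\<epsilon> * sqrt y)\<^sup>2)" by simp
      also have "\<dots> \<le> ((2 * L + 1) * sqrt y) * (?q / (\<epsilon> * sqrt y)\<^sup>2)"
        by (intro mult_right_mono card_window L elim) auto
      also have "\<dots> = (2 * L + 1) * (?q / \<epsilon>\<^sup>2) * (sqrt y / y)"
        using elim by (simp add: power_mult_distrib)
      also have "sqrt y / y = 1 / sqrt y" using elim by (simp add: field_simps)
      finally have "(\<Sum>k\<in>window L y. prob (B y k)) \<le> (2 * L + 1) * (?q / \<epsilon>\<^sup>2) / sqrt y" by simp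
      then show ?case
        using finite_window[OF L elim] by (auto simp: B_def)
    qed
  qed
  then show ?thesis
    by (rule whp_mono) (intro always_eventually allI ballI impI, force simp: B_def)
qed

text \<open>The order y^(d - 1/2) of the fluctuations of the statistic.\<close>

definition rate :: "nat \<Rightarrow> real \<Rightarrow> real" where
  "rate d y = y ^ (d - 1) * sqrt y"

lemma rate_pos: "0 < y \<Longrightarrow> 0 < rate d y"
  by (simp add: rate_def)

lemma rate_square: "0 \<le> y \<Longrightarrow> (rate d y)\<^sup>2 = y ^ (2 * d - 2) * y"
proof -
  assume "0 \<le> y"
  moreover have "2 * d - 2 = (d - 1) * 2" by simp
  ultimately show ?thesis by (simp only: rate_def power_mult_distrib power_mult real_sqrt_pow2)
qed

text \<open>Within a window the increment has second moment O(sqrt y * y^(2d-2)), against the square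
  y^(2d-1) of the rate; the quotient is O(1/sqrt y).\<close>

lemma prob_increment_le:
  assumes g: "kernel d g" and d: "1 \<le> d" and \<epsilon>: "0 < \<epsilon>" and y: "1 \<le> y" and Ly: "L * sqrt y \<le> y"
    and n: "n \<in> window L y" and m: "m \<in> window L y"
  defines "q \<equiv> expectation (\<lambda>\<omega>. (g (\<lambda>k\<in>{1..d}. X k \<omega>) - U_mean M d g X)\<^sup>2)"
  shows "prob {\<omega> \<in> space M. \<epsilon> * rate d y \<le> \<bar>U_centred d g n \<omega> - U_centred d g m \<omega>\<bar>}
     \<le> 2 * L * (real d)\<^sup>2 * 2 ^ (2 * d - 2) * q / \<epsilon>\<^sup>2 / sqrt y"
  using n m
proof (induction n m rule: linorder_wlog)
  case (sym n m)
  then show ?case by (simp add: abs_minus_commute)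
next
  case (le n m)
  have mn: "real m \<le> 2 * y" "real m - real n \<le> 2 * L * sqrt y"
    using le Ly by (auto simp: window_def)
  have q0: "0 \<le> q" by (simp add: q_def)
  have "prob {\<omega> \<in> space M. \<epsilon> * rate d y \<le> \<bar>U_centred d g m \<omega> - U_centred d g n \<omega>\<bar>}
    \<le> real (d\<^sup>2 * ((m - n) * m ^ (2 * d - 2))) * q / (\<epsilon> * rate d y)\<^sup>2"
  proof (rule chebyshev)
    show "random_variable borel (\<lambda>\<omega>. U_centred d g m \<omega> - U_centred d g n \<omega>)"
      using U_centred_rv[OF g] by measurable
    show "integrable M (\<lambda>\<omega>. (U_centred d g m \<omega> - U_centred d g n \<omega>)\<^sup>2)" by (rule U_centred_square_integrable[OF g])
    show "0 < \<epsilon> * rate d y" using \<epsilon> y rate_pos[of y d] by simp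
    show "expectation (\<lambda>\<omega>. (U_centred d g m \<omega> - U_centred d g n \<omega>)\<^sup>2) \<le> real (d\<^sup>2 * ((m - n) * m ^ (2 * d - 2))) * q"
      unfolding q_def by (rule increment_second_moment[OF g d le(1)])
  qed
  also have "\<dots> \<le> ((real d)\<^sup>2 * ((2 * L * sqrt y) * (2 * y) ^ (2 * d - 2))) * q / (\<epsilon> * rate d y)\<^sup>2"
  proof (intro divide_right_mono mult_right_mono q0)
    have "real ((m - n) * m ^ (2 * d - 2)) \<le> (2 * L * sqrt y) * (2 * y) ^ (2 * d - 2)"
      unfolding of_nat_mult of_nat_power of_nat_diff[OF le(1)]
      using mn le(1) by (intro mult_mono power_mono) auto
    then show "real (d\<^sup>2 * ((m - n) * m ^ (2 * d - 2))) \<le> (real d)\<^sup>2 * ((2 * L * sqrt y) * (2 * y) ^ (2 * d - 2))"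
      using mult_left_mono[of _ _ "(real d)\<^sup>2"] by simp
  qed simp
  also have "\<dots> = 2 * L * (real d)\<^sup>2 * 2 ^ (2 * d - 2) * q / \<epsilon>\<^sup>2 / sqrt y"
  proof -
    have "y = sqrt y * sqrt y" using y by simp
    then have r2: "(rate d y)\<^sup>2 = y ^ (2 * d - 2) * (sqrt y * sqrt y)" using rate_square[of y d] y by simp
    have "y ^ (2 * d - 2) \<noteq> 0" "sqrt y \<noteq> 0" "\<epsilon> \<noteq> 0" using y \<epsilon> by auto
    then show ?thesis unfolding power_mult_distrib r2 by (simp add: divide_simps) (simp add: mult_ac)?
  qed
  finally show ?case by (simp add: abs_minus_commute)
qed

lemma U_stat_mono:
  assumes "\<And>x. 0 \<le> h x" "n \<le> m"
  shows "U_stat d h X n \<omega> \<le> U_stat d h X m \<omega>"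
  unfolding U_stat_def
  using assms(1) increasing_tuples_mono[OF assms(2)]
  by (intro sum_mono2) (auto simp: increasing_tuples_finite)

lemma binomial_increment_le:
  assumes "1 \<le> d" "n \<le> m"
  shows "real (m choose d) - real (n choose d) \<le> real ((m - n) * m ^ (d - 1))"
proof -
  have "card (increasing_tuples d m) = card (increasing_tuples d m - increasing_tuples d n) + card (increasing_tuples d n)"
    using increasing_tuples_mono[OF assms(2), of d]
    by (subst card_Diff_subset) (auto simp: increasing_tuples_finite card_mono)
  then have "m choose d \<le> (m - n) * m ^ (d - 1) + (n choose d)"
    using card_increasing_tuples_diff[OF assms] by (simp add: card_increasing_tuples)
  then have "real (m choose d) \<le> real ((m - n) * m ^ (d - 1) + (n choose d))" by (rule of_nat_mono)
  then show ?thesis by simp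
qed

text \<open>For a nonnegative kernel the statistic is monotone in \<open>n\<close>, so that it is enough to control
  it on a grid of mesh \<open>\<delta> * sqrt y\<close>, which has a bounded number of points in the window.\<close>

lemma whp_window_oscillation_nonneg:
  assumes h: "kernel d h" and h0: "\<And>x. 0 \<le> h x" and d: "1 \<le> d" and L: "0 \<le> L" and \<epsilon>: "0 < \<epsilon>"
  shows "whp (\<lambda>y \<omega>. \<forall>n\<in>window L y. \<bar>U_centred d h n \<omega> - U_centred d h (nat \<lfloor>y\<rfloor>) \<omega>\<bar> \<le> \<epsilon> * rate d y)"
proof -
  define \<theta> where "\<theta> = U_mean M d h X"
  have \<theta>0: "0 \<le> \<theta>" unfolding \<theta>_def U_mean_def by (intro Bochner_Integration.integral_nonneg h0)
  \<comment> \<open>Over one mesh the mean of the statistic moves by at most theta delta 2^d times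
    the rate; this choice makes it at most half of epsilon. The summand 1 admits theta = 0.\<close>
  define \<delta> where "\<delta> = \<epsilon> / (2 ^ (d + 1) * (\<theta> + 1))"
  have \<delta>: "0 < \<delta>" using \<epsilon> \<theta>0 by (simp add: \<delta>_def)
  define J where "J = nat \<lfloor>2 * L / \<delta>\<rfloor> + 1"
  define v where "v = (\<lambda>y j. y - L * sqrt y + real j * \<delta> * sqrt y)"
  define G where "G = (\<lambda>y j. nat \<lfloor>v y j\<rfloor>)"
  \<comment> \<open>Room for the grid point beyond the end of the window (\<open>\<delta>\<close>)
    and for rounding to integers (1).\<close>
  define L' where "L' = L + \<delta> + 1"
  define B where "B = (\<lambda>y j. {\<omega> \<in> space M. (\<epsilon> / 2) * rate d y \<le> \<bar>U_centred d h (G y j) \<omega> - U_centred d h (nat \<lfloor>y\<rfloor>) \<omega>\<bar>})"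
  define q where "q = expectation (\<lambda>\<omega>. (h (\<lambda>k\<in>{1..d}. X k \<omega>) - U_mean M d h X)\<^sup>2)"
  define C where "C = 2 * L' * (real d)\<^sup>2 * 2 ^ (2 * d - 2) * q / (\<epsilon> / 2)\<^sup>2"
  have J\<delta>: "real J * \<delta> \<le> 2 * L + \<delta>"
  proof -
    have "real (nat \<lfloor>2 * L / \<delta>\<rfloor>) \<le> 2 * L / \<delta>" using L \<delta> by simp
    then have "real J \<le> 2 * L / \<delta> + 1" by (simp add: J_def)
    then have "real J * \<delta> \<le> (2 * L / \<delta> + 1) * \<delta>" using \<delta> by (intro mult_right_mono) auto
    then show ?thesis using \<delta> by (simp add: distrib_right)
  qed
  have large: "\<forall>\<^sub>F y in at_top. 1 \<le> y \<and> L' * sqrt y \<le> y \<and> 1 \<le> \<delta> * sqrt y"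
    using eventually_ge_at_top[of 1] eventually_const_over_sqrt_le[OF zero_less_one, of L'] eventually_const_over_sqrt_le[OF \<delta>, of 1]
  proof eventually_elim
    case (elim y)
    have "L' \<le> sqrt y" using elim by (simp add: field_simps)
    then have "L' * sqrt y \<le> sqrt y * sqrt y" using elim by (intro mult_right_mono) auto
    then show ?case using elim by (simp add: field_simps)
  qed
  have v_bounds: "0 \<le> v y j" "\<bar>v y j - y\<bar> \<le> (L + \<delta>) * sqrt y"
    if "1 \<le> y" "L' * sqrt y \<le> y" "j \<le> J" for y j
  proof -
    have "real j * \<delta> \<le> real J * \<delta>" using that \<delta> by (intro mult_right_mono) auto
    then have "real j * \<delta> \<le> 2 * L + \<delta>" using J\<delta> by linarith
    then have up: "real j * \<delta> * sqrt y \<le> (2 * L + \<delta>) * sqrt y" using that by (intro mult_right_mono) auto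
    have lo: "0 \<le> real j * \<delta> * sqrt y" using \<delta> that by simp
    have sy: "0 \<le> \<delta> * sqrt y" "0 \<le> sqrt y" using \<delta> that by auto
    show "0 \<le> v y j"
      using lo that(2) sy unfolding v_def L'_def distrib_right mult_1_left by linarith
    show "\<bar>v y j - y\<bar> \<le> (L + \<delta>) * sqrt y"
      using lo up sy unfolding v_def distrib_right by linarith
  qed
  have G_window: "G y j \<in> window L' y" if "1 \<le> y" "L' * sqrt y \<le> y" "j \<le> J" for y j
  proof -
    have "real (G y j) \<le> v y j" "v y j < real (G y j) + 1"
      unfolding G_def by (rule nat_floor_bounds[OF v_bounds(1)[OF that]])+
    moreover have "1 \<le> sqrt y" using that by simp
    ultimately show ?thesis
      using v_bounds(2)[OF that] unfolding window_def mem_Collect_eq L'_def distrib_right mult_1_left by linarith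
  qed
  have m_window: "nat \<lfloor>y\<rfloor> \<in> window L' y" if "1 \<le> y" for y
  proof -
    have "real (nat \<lfloor>y\<rfloor>) \<le> y" "y < real (nat \<lfloor>y\<rfloor>) + 1"
      using that nat_floor_bounds[of y] by auto
    moreover have "1 \<le> sqrt y" "0 \<le> L * sqrt y" "0 \<le> \<delta> * sqrt y" using that L \<delta> by auto
    ultimately show ?thesis
      unfolding window_def mem_Collect_eq L'_def distrib_right mult_1_left by linarith
  qed
  have "whp (\<lambda>y \<omega>. \<forall>j\<in>{..J}. \<omega> \<notin> B y j)"
  proof (rule whp_union_bound[where C="real (J + 1) * C"])
    show "\<forall>\<^sub>F y in at_top. finite {..J} \<and> (\<forall>j\<in>{..J}. B y j \<in> events) \<and> (\<Sum>j\<in>{..J}. prob (B y j)) \<le> real (J + 1) * C / sqrt y"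
      using large
    proof eventually_elim
      case (elim y)
      have "(\<Sum>j\<in>{..J}. prob (B y j)) \<le> (\<Sum>j\<in>{..J}. C / sqrt y)"
        unfolding B_def C_def q_def
        using elim \<epsilon> by (intro sum_mono prob_increment_le h d G_window m_window) auto
      moreover have "B y j \<in> events" for j
        unfolding B_def using U_centred_rv[OF h] by measurable
      ultimately show ?case by (simp add: add.commute)
    qed
  qed
  then show ?thesis
  proof (rule whp_mono)
    show "\<forall>\<^sub>F y in at_top. \<forall>\<omega>\<in>space M. (\<forall>j\<in>{..J}. \<omega> \<notin> B y j) \<longrightarrow>
      (\<forall>n\<in>window L y. \<bar>U_centred d h n \<omega> - U_centred d h (nat \<lfloor>y\<rfloor>) \<omega>\<bar> \<le> \<epsilon> * rate d y)"
      using large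
    proof eventually_elim
      case (elim y)
      have y: "1 \<le> y" "L' * sqrt y \<le> y" "1 \<le> \<delta> * sqrt y" using elim by auto
      have sy: "0 < \<delta> * sqrt y" using y(3) by linarith
      show ?case
      proof (intro ballI impI)
        fix \<omega> n assume \<omega>: "\<omega> \<in> space M" and good: "\<forall>j\<in>{..J}. \<omega> \<notin> B y j" and n: "n \<in> window L y"
        let ?V = "\<lambda>n. U_centred d h n \<omega>" and ?m = "nat \<lfloor>y\<rfloor>"
        \<comment> \<open>The position of \<open>n\<close> on the grid, in units of the mesh; the
          grid points \<open>j\<close> and \<open>j + 1\<close> then enclose
          \<open>n\<close>.\<close>
        define t where "t = (real n - (y - L * sqrt y)) / (\<delta> * sqrt y)"
        define j where "j = nat \<lfloor>t\<rfloor>"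
        have nL: "y - L * sqrt y \<le> real n" "real n \<le> y + L * sqrt y" using n by (auto simp: window_def)
        then have t0: "0 \<le> t" using sy by (simp add: t_def)
        have "t \<le> (2 * L * sqrt y) / (\<delta> * sqrt y)"
          unfolding t_def using nL sy by (intro divide_right_mono) auto
        also have "\<dots> = 2 * L / \<delta>" using y by simp
        finally have "\<lfloor>t\<rfloor> \<le> \<lfloor>2 * L / \<delta>\<rfloor>" by (rule floor_mono)
        then have jJ: "j + 1 \<le> J" unfolding j_def J_def by (simp add: nat_mono)
        have jt: "real j \<le> t" "t < real j + 1" unfolding j_def by (rule nat_floor_bounds[OF t0])+
        have t_eq: "real n = y - L * sqrt y + t * (\<delta> * sqrt y)"
        proof -
          have "\<delta> * sqrt y \<noteq> 0" using sy by linarith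
          from iffD1[OF nonzero_eq_divide_eq[OF this] t_def] show ?thesis by linarith
        qed
        have "v y j \<le> real n"
          using mult_right_mono[OF jt(1), of "\<delta> * sqrt y"] sy unfolding t_eq v_def mult.assoc by linarith
        then have Gn: "G y j \<le> n" unfolding G_def by linarith
        have "real n < v y (j + 1)"
          using mult_strict_right_mono[OF jt(2) sy] unfolding t_eq v_def mult.assoc of_nat_add of_nat_1 by linarith
        then have nG: "n \<le> G y (j + 1)" unfolding G_def by linarith
        have g1: "\<bar>?V (G y j) - ?V ?m\<bar> < \<epsilon> / 2 * rate d y" "\<bar>?V (G y (j + 1)) - ?V ?m\<bar> < \<epsilon> / 2 * rate d y"
          using good jJ \<omega> by (auto simp: B_def not_le)
        \<comment> \<open>Only the uncentred statistic is monotone, so the change of its mean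
          between neighbouring grid points has to be paid separately.\<close>
        have mesh: "\<theta> * (real (G y (j + 1) choose d) - real (G y j choose d)) \<le> \<epsilon> / 2 * rate d y"
        proof -
          have GG: "G y j \<le> G y (j + 1)" using Gn nG by linarith
          have "real (G y (j + 1)) \<le> v y (j + 1)" "v y j < real (G y j) + 1"
            using nat_floor_bounds(1)[OF v_bounds(1)[OF y(1,2) jJ]] nat_floor_bounds(2)[OF v_bounds(1)[OF y(1,2), of j]] jJ
            unfolding G_def by auto
          moreover have "v y (j + 1) - v y j = \<delta> * sqrt y" by (simp add: v_def distrib_right)
          \<comment> \<open>Rounding costs less than 1, which is at most
            \<open>\<delta> * sqrt y\<close>; hence the factor 2.\<close>
          ultimately have "real (G y (j + 1) - G y j) \<le> 2 * (\<delta> * sqrt y)" using y(3) GG by (simp add: of_nat_diff)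
          moreover have "real (G y (j + 1)) \<le> 2 * y"
            using G_window[OF y(1,2) jJ] y by (simp add: window_def abs_le_iff)
          ultimately have "real ((G y (j + 1) - G y j) * G y (j + 1) ^ (d - 1)) \<le> (2 * (\<delta> * sqrt y)) * (2 * y) ^ (d - 1)"
            unfolding of_nat_mult of_nat_power using sy by (intro mult_mono power_mono) auto
          also have "\<dots> = \<delta> * 2 ^ d * rate d y"
          proof -
            have "(2::real) ^ d = 2 * 2 ^ (d - 1)" using d by (simp add: power_eq_if)
            then show ?thesis by (simp add: rate_def power_mult_distrib)
          qed
          finally have "real (G y (j + 1) choose d) - real (G y j choose d) \<le> \<delta> * 2 ^ d * rate d y"
            using binomial_increment_le[OF d GG] by linarith
          then have "\<theta> * (real (G y (j + 1) choose d) - real (G y j choose d)) \<le> \<theta> * (\<delta> * 2 ^ d * rate d y)"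
            by (intro mult_left_mono \<theta>0)
          also have "\<dots> \<le> (\<theta> + 1) * (\<delta> * 2 ^ d * rate d y)"
            using \<delta> rate_pos[of y d] y by (intro mult_right_mono) auto
          also have "(\<theta> + 1) * (\<delta> * 2 ^ d * rate d y) = \<epsilon> / 2 * rate d y"
          proof -
            have "\<epsilon> / (2 ^ (d + 1) * w) * 2 ^ d * w = \<epsilon> / 2" if "w \<noteq> 0" for w :: real
              using that by (simp add: power_add)
            from this[of "\<theta> + 1"] have "\<delta> * 2 ^ d * (\<theta> + 1) = \<epsilon> / 2" using \<theta>0 by (simp add: \<delta>_def)
            then show ?thesis by (metis mult.assoc mult.commute)
          qed
          finally show ?thesis .
        qed
        have b1: "real (G y j choose d) \<le> real (n choose d)" "real (n choose d) \<le> real (G y (j + 1) choose d)"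
          using card_mono[OF increasing_tuples_finite increasing_tuples_mono[OF Gn, of d]]
            card_mono[OF increasing_tuples_finite increasing_tuples_mono[OF nG, of d]]
          by (auto simp: card_increasing_tuples)
        have th: "\<theta> * real (G y j choose d) \<le> \<theta> * real (n choose d)" "\<theta> * real (n choose d) \<le> \<theta> * real (G y (j + 1) choose d)"
          using b1 \<theta>0 by (auto intro: mult_left_mono)
        have us: "U_stat d h X (G y j) \<omega> \<le> U_stat d h X n \<omega>" "U_stat d h X n \<omega> \<le> U_stat d h X (G y (j + 1)) \<omega>"
          using U_stat_mono[OF h0] Gn nG by auto
        have V: "?V k = U_stat d h X k \<omega> - \<theta> * real (k choose d)" for k
          by (simp add: U_centred_def \<theta>_def mult.commute)
        show "\<bar>?V n - ?V ?m\<bar> \<le> \<epsilon> * rate d y"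
        proof -
          define r where "r = \<epsilon> / 2 * rate d y"
          have r2: "\<epsilon> * rate d y = 2 * r" by (simp add: r_def)
          have "?V (G y j) - ?V ?m > - r" "?V (G y (j + 1)) - ?V ?m < r"
            using g1 unfolding r_def by (simp_all only: abs_less_iff) linarith+
          then show ?thesis
            using mesh th us unfolding r2 r_def[symmetric] V[of n] V[of "G y j"] V[of "G y (j + 1)"] right_diff_distrib
            by (intro abs_leI) linarith+
        qed
      qed
    qed
  qed
qed

lemma U_centred_diff:
  assumes "kernel d g" "kernel d h"
  shows "U_centred d (\<lambda>x. g x - h x) n \<omega> = U_centred d g n \<omega> - U_centred d h n \<omega>"
  unfolding U_centred_def U_mean_diff[OF assms] U_stat_def by (simp add: sum_subtractf right_diff_distrib)

text \<open>The kernel is the difference of its positive and negative parts, and the monotonicity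
  argument applies to each of them.\<close>

lemma whp_window_oscillation:
  assumes g: "kernel d g" and d: "1 \<le> d" and L: "0 \<le> L" and \<epsilon>: "0 < \<epsilon>"
  shows "whp (\<lambda>y \<omega>. \<forall>n\<in>window L y. \<bar>U_centred d g n \<omega> - U_centred d g (nat \<lfloor>y\<rfloor>) \<omega>\<bar> \<le> \<epsilon> * rate d y)"
proof -
  let ?p = "\<lambda>x. max 0 (g x)" and ?n = "\<lambda>x. max 0 ((-1) * g x)"
  have p: "kernel d ?p" and n: "kernel d ?n"
    by (rule kernel_max0[OF g], rule kernel_max0[OF kernel_cmult[OF g]])
  have "g = (\<lambda>x. ?p x - ?n x)" by (auto simp: max_def)
  then have V: "U_centred d g k \<omega> = U_centred d ?p k \<omega> - U_centred d ?n k \<omega>" for k \<omega>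
    using U_centred_diff[OF p n, of k \<omega>] by simp
  have "0 < \<epsilon> / 2" using \<epsilon> by simp
  from whp_conj[OF whp_window_oscillation_nonneg[OF p max.cobounded1 d L this] whp_window_oscillation_nonneg[OF n max.cobounded1 d L this]]
  show ?thesis
  proof (rule whp_mono, intro always_eventually allI ballI impI)
    fix y \<omega> k
    assume a: "(\<forall>k\<in>window L y. \<bar>U_centred d ?p k \<omega> - U_centred d ?p (nat \<lfloor>y\<rfloor>) \<omega>\<bar> \<le> \<epsilon> / 2 * rate d y) \<and>
        (\<forall>k\<in>window L y. \<bar>U_centred d ?n k \<omega> - U_centred d ?n (nat \<lfloor>y\<rfloor>) \<omega>\<bar> \<le> \<epsilon> / 2 * rate d y)"
      and k: "k \<in> window L y"
    have "\<bar>U_centred d ?p k \<omega> - U_centred d ?p (nat \<lfloor>y\<rfloor>) \<omega>\<bar> \<le> \<epsilon> / 2 * rate d y"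
      "\<bar>U_centred d ?n k \<omega> - U_centred d ?n (nat \<lfloor>y\<rfloor>) \<omega>\<bar> \<le> \<epsilon> / 2 * rate d y"
      using a k by blast+
    then show "\<bar>U_centred d g k \<omega> - U_centred d g (nat \<lfloor>y\<rfloor>) \<omega>\<bar> \<le> \<epsilon> * rate d y"
      unfolding V[of k] V[of "nat \<lfloor>y\<rfloor>"] by linarith
  qed
qed

end

text \<open>The half-width \<open>L\<close> of the window has to grow with the demanded confidence,
  so \<open>P\<close> is not a \<open>whp\<close> statement for a fixed \<open>L\<close>. As
  \<open>Q\<close> is one for every \<open>L\<close>, the choice can be made after
  \<open>\<eta>\<close> is given.\<close>

lemma (in prob_space) whp_localize:
  assumes P: "\<And>\<eta>. 0 < \<eta> \<Longrightarrow> \<exists>L\<ge>0. \<forall>\<^sub>F y in at_top. \<exists>A\<in>events. prob A \<le> \<eta> \<and> (\<forall>\<omega>\<in>space M - A. P L y \<omega>)"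
    and Q: "\<And>L. 0 \<le> L \<Longrightarrow> whp (Q L)"
    and R: "\<And>L. 0 \<le> L \<Longrightarrow> \<forall>\<^sub>F y in at_top. \<forall>\<omega>\<in>space M. P L y \<omega> \<longrightarrow> Q L y \<omega> \<longrightarrow> R y \<omega>"
  shows "whp R"
  unfolding whp_def
proof (intro allI impI)
  fix \<eta> :: real assume "0 < \<eta>"
  then have \<eta>2: "0 < \<eta> / 2" by simp
  obtain L where L: "0 \<le> L"
    and PL: "\<forall>\<^sub>F y in at_top. \<exists>A\<in>events. prob A \<le> \<eta> / 2 \<and> (\<forall>\<omega>\<in>space M - A. P L y \<omega>)"
    using P[OF \<eta>2] by blast
  have "\<forall>\<^sub>F y in at_top. \<exists>A\<in>events. prob A \<le> \<eta> / 2 \<and> (\<forall>\<omega>\<in>space M - A. Q L y \<omega>)"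
    using Q[OF L] \<eta>2 unfolding whp_def by blast
  with PL R[OF L] show "\<forall>\<^sub>F y in at_top. \<exists>A\<in>events. prob A \<le> \<eta> \<and> (\<forall>\<omega>\<in>space M - A. R y \<omega>)"
  proof eventually_elim
    case (elim y)
    then obtain A B where A: "A \<in> events" "prob A \<le> \<eta> / 2" "\<forall>\<omega>\<in>space M - A. P L y \<omega>"
      and B: "B \<in> events" "prob B \<le> \<eta> / 2" "\<forall>\<omega>\<in>space M - B. Q L y \<omega>" by blast
    have "prob (A \<union> B) \<le> \<eta>" using measure_Un_le[OF A(1) B(1)] A(2) B(2) by linarith
    then show ?case using A B elim(2) by (intro bexI[of _ "A \<union> B"]) auto
  qed
qed

lemma (in prob_space) whp_of_tendsto:
  assumes "\<forall>\<^sub>F y in at_top. B y \<in> events \<and> prob (B y) \<le> p y" "(p \<longlongrightarrow> 0) at_top"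
  shows "whp (\<lambda>y \<omega>. \<omega> \<notin> B y)"
  unfolding whp_def
proof (intro allI impI)
  fix \<eta> :: real assume "0 < \<eta>"
  from assms(1) order_tendstoD(2)[OF assms(2) this]
  show "\<forall>\<^sub>F y in at_top. \<exists>A\<in>events. prob A \<le> \<eta> \<and> (\<forall>\<omega>\<in>space M - A. \<omega> \<notin> B y)"
  proof eventually_elim
    case (elim y)
    then show ?case by (intro bexI[of _ "B y"]) auto
  qed
qed

section \<open>Both crossing times as up-crossings of the level\<close>

lemma U_sum_Suc: "U_sum f X (Suc n) \<omega> = U_sum f X n \<omega> + f (X (Suc n) \<omega>)"
  by (simp add: U_sum_def)

text \<open>The set is finite by \<open>late\<close> and contains 0 because the empty sum is 0. Its
  maximum is therefore the last index not above the level, and the next step is an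
  up-crossing.\<close>

lemma N_minus_crossing:
  assumes x: "0 \<le> x" and late: "\<And>n. b \<le> real n \<Longrightarrow> x < U_sum f X n \<omega>"
  shows "\<exists>p. N_minus f X x \<omega> = enat p \<and> real p < b \<and> U_sum f X p \<omega> \<le> x \<and> x < U_sum f X (Suc p) \<omega>"
proof -
  let ?S = "{n. U_sum f X n \<omega> \<le> x}"
  have sub: "real n < b" if "n \<in> ?S" for n using late[of n] that by force
  have fin: "finite ?S"
  proof (rule finite_subset)
    show "?S \<subseteq> {..nat \<lceil>b\<rceil>}"
    proof
      fix n assume "n \<in> ?S"
      then show "n \<in> {..nat \<lceil>b\<rceil>}" using sub[of n] unfolding atMost_iff by linarith
    qed
  qed simp
  have "0 \<in> ?S" using x by (simp add: U_sum_def)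
  then have p: "Max ?S \<in> ?S" using fin Max_in by blast
  have "Suc (Max ?S) \<notin> ?S"
  proof
    assume "Suc (Max ?S) \<in> ?S"
    from Max_ge[OF fin this] show False by simp
  qed
  moreover have "N_minus f X x \<omega> = enat (Max ?S)"
    unfolding N_minus_def
  proof (rule antisym)
    show "Sup (enat ` ?S) \<le> enat (Max ?S)" by (rule Sup_least) (use Max_ge[OF fin] in auto)
    show "enat (Max ?S) \<le> Sup (enat ` ?S)" using p by (intro Sup_upper imageI)
  qed
  ultimately show ?thesis using p sub[OF p] by (intro exI[of _ "Max ?S"]) auto
qed

text \<open>The set is nonempty by \<open>late\<close> and its least element is not 0 because the
  empty sum is 0. Hence it has a predecessor, from which the step is an up-crossing.\<close>

lemma N_plus_crossing:
  assumes x: "0 \<le> x" and late: "\<And>n. b \<le> real n \<Longrightarrow> x < U_sum f X n \<omega>"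
  shows "\<exists>q. N_plus f X x \<omega> = enat (Suc q) \<and> U_sum f X q \<omega> \<le> x \<and> x < U_sum f X (Suc q) \<omega>"
proof -
  let ?S = "{n. U_sum f X n \<omega> > x}"
  define l where "l = (LEAST n. n \<in> ?S)"
  have "nat \<lceil>b\<rceil> \<in> ?S" using late[of "nat \<lceil>b\<rceil>"] by (simp add: of_nat_ceiling)
  then have l: "l \<in> ?S" unfolding l_def by (rule LeastI)
  have "l \<noteq> 0"
  proof
    assume "l = 0"
    then show False using l x by (simp add: U_sum_def)
  qed
  then obtain q where q: "l = Suc q" by (cases l) auto
  have "q \<notin> ?S" using not_less_Least[of q "\<lambda>n. n \<in> ?S"] q unfolding l_def[symmetric] by simp
  moreover have "N_plus f X x \<omega> = enat l"
    unfolding N_plus_def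
  proof (rule antisym)
    show "Inf (enat ` ?S) \<le> enat l" using l by (intro Inf_lower imageI)
    show "enat l \<le> Inf (enat ` ?S)" unfolding l_def by (rule Inf_greatest) (auto intro: Least_le)
  qed
  ultimately show ?thesis using l q by (intro exI[of _ q]) auto
qed

text \<open>The expression is the gap between y^(k+1) and the tangent at n to the power function:
  nonnegative by convexity and quadratic in n - y. It obeys E(k+1) = y E(k) + (k+1) n^k (n-y)^2. The
  factor K^2 on the left avoids the exponent k - 1, which is negative for k = 0.\<close>

lemma tangent_power_bound:
  fixes n y K :: real
  assumes "0 \<le> n" "n \<le> K" "0 \<le> y" "y \<le> K"
  shows "0 \<le> y ^ Suc k - real (Suc k) * y * n ^ k + real k * n ^ Suc k"
    and "K\<^sup>2 * (y ^ Suc k - real (Suc k) * y * n ^ k + real k * n ^ Suc k) \<le> real (Suc k) ^ 2 * K ^ Suc k * (n - y)\<^sup>2"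
proof (induction k)
  case 0
  { case 1 then show ?case by simp }
  { case 2 show ?case using assms by simp }
next
  case (Suc k)
  let ?E = "\<lambda>k. y ^ Suc k - real (Suc k) * y * n ^ k + real k * n ^ Suc k"
  have rec: "?E (Suc k) = y * ?E k + real (Suc k) * n ^ k * (n - y)\<^sup>2"
    by (simp add: power2_eq_square algebra_simps)
  { case 1 show ?case unfolding rec
      by (rule add_nonneg_nonneg[OF mult_nonneg_nonneg[OF assms(3) Suc.IH(1)]]) (use assms in simp) }
  { case 2
    have "K\<^sup>2 * ?E (Suc k) = y * (K\<^sup>2 * ?E k) + real (Suc k) * (n ^ k * K\<^sup>2) * (n - y)\<^sup>2"
      unfolding rec by (simp add: algebra_simps)
    also have "\<dots> \<le> K * (real (Suc k) ^ 2 * K ^ Suc k * (n - y)\<^sup>2) + real (Suc k) * (K ^ k * K\<^sup>2) * (n - y)\<^sup>2"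
    proof (rule add_mono)
      show "y * (K\<^sup>2 * ?E k) \<le> K * (real (Suc k) ^ 2 * K ^ Suc k * (n - y)\<^sup>2)"
        using assms by (intro mult_mono Suc.IH(2) mult_nonneg_nonneg[OF _ Suc.IH(1)]) auto
      show "real (Suc k) * (n ^ k * K\<^sup>2) * (n - y)\<^sup>2 \<le> real (Suc k) * (K ^ k * K\<^sup>2) * (n - y)\<^sup>2"
        using assms by (intro mult_right_mono mult_left_mono power_mono) auto
    qed
    also have "\<dots> = (real (Suc k) ^ 2 + real (Suc k)) * (K ^ Suc (Suc k) * (n - y)\<^sup>2)"
      by (simp add: algebra_simps power2_eq_square)
    also have "\<dots> \<le> real (Suc (Suc k)) ^ 2 * (K ^ Suc (Suc k) * (n - y)\<^sup>2)"
    proof (rule mult_right_mono)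
      show "real (Suc k) ^ 2 + real (Suc k) \<le> real (Suc (Suc k)) ^ 2"
        by (simp add: power2_eq_square algebra_simps)
      have "0 \<le> K" using assms by linarith
      then show "0 \<le> K ^ Suc (Suc k) * (n - y)\<^sup>2" by (intro mult_nonneg_nonneg zero_le_power zero_le_power2)
    qed
    finally show ?case by (simp add: mult.assoc) }
qed

text \<open>The mean of \<open>U_stat\<close> at a random index \<open>n\<close> close to \<open>y\<close>: the terms linear in \<open>n - y\<close> cancel.\<close>

lemma binomial_tangent_bound:
  assumes d: "1 \<le> d" and L: "0 \<le> L"
  shows "\<exists>C\<ge>0. \<forall>\<^sub>F y in at_top. \<forall>n\<in>window L y.
    \<bar>(1 - real d) * real (n choose d) + y * real ((n - 1) choose (d - 1)) - y ^ d / fact d\<bar> \<le> C * y ^ (d - 1)"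
proof -
  obtain C where C: "0 \<le> C" "\<And>n k. 0 < n \<Longrightarrow> k \<le> n \<Longrightarrow>
     \<bar>real (k choose d) / real n ^ d - (real k / real n) ^ d / fact d\<bar> \<le> C / real n"
    using binomial_quotient_approx[of d] by blast
  obtain k where k: "d = Suc k" using d by (cases d) auto
  \<comment> \<open>The first summand bounds \<open>r * q\<close> by C (2y)^k times 3d, the second
    the tangent gap with \<open>K\<close> taken as 2y.\<close>
  define D where "D = C * 2 ^ k * (3 * real d) + (real d)\<^sup>2 * 2 ^ d * L\<^sup>2"
  show ?thesis
  proof (intro exI[of _ D] conjI)
    show "0 \<le> D" using C(1) by (simp add: D_def)
    show "\<forall>\<^sub>F y in at_top. \<forall>n\<in>window L y.
      \<bar>(1 - real d) * real (n choose d) + y * real ((n - 1) choose (d - 1)) - y ^ d / fact d\<bar> \<le> D * y ^ (d - 1)"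
      using eventually_ge_at_top[of 1] eventually_const_over_sqrt_le[of "1/2" L, simplified]
    proof eventually_elim
      case (elim y)
      show ?case
      proof
        fix n assume n: "n \<in> window L y"
        have sy: "0 < sqrt y" "sqrt y * sqrt y = y" using elim by auto
        have "2 * L \<le> sqrt y" using elim sy by (simp add: field_simps)
        then have "2 * L * sqrt y \<le> sqrt y * sqrt y" using sy by (intro mult_right_mono) auto
        then have "2 * (L * sqrt y) \<le> y" using sy by simp
        then have ny: "y \<le> 2 * real n" "real n \<le> 2 * y" using n elim by (auto simp: window_def abs_le_iff)
        then have n0: "0 < n" using elim by (cases n) auto
        \<comment> \<open>The error of replacing the binomial coefficient by its leading term; it is
          of order n^(d-1).\<close>
        define r where "r = real (n choose d) - real n ^ d / fact d"
        have r: "\<bar>r\<bar> \<le> C * real n ^ k"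
        proof -
          have "r = (real (n choose d) / real n ^ d - (real n / real n) ^ d / fact d) * real n ^ d"
            using n0 by (simp add: r_def field_simps)
          then have "\<bar>r\<bar> = \<bar>real (n choose d) / real n ^ d - (real n / real n) ^ d / fact d\<bar> * real n ^ d"
            by (simp only: abs_mult) simp
          also have "\<dots> \<le> C / real n * real n ^ d" using C(2)[OF n0 order_refl] by (intro mult_right_mono) auto
          also have "\<dots> = C * real n ^ k" using n0 by (simp add: k)
          finally show ?thesis .
        qed
        have "d * (n choose d) = n * ((n - 1) choose (d - 1))"
          using binomial_absorption[of k n] by (simp add: k)
        then have "real d * real (n choose d) = real n * real ((n - 1) choose (d - 1))"
          by (metis of_nat_mult)
        then have b: "real ((n - 1) choose (d - 1)) = real d * real (n choose d) / real n"
          using n0 by (simp add: field_simps)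
        \<comment> \<open>As (n-1 choose d-1) = (d/n) (n choose d) and 1 - d = -k, the first two
          terms merge into (n choose d) times \<open>q\<close>.\<close>
        define q where "q = real d * y / real n - real k"
        have "(1 - real d) * real (n choose d) + y * real ((n - 1) choose (d - 1)) - y ^ d / fact d
          = real (n choose d) * q - y ^ d / fact d"
          unfolding b q_def by (simp add: k algebra_simps)
        also have "\<dots> = r * q + (real n ^ d * q - y ^ d) / fact d"
          by (simp add: r_def algebra_simps diff_divide_distrib)
        finally have eq0: "(1 - real d) * real (n choose d) + y * real ((n - 1) choose (d - 1)) - y ^ d / fact d
          = r * q + (real n ^ d * q - y ^ d) / fact d" .
        \<comment> \<open>With the leading term n^d inserted, what is left is minus the tangent gap
          of \<open>tangent_power_bound\<close>, quadratic in n - y.\<close>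
        define E where "E = y ^ Suc k - real (Suc k) * y * real n ^ k + real k * real n ^ Suc k"
        have "real n ^ d * q - y ^ d = - E"
          using n0 by (simp add: E_def q_def k field_simps)
        then have eq: "(1 - real d) * real (n choose d) + y * real ((n - 1) choose (d - 1)) - y ^ d / fact d
          = r * q - E / fact d" unfolding eq0 by simp
        have "\<bar>r * q\<bar> \<le> (C * (2 * y) ^ k) * (3 * real d)"
          unfolding abs_mult
        proof (rule mult_mono)
          have "C * real n ^ k \<le> C * (2 * y) ^ k" using ny C(1) by (intro mult_left_mono power_mono) auto
          then show "\<bar>r\<bar> \<le> C * (2 * y) ^ k" using r by linarith
          have "y / real n \<le> 2" using ny n0 by (simp add: field_simps)
          then have "real d * (y / real n) \<le> real d * 2" by (intro mult_left_mono) auto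
          moreover have "0 \<le> real d * y / real n" using elim by simp
          ultimately show "\<bar>q\<bar> \<le> 3 * real d" unfolding q_def k by (simp add: abs_le_iff)
        qed (use C(1) elim in auto)
        also have "\<dots> = C * 2 ^ k * (3 * real d) * y ^ k" by (simp add: power_mult_distrib)
        finally have rq: "\<bar>r * q\<bar> \<le> C * 2 ^ k * (3 * real d) * y ^ k" .
        have E0: "0 \<le> E" unfolding E_def
          by (rule tangent_power_bound[of "real n" "2 * y" y k]) (use ny elim in auto)
        have "(2 * y)\<^sup>2 * E \<le> (real d)\<^sup>2 * (2 * y) ^ d * (real n - y)\<^sup>2"
          unfolding E_def k by (rule tangent_power_bound[of "real n" "2 * y" y k]) (use ny elim in auto)
        also have "\<dots> \<le> (real d)\<^sup>2 * (2 * y) ^ d * (L\<^sup>2 * y)"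
        proof (intro mult_left_mono)
          have "(real n - y)\<^sup>2 = \<bar>real n - y\<bar>\<^sup>2" by simp
          also have "\<dots> \<le> (L * sqrt y)\<^sup>2" using n by (intro power_mono) (auto simp: window_def)
          finally show "(real n - y)\<^sup>2 \<le> L\<^sup>2 * y" using elim by (simp add: power_mult_distrib)
        qed (use elim in auto)
        also have "\<dots> = (2 * y)\<^sup>2 * ((real d)\<^sup>2 * 2 ^ d * L\<^sup>2 * y ^ k / 4)"
          by (simp add: k power2_eq_square power_mult_distrib)
        finally have "E \<le> (real d)\<^sup>2 * 2 ^ d * L\<^sup>2 * y ^ k / 4"
          using elim by (simp add: mult_le_cancel_left_pos)
        also have "\<dots> \<le> (real d)\<^sup>2 * 2 ^ d * L\<^sup>2 * y ^ k" using elim by simp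
        finally have "E \<le> (real d)\<^sup>2 * 2 ^ d * L\<^sup>2 * y ^ k" .
        moreover have "E / fact d \<le> E" using E0 fact_ge_1[of d, where 'a=real] by (simp add: divide_le_eq mult_le_cancel_left1)
        moreover have "0 \<le> E / fact d" using E0 by simp
        ultimately have "\<bar>r * q - E / fact d\<bar> \<le> C * 2 ^ k * (3 * real d) * y ^ k + (real d)\<^sup>2 * 2 ^ d * L\<^sup>2 * y ^ k"
          using rq by linarith
        then show "\<bar>(1 - real d) * real (n choose d) + y * real ((n - 1) choose (d - 1)) - y ^ d / fact d\<bar> \<le> D * y ^ (d - 1)"
          unfolding eq D_def by (simp add: k distrib_right)
      qed
    qed
  qed
qed

section \<open>Measurability and location of the crossing times\<close>

context iid_sequence begin

text \<open>The supremum and infimum over a random set become ones over all \<open>n\<close>, with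
  the neutral values 0 and infinity outside the set; these are countable operations on measurable
  functions.\<close>

lemma N_measurable:
  assumes f[measurable]: "f \<in> borel_measurable S" and N: "N \<in> {N_minus f X, N_plus f X}"
  shows "N x \<in> measurable M (count_space UNIV)"
proof -
  have U[measurable]: "random_variable borel (U_sum f X n)" for n
    unfolding U_sum_def[abs_def] by measurable
  have "N_minus f X x = (\<lambda>\<omega>. SUP n. if U_sum f X n \<omega> \<le> x then enat n else 0)"
  proof (rule ext, rule antisym)
    fix \<omega>
    show "N_minus f X x \<omega> \<le> (SUP n. if U_sum f X n \<omega> \<le> x then enat n else 0)"
      unfolding N_minus_def
    proof (rule Sup_least, clarify)
      fix n assume "U_sum f X n \<omega> \<le> x"
      then show "enat n \<le> (SUP n. if U_sum f X n \<omega> \<le> x then enat n else 0)" by (intro SUP_upper2[of n]) auto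
    qed
    show "(SUP n. if U_sum f X n \<omega> \<le> x then enat n else 0) \<le> N_minus f X x \<omega>"
      unfolding N_minus_def by (intro SUP_least) (auto intro: Sup_upper)
  qed
  moreover have "N_plus f X x = (\<lambda>\<omega>. INF n. if U_sum f X n \<omega> > x then enat n else \<infinity>)"
  proof (rule ext, rule antisym)
    fix \<omega>
    show "(INF n. if U_sum f X n \<omega> > x then enat n else \<infinity>) \<le> N_plus f X x \<omega>"
      unfolding N_plus_def
    proof (rule Inf_greatest, clarify)
      fix n assume "U_sum f X n \<omega> > x"
      then show "(INF n. if U_sum f X n \<omega> > x then enat n else \<infinity>) \<le> enat n" by (intro INF_lower2[of n]) auto
    qed
    show "N_plus f X x \<omega> \<le> (INF n. if U_sum f X n \<omega> > x then enat n else \<infinity>)"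
      unfolding N_plus_def by (intro INF_greatest) (auto intro: Inf_lower)
  qed
  moreover have "(\<lambda>\<omega>. SUP n. if U_sum f X n \<omega> \<le> x then enat n else 0) \<in> measurable M (count_space UNIV)"
    "(\<lambda>\<omega>. INF n. if U_sum f X n \<omega> > x then enat n else \<infinity>) \<in> measurable M (count_space UNIV)"
    by measurable
  ultimately show ?thesis using N by auto
qed

lemma U_stat_random_index_rv:
  assumes "kernel d g" "f \<in> borel_measurable S" "N \<in> {N_minus f X, N_plus f X}"
  shows "random_variable borel (\<lambda>\<omega>. U_stat d g X (the_enat (N x \<omega>)) \<omega>)"
  by (rule measurable_compose_countable[OF U_stat_rv[OF assms(1)]])
     (rule measurable_compose[OF N_measurable[OF assms(2,3)]], simp)

text \<open>Both times are an endpoint of an up-crossing step, so the walk there misses the level by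
  at most the size of that step. The index \<open>n\<close> is the value of \<open>N\<close>, while
  \<open>k\<close> is the end of the step, which for \<open>N_minus\<close> is \<open>n + 1\<close>;
  the summand 1 in the half-width makes room for both.\<close>

lemma crossing_window:
  assumes f: "f \<in> borel_measurable S" and fsq: "integrable M (\<lambda>\<omega>. (f (X 0 \<omega>))\<^sup>2)"
    and \<mu>: "\<mu> = expectation (\<lambda>\<omega>. f (X 0 \<omega>))" "0 < \<mu>"
    and N: "N \<in> {N_minus f X, N_plus f X}" and \<eta>: "0 < \<eta>"
  shows "\<exists>L\<ge>0. \<forall>\<^sub>F y in at_top. \<exists>A\<in>events. prob A \<le> \<eta> \<and> (\<forall>\<omega>\<in>space M - A.
    \<exists>n k. N (\<mu> * y) \<omega> = enat n \<and> n \<in> window L y \<and> k \<in> window L y \<and> \<bar>U_sum f X n \<omega> - \<mu> * y\<bar> \<le> \<bar>f (X k \<omega>)\<bar>)"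
proof -
  let ?\<sigma> = "variance (\<lambda>\<omega>. f (X 0 \<omega>))"
  have \<sigma>: "0 \<le> ?\<sigma>" by simp
  \<comment> \<open>Makes the late-crossing bound 3 sigma / (mu^2 K) at most half of
    \<open>\<eta>\<close>; with K at least 1 the early bound is then smaller still.\<close>
  define K where "K = max 1 (6 * ?\<sigma> / (\<mu>\<^sup>2 * \<eta>))"
  have K: "1 \<le> K" by (simp add: K_def)
  have "6 * ?\<sigma> / (\<mu>\<^sup>2 * \<eta>) \<le> K" by (simp add: K_def)
  then have K3: "3 * ?\<sigma> / (\<mu>\<^sup>2 * K) \<le> \<eta> / 2" using \<mu>(2) \<eta> K by (simp add: field_simps)
  have "?\<sigma> / (\<mu>\<^sup>2 * K\<^sup>2) \<le> ?\<sigma> / (\<mu>\<^sup>2 * K)"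
    using K \<mu>(2) \<sigma> by (intro divide_left_mono mult_left_mono mult_pos_pos) (auto simp: power2_eq_square)
  also have "\<dots> \<le> 3 * ?\<sigma> / (\<mu>\<^sup>2 * K)" using K \<mu>(2) \<sigma> by (intro divide_right_mono) auto
  finally have K1: "?\<sigma> / (\<mu>\<^sup>2 * K\<^sup>2) \<le> \<eta> / 2" using K3 by linarith
  note [measurable] = U_sum_rv[OF f fsq \<mu>]
  show ?thesis
  proof (intro exI[of _ "K + 1"] conjI)
    show "0 \<le> K + 1" using K by simp
    show "\<forall>\<^sub>F y in at_top. \<exists>A\<in>events. prob A \<le> \<eta> \<and> (\<forall>\<omega>\<in>space M - A. \<exists>n k. N (\<mu> * y) \<omega> = enat n \<and>
      n \<in> window (K + 1) y \<and> k \<in> window (K + 1) y \<and> \<bar>U_sum f X n \<omega> - \<mu> * y\<bar> \<le> \<bar>f (X k \<omega>)\<bar>)"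
      using eventually_ge_at_top[of 1]
    proof eventually_elim
      case (elim y)
      define E1 where "E1 = {\<omega> \<in> space M. \<exists>n. real n \<le> y - K * sqrt y \<and> \<mu> * y < U_sum f X n \<omega>}"
      define E2 where "E2 = {\<omega> \<in> space M. \<exists>n. y + K * sqrt y \<le> real n \<and> U_sum f X n \<omega> \<le> \<mu> * y}"
      have ev: "E1 \<in> events" "E2 \<in> events" unfolding E1_def E2_def by measurable
      have "prob E1 \<le> \<eta> / 2" "prob E2 \<le> \<eta> / 2"
        using prob_early_crossing[OF f fsq \<mu> _ elim, of K] prob_late_crossing[OF f fsq \<mu> K elim] K K1 K3
        unfolding E1_def E2_def by linarith+
      then have pr: "prob (E1 \<union> E2) \<le> \<eta>" using measure_Un_le[OF ev] by linarith
      have sy: "1 \<le> sqrt y" using elim by simp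
      have "\<exists>n k. N (\<mu> * y) \<omega> = enat n \<and> n \<in> window (K + 1) y \<and> k \<in> window (K + 1) y \<and> \<bar>U_sum f X n \<omega> - \<mu> * y\<bar> \<le> \<bar>f (X k \<omega>)\<bar>"
        if \<omega>: "\<omega> \<in> space M - (E1 \<union> E2)" for \<omega>
      proof -
        have early: "U_sum f X n \<omega> \<le> \<mu> * y" if "real n \<le> y - K * sqrt y" for n
          using \<omega> that by (force simp: E1_def)
        have late: "\<mu> * y < U_sum f X n \<omega>" if "y + K * sqrt y \<le> real n" for n
          using \<omega> that by (force simp: E2_def)
        have my: "0 \<le> \<mu> * y" using \<mu>(2) elim by simp
        have crossing: "p \<in> window (K + 1) y \<and> Suc p \<in> window (K + 1) y \<and>
            \<bar>U_sum f X p \<omega> - \<mu> * y\<bar> \<le> \<bar>f (X (Suc p) \<omega>)\<bar> \<and> \<bar>U_sum f X (Suc p) \<omega> - \<mu> * y\<bar> \<le> \<bar>f (X (Suc p) \<omega>)\<bar>"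
          if p: "U_sum f X p \<omega> \<le> \<mu> * y" "\<mu> * y < U_sum f X (Suc p) \<omega>" for p
        proof -
          have "y - K * sqrt y < real (Suc p)" using early[of "Suc p"] p(2) by force
          moreover have "real p < y + K * sqrt y" using late[of p] p(1) by force
          ultimately have "p \<in> window (K + 1) y" "Suc p \<in> window (K + 1) y"
            using sy unfolding window_def mem_Collect_eq distrib_right mult_1_left of_nat_Suc by linarith+
          then show ?thesis using p unfolding U_sum_Suc by (intro conjI; linarith?)
        qed
        from N show ?thesis
        proof (elim insertE emptyE)
          assume Nm: "N = N_minus f X"
          from N_minus_crossing[OF my late] obtain p where "N_minus f X (\<mu> * y) \<omega> = enat p"
            "U_sum f X p \<omega> \<le> \<mu> * y" "\<mu> * y < U_sum f X (Suc p) \<omega>" by blast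
          then show ?thesis using crossing[of p] unfolding Nm by blast
        next
          assume Np: "N = N_plus f X"
          from N_plus_crossing[OF my late] obtain p where "N_plus f X (\<mu> * y) \<omega> = enat (Suc p)"
            "U_sum f X p \<omega> \<le> \<mu> * y" "\<mu> * y < U_sum f X (Suc p) \<omega>" by blast
          then show ?thesis using crossing[of p] unfolding Np by blast
        qed
      qed
      then show ?case using pr ev by (intro bexI[of _ "E1 \<union> E2"]) auto
    qed
  qed
qed

end

section \<open>The random index\<close>

lemma tendsto_nat_floor_quotient: "((\<lambda>y::real. real (nat \<lfloor>y\<rfloor>) / y) \<longlongrightarrow> 1) at_top"
proof (rule tendsto_sandwich[where f="\<lambda>y. 1 - 1 / y" and h="\<lambda>_. 1"])
  show "\<forall>\<^sub>F y in at_top. 1 - 1 / y \<le> real (nat \<lfloor>y\<rfloor>) / y"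
    using eventually_gt_at_top[of "0::real"]
  proof eventually_elim
    case (elim y)
    have "(y - 1) / y \<le> real (nat \<lfloor>y\<rfloor>) / y"
      using nat_floor_bounds[of y] elim by (intro divide_right_mono) auto
    then show ?case using elim by (simp add: diff_divide_distrib)
  qed
  show "\<forall>\<^sub>F y in at_top. real (nat \<lfloor>y\<rfloor>) / y \<le> 1"
    using eventually_gt_at_top[of "0::real"] by eventually_elim (use nat_floor_bounds in \<open>auto simp: divide_le_eq_1\<close>)
  show "((\<lambda>y::real. 1 - 1 / y) \<longlongrightarrow> 1) at_top" by real_asymp
qed simp

context iid_sequence begin

lemma tendsto_rate_floor: "((\<lambda>y. rate d (real (nat \<lfloor>y\<rfloor>)) / rate d y) \<longlongrightarrow> 1) at_top"
proof -
  have "((\<lambda>y. (real (nat \<lfloor>y\<rfloor>) / y) ^ (d - 1) * sqrt (real (nat \<lfloor>y\<rfloor>) / y)) \<longlongrightarrow> 1 ^ (d - 1) * sqrt 1) at_top"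
    by (intro tendsto_intros tendsto_nat_floor_quotient)
  then show ?thesis by (simp add: rate_def power_divide real_sqrt_divide)
qed

text \<open>The limit theorem at integers normalises by the floor of \<open>y\<close>, the
  random-index statement by \<open>y\<close>. The centred statistic has second moment of the order
  of the squared rate, and the quotient of the two rates tends to 1.\<close>

lemma whp_floor_rate:
  assumes g: "kernel d g" and d: "1 \<le> d" and \<epsilon>: "0 < \<epsilon>"
  shows "whp (\<lambda>y \<omega>. \<bar>U_centred d g (nat \<lfloor>y\<rfloor>) \<omega> / rate d y
    - U_centred d g (nat \<lfloor>y\<rfloor>) \<omega> / rate d (real (nat \<lfloor>y\<rfloor>))\<bar> \<le> \<epsilon>)"
proof -
  define q where "q = expectation (\<lambda>\<omega>. (g (\<lambda>k\<in>{1..d}. X k \<omega>) - U_mean M d g X)\<^sup>2)"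
  define s where "s y = 1 / rate d y - 1 / rate d (real (nat \<lfloor>y\<rfloor>))" for y
  let ?V = "\<lambda>y. U_centred d g (nat \<lfloor>y\<rfloor>)"
  define B where "B y = {\<omega> \<in> space M. \<epsilon> \<le> \<bar>s y * ?V y \<omega>\<bar>}" for y
  define p where "p = (\<lambda>y. (real d)\<^sup>2 * q / \<epsilon>\<^sup>2 * (rate d (real (nat \<lfloor>y\<rfloor>)) / rate d y - 1)\<^sup>2)"
  \<comment> \<open>There are no tuples at index 0, so the increment bound taken from 0 bounds the
    second moment itself.\<close>
  have V0: "U_centred d g 0 \<omega> = 0" for \<omega>
    using d by (cases d) (auto simp: U_centred_eq increasing_tuples_Suc_0)
  have "whp (\<lambda>y \<omega>. \<omega> \<notin> B y)"
  proof (rule whp_of_tendsto)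
    show "\<forall>\<^sub>F y in at_top. B y \<in> events \<and> prob (B y) \<le> p y"
      using eventually_ge_at_top[of 1]
    proof eventually_elim
      case (elim y)
      let ?m = "nat \<lfloor>y\<rfloor>"
      have m: "0 < real ?m" using nat_floor_bounds[of y] elim by linarith
      have rv: "random_variable borel (\<lambda>\<omega>. s y * ?V y \<omega>)" using U_centred_rv[OF g] by measurable
      have r2: "(rate d (real ?m))\<^sup>2 = real ?m * real ?m ^ (2 * d - 2)" using rate_square[of "real ?m" d] by simp
      have "prob (B y) \<le> (s y)\<^sup>2 * ((real d)\<^sup>2 * (rate d (real ?m))\<^sup>2 * q) / \<epsilon>\<^sup>2"
        unfolding B_def
      proof (rule chebyshev[OF rv _ \<epsilon>])
        show "integrable M (\<lambda>\<omega>. (s y * ?V y \<omega>)\<^sup>2)"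
          using U_centred_square_integrable[OF g, of ?m 0] by (simp add: V0 power_mult_distrib)
        have "expectation (\<lambda>\<omega>. (?V y \<omega>)\<^sup>2) \<le> (real d)\<^sup>2 * (rate d (real ?m))\<^sup>2 * q"
          using increment_second_moment[OF g d, of 0 ?m] by (simp add: V0 q_def r2 mult.assoc)
        then show "expectation (\<lambda>\<omega>. (s y * ?V y \<omega>)\<^sup>2) \<le> (s y)\<^sup>2 * ((real d)\<^sup>2 * (rate d (real ?m))\<^sup>2 * q)"
          by (simp add: power_mult_distrib mult_left_mono)
      qed
      also have "\<dots> = (real d)\<^sup>2 * q / \<epsilon>\<^sup>2 * (s y * rate d (real ?m))\<^sup>2"
        by (simp add: power_mult_distrib)
      also have "s y * rate d (real ?m) = rate d (real ?m) / rate d y - 1"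
        using rate_pos[OF m, of d] by (simp add: s_def left_diff_distrib)
      finally have "prob (B y) \<le> p y" unfolding p_def .
      then show ?case using rv by (auto simp: B_def)
    qed
    have "(p \<longlongrightarrow> (real d)\<^sup>2 * q / \<epsilon>\<^sup>2 * (1 - 1)\<^sup>2) at_top"
      unfolding p_def by (intro tendsto_mult_left tendsto_power tendsto_diff tendsto_rate_floor tendsto_const)
    then show "(p \<longlongrightarrow> 0) at_top" by simp
  qed
  then show ?thesis
    by (rule whp_mono) (intro always_eventually allI ballI impI, force simp: B_def s_def left_diff_distrib)
qed

definition shifted_kernel :: "nat \<Rightarrow> ('s \<Rightarrow> real) \<Rightarrow> ((nat \<Rightarrow> 's) \<Rightarrow> real) \<Rightarrow> real \<Rightarrow> (nat \<Rightarrow> 's) \<Rightarrow> real" where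
  "shifted_kernel d f g \<kappa> x = g x - \<kappa> * (\<Sum>l=1..d. f (x l))"

section \<open>The shifted kernel, its limiting variance and the random index\<close>

context
  fixes d :: nat and f :: "'s \<Rightarrow> real" and g :: "(nat \<Rightarrow> 's) \<Rightarrow> real" and \<mu> \<nu> \<kappa> :: real
  assumes d: "1 \<le> d" and f[measurable]: "f \<in> borel_measurable S" and g: "kernel d g"
    and fsq: "integrable M (\<lambda>\<omega>. (f (X 0 \<omega>))\<^sup>2)"
    and \<mu>: "\<mu> = expectation (\<lambda>\<omega>. f (X 0 \<omega>))" and \<nu>: "\<nu> = U_mean M d g X" and \<mu>_pos: "0 < \<mu>"
    and \<kappa>: "\<kappa> = \<nu> / \<mu>"
begin

lemma kernel_f_sum: "kernel d (\<lambda>x. \<Sum>l=1..d. f (x l))"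
  by (intro kernel_sum kernel_component f fsq) auto

lemma kernel_shifted: "kernel d (shifted_kernel d f g \<kappa>)"
  unfolding shifted_kernel_def[abs_def] by (intro kernel_diff g kernel_cmult kernel_f_sum)

lemma U_mean_shifted: "U_mean M d (shifted_kernel d f g \<kappa>) X = \<nu> - real d * \<nu>"
proof -
  have "U_mean M d (\<lambda>x. \<Sum>l=1..d. f (x l)) X = (\<Sum>l=1..d. \<mu>)"
    using U_mean_component[OF _ f] kernel_component[OF f fsq]
    by (subst U_mean_sum) (auto simp: \<mu>)
  then show ?thesis
    unfolding shifted_kernel_def[abs_def] U_mean_diff[OF g kernel_cmult[OF kernel_f_sum]] U_mean_cmult
    using \<mu>_pos by (simp add: \<kappa> \<nu>)
qed

text \<open>Every index occurs in the same number of tuples, so the subtracted part is an exact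
  multiple of \<open>U_sum\<close>; the middle term is the mean of the shifted statistic.\<close>

lemma U_stat_shifted:
  assumes "1 \<le> n"
  shows "U_stat d g X n \<omega> = U_centred d (shifted_kernel d f g \<kappa>) n \<omega> + (\<nu> - real d * \<nu>) * real (n choose d)
    + \<kappa> * real ((n - 1) choose (d - 1)) * U_sum f X n \<omega>"
proof -
  have "(\<Sum>I\<in>increasing_tuples d n. \<Sum>l=1..d. f (X (I l) \<omega>))
     = (\<Sum>m=1..n. (\<Sum>l=1..d. real (((m - 1) choose (l - 1)) * ((n - m) choose (d - l)))) * f (X m \<omega>))"
    unfolding sum_distrib_right by (rule sum_over_positions)
  also have "\<dots> = (\<Sum>m=1..n. real ((n - 1) choose (d - 1)) * f (X m \<omega>))"
  proof (intro sum.cong refl)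
    fix m assume "m \<in> {1..n}"
    then have "(\<Sum>l=1..d. ((m - 1) choose (l - 1)) * ((n - m) choose (d - l))) = (n - 1) choose (d - 1)"
      by (intro sum_binomial_position d) auto
    then have "(\<Sum>l=1..d. real (((m - 1) choose (l - 1)) * ((n - m) choose (d - l)))) = real ((n - 1) choose (d - 1))"
      by (metis of_nat_sum)
    then show "(\<Sum>l=1..d. real (((m - 1) choose (l - 1)) * ((n - m) choose (d - l)))) * f (X m \<omega>)
        = real ((n - 1) choose (d - 1)) * f (X m \<omega>)" by (simp only:)
  qed
  finally have F: "(\<Sum>I\<in>increasing_tuples d n. \<Sum>l=1..d. f (X (I l) \<omega>)) = real ((n - 1) choose (d - 1)) * U_sum f X n \<omega>"
    unfolding U_sum_def sum_distrib_left .
  have "U_stat d (shifted_kernel d f g \<kappa>) X n \<omega> = U_stat d g X n \<omega> - \<kappa> * (\<Sum>I\<in>increasing_tuples d n. \<Sum>l=1..d. f (X (I l) \<omega>))"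
    unfolding U_stat_def shifted_kernel_def sum_subtractf sum_distrib_left by simp
  then show ?thesis unfolding F U_centred_def U_mean_shifted by simp
qed

text \<open>Of the subtracted terms only the one at position \<open>a\<close> still depends on the
  fixed point; the others integrate to constants that the mean absorbs.\<close>

lemma U_proj_shifted:
  assumes a: "a \<in> {1..d}"
  shows "AE \<omega> in M. U_proj M d (shifted_kernel d f g \<kappa>) X a (X 0 \<omega>)
    = U_proj M d g X a (X 0 \<omega>) - \<kappa> * (f (X 0 \<omega>) - \<mu>)"
  using U_proj_AE_integrable[OF g a] AE_space
proof eventually_elim
  case (elim \<omega>)
  let ?y = "\<lambda>\<omega>'. \<lambda>k\<in>{1..d}. if k = a then X 0 \<omega> else X k \<omega>'"
  have fint: "integrable M (\<lambda>\<omega>'. f (?y \<omega>' l))"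
    and fexp: "expectation (\<lambda>\<omega>'. f (?y \<omega>' l)) = \<mu> + (if l = a then f (X 0 \<omega>) - \<mu> else 0)"
    if l: "l \<in> {1..d}" for l
  proof -
    have int: "integrable M (\<lambda>\<omega>'. f (X l \<omega>'))"
      by (rule square_integrable_imp_integrable[OF _ f_square_integrable[OF f fsq \<mu> \<mu>_pos]]) measurable
    have e: "expectation (\<lambda>\<omega>'. f (X l \<omega>')) = \<mu>" using expectation_X[OF f, of l] \<mu> by simp
    have "(\<lambda>\<omega>'. f (?y \<omega>' l)) = (if l = a then (\<lambda>_. f (X 0 \<omega>)) else (\<lambda>\<omega>'. f (X l \<omega>')))"
      using l by auto
    then show "integrable M (\<lambda>\<omega>'. f (?y \<omega>' l))"
      "expectation (\<lambda>\<omega>'. f (?y \<omega>' l)) = \<mu> + (if l = a then f (X 0 \<omega>) - \<mu> else 0)"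
      using int e by (auto simp: prob_space)
  qed
  have sint: "integrable M (\<lambda>\<omega>'. \<kappa> * (\<Sum>l=1..d. f (?y \<omega>' l)))"
    by (rule integrable_mult_right, rule Bochner_Integration.integrable_sum, rule fint)
  have "expectation (\<lambda>\<omega>'. \<Sum>l=1..d. f (?y \<omega>' l)) = (\<Sum>l=1..d. expectation (\<lambda>\<omega>'. f (?y \<omega>' l)))"
    by (rule Bochner_Integration.integral_sum) (rule fint)
  also have "\<dots> = (\<Sum>l=1..d. \<mu> + (if l = a then f (X 0 \<omega>) - \<mu> else 0))"
    by (rule sum.cong[OF refl fexp])
  also have "\<dots> = real d * \<mu> + (f (X 0 \<omega>) - \<mu>)" using a by (simp add: sum.distrib)
  finally have s: "expectation (\<lambda>\<omega>'. \<Sum>l=1..d. f (?y \<omega>' l)) = real d * \<mu> + (f (X 0 \<omega>) - \<mu>)" .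
  have "expectation (\<lambda>\<omega>'. shifted_kernel d f g \<kappa> (?y \<omega>'))
     = expectation (\<lambda>\<omega>'. g (?y \<omega>')) - expectation (\<lambda>\<omega>'. \<kappa> * (\<Sum>l=1..d. f (?y \<omega>' l)))"
    unfolding shifted_kernel_def by (rule Bochner_Integration.integral_diff[OF elim(1) sint])
  also have "expectation (\<lambda>\<omega>'. \<kappa> * (\<Sum>l=1..d. f (?y \<omega>' l))) = \<kappa> * (real d * \<mu> + (f (X 0 \<omega>) - \<mu>))"
    unfolding s[symmetric] by (rule Bochner_Integration.integral_mult_right_zero)
  finally have e: "expectation (\<lambda>\<omega>'. shifted_kernel d f g \<kappa> (?y \<omega>'))
     = expectation (\<lambda>\<omega>'. g (?y \<omega>')) - \<kappa> * (real d * \<mu> + (f (X 0 \<omega>) - \<mu>))" .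
  have km: "\<kappa> * (real d * \<mu>) = real d * \<nu>" using \<mu>_pos by (simp add: \<kappa>)
  show ?case
    unfolding U_proj_def e U_mean_shifted \<nu>[symmetric] distrib_left km by (rule trans[OF _ refl]) argo
qed

lemma bern_form_shifted_expectation:
  "expectation (\<lambda>\<omega>. bern_form d (\<lambda>l. U_proj M d (shifted_kernel d f g \<kappa>) X l (X 0 \<omega>)))
    = (\<Sum>i=1..d. \<Sum>j=1..d. bern_gram d i j * covariance M (\<lambda>\<omega>. U_proj M d g X i (X 0 \<omega>)) (\<lambda>\<omega>. U_proj M d g X j (X 0 \<omega>)))
      - 2 * \<kappa> / (fact (d - 1) * fact d) * (\<Sum>i=1..d. covariance M (\<lambda>\<omega>. f (X 0 \<omega>)) (\<lambda>\<omega>. U_proj M d g X i (X 0 \<omega>)))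
      + \<kappa>\<^sup>2 / (fact (d - 1))\<^sup>2 * variance (\<lambda>\<omega>. f (X 0 \<omega>))"
proof -
  let ?h = "\<lambda>i \<omega>. U_proj M d g X i (X 0 \<omega>)" and ?p = "\<lambda>i \<omega>. U_proj M d (shifted_kernel d f g \<kappa>) X i (X 0 \<omega>)"
  \<comment> \<open>Projections are numbered from 1, so index 0 is free for the centred
    \<open>f\<close>, as \<open>bern_gram_shift\<close> expects.\<close>
  define F where "F i = (if i = 0 then (\<lambda>\<omega>. f (X 0 \<omega>) - \<mu>) else ?h i)" for i
  define C where "C i j = expectation (\<lambda>\<omega>. F i \<omega> * F j \<omega>)" for i j
  have Fm: "random_variable borel (F i)" for i
    unfolding F_def using U_proj_rv[OF g] by simp
  have Fsq: "integrable M (\<lambda>\<omega>. (F i \<omega>)\<^sup>2)" if "i \<le> d" for i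
  proof (cases "i = 0")
    case True
    then show ?thesis using centred_f(3)[OF f fsq \<mu> \<mu>_pos] by (simp add: F_def)
  next
    case False
    then have "i \<in> {1..d}" using that by auto
    then show ?thesis using U_proj_square_integrable[OF g] False by (simp add: F_def)
  qed
  have int: "integrable M (\<lambda>\<omega>. F i \<omega> * F j \<omega>)" if "i \<le> d" "j \<le> d" for i j
    by (rule square_integrable_mult[OF Fm Fm Fsq[OF that(1)] Fsq[OF that(2)]])
  have mean: "expectation (?h i) = 0" if "i \<in> {1..d}" for i by (rule expectation_U_proj[OF g that])
  have C: "C i j = covariance M (?h i) (?h j)" if "i \<in> {1..d}" "j \<in> {1..d}" for i j
    using that by (simp add: C_def F_def covariance_def mean)
  have C0: "C 0 i = covariance M (\<lambda>\<omega>. f (X 0 \<omega>)) (?h i)" if "i \<in> {1..d}" for i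
    using that by (simp add: C_def F_def covariance_def mean \<mu>)
  have C00: "C 0 0 = variance (\<lambda>\<omega>. f (X 0 \<omega>))"
    by (simp add: C_def F_def \<mu> power2_eq_square)
  have pp: "expectation (\<lambda>\<omega>. ?p i \<omega> * ?p j \<omega>) = C i j - \<kappa> * C 0 i - \<kappa> * C 0 j + \<kappa>\<^sup>2 * C 0 0"
    if i: "i \<in> {1..d}" and j: "j \<in> {1..d}" for i j
  proof -
    have "expectation (\<lambda>\<omega>. ?p i \<omega> * ?p j \<omega>) = expectation (\<lambda>\<omega>. (F i \<omega> - \<kappa> * F 0 \<omega>) * (F j \<omega> - \<kappa> * F 0 \<omega>))"
    proof (rule integral_cong_AE)
      show "(\<lambda>\<omega>. ?p i \<omega> * ?p j \<omega>) \<in> borel_measurable M"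
        using U_proj_rv[OF kernel_shifted] by measurable
      show "(\<lambda>\<omega>. (F i \<omega> - \<kappa> * F 0 \<omega>) * (F j \<omega> - \<kappa> * F 0 \<omega>)) \<in> borel_measurable M"
        using Fm by measurable
      show "AE \<omega> in M. ?p i \<omega> * ?p j \<omega> = (F i \<omega> - \<kappa> * F 0 \<omega>) * (F j \<omega> - \<kappa> * F 0 \<omega>)"
        using U_proj_shifted[OF i] U_proj_shifted[OF j] by eventually_elim (use i j in \<open>simp add: F_def\<close>)
    qed
    also have "\<dots> = expectation (\<lambda>\<omega>. F i \<omega> * F j \<omega> - \<kappa> * (F 0 \<omega> * F i \<omega>) - \<kappa> * (F 0 \<omega> * F j \<omega>) + \<kappa>\<^sup>2 * (F 0 \<omega> * F 0 \<omega>))"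
      by (intro Bochner_Integration.integral_cong refl) (simp add: algebra_simps power2_eq_square)
    also have "\<dots> = C i j - \<kappa> * C 0 i - \<kappa> * C 0 j + \<kappa>\<^sup>2 * C 0 0"
      using i j int[of i j] int[of 0 i] int[of 0 j] int[of 0 0] unfolding C_def by simp
    finally show ?thesis .
  qed
  have "expectation (\<lambda>\<omega>. bern_form d (\<lambda>l. ?p l \<omega>)) = (\<Sum>i=1..d. \<Sum>j=1..d. bern_gram d i j * expectation (\<lambda>\<omega>. ?p i \<omega> * ?p j \<omega>))"
    unfolding bern_form_def
    by (rule integral_double_sum)
       (intro square_integrable_mult U_proj_rv U_proj_square_integrable kernel_shifted)
  also have "\<dots> = (\<Sum>i=1..d. \<Sum>j=1..d. bern_gram d i j * (C i j - \<kappa> * C 0 i - \<kappa> * C 0 j + \<kappa>\<^sup>2 * C 0 0))"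
    by (intro sum.cong refl arg_cong2[where f="(*)"] pp)
  also have "\<dots> = (\<Sum>i=1..d. \<Sum>j=1..d. bern_gram d i j * C i j)
      - 2 * \<kappa> / (fact (d - 1) * fact d) * (\<Sum>i=1..d. C 0 i) + \<kappa>\<^sup>2 / (fact (d - 1))\<^sup>2 * C 0 0"
    by (rule bern_gram_shift[OF d]) (simp add: C_def mult.commute)
  also have "(\<Sum>i=1..d. \<Sum>j=1..d. bern_gram d i j * C i j) = (\<Sum>i=1..d. \<Sum>j=1..d. bern_gram d i j * covariance M (?h i) (?h j))"
    by (intro sum.cong refl arg_cong2[where f="(*)"] C)
  also have "(\<Sum>i=1..d. C 0 i) = (\<Sum>i=1..d. covariance M (\<lambda>\<omega>. f (X 0 \<omega>)) (?h i))"
    by (intro sum.cong refl C0)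
  finally show ?thesis unfolding C00 .
qed

text \<open>Identifies the explicit formula with the variance delivered by the limit theorem. The
  squared factor accounts for the change of scale from y to x; both the nonnegativity and the
  degenerate case are read off from this form.\<close>

lemma gamma_sq_eq:
  "gamma_sq M d f g X = (1 / (\<mu> ^ (d - 1) * sqrt \<mu>))\<^sup>2 *
     expectation (\<lambda>\<omega>. bern_form d (\<lambda>l. U_proj M d (shifted_kernel d f g \<kappa>) X l (X 0 \<omega>)))"
proof -
  obtain k where k: "d = Suc k" using d by (cases d) auto
  have m0: "\<mu> \<noteq> 0" using \<mu>_pos by simp
  have p1: "\<mu> powi (1 - 2 * int d) = 1 / \<mu> ^ (2 * k + 1)"
  proof -
    have "1 - 2 * int d = - int (2 * k + 1)" by (simp add: k)
    then show ?thesis by (simp only: power_int_minus power_int_of_nat inverse_eq_divide)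
  qed
  have p2: "\<mu> powi (- 2 * int d) = 1 / \<mu> ^ (2 * k + 2)"
  proof -
    have "- 2 * int d = - int (2 * k + 2)" by (simp add: k)
    then show ?thesis by (simp only: power_int_minus power_int_of_nat inverse_eq_divide)
  qed
  have p3: "\<mu> powi (- 2 * int d - 1) = 1 / \<mu> ^ (2 * k + 3)"
  proof -
    have "- 2 * int d - 1 = - int (2 * k + 3)" by (simp add: k)
    then show ?thesis by (simp only: power_int_minus power_int_of_nat inverse_eq_divide)
  qed
  have c2: "(1 / (\<mu> ^ (d - 1) * sqrt \<mu>))\<^sup>2 = 1 / \<mu> ^ (2 * k + 1)"
    using \<mu>_pos by (simp add: k power_divide power_mult_distrib power_mult[symmetric] mult.commute power_add)
  have q2: "1 / \<mu> ^ (2 * k + 2) * \<nu> / (fact (d - 1) * fact d) = 1 / \<mu> ^ (2 * k + 1) * (\<kappa> / (fact (d - 1) * fact d))"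
    using m0 by (simp add: \<kappa> power_add)
  have q3: "1 / \<mu> ^ (2 * k + 3) * \<nu>\<^sup>2 / (fact (d - 1))\<^sup>2 = 1 / \<mu> ^ (2 * k + 1) * (\<kappa>\<^sup>2 / (fact (d - 1))\<^sup>2)"
    using m0 by (simp add: \<kappa> power_divide power_add power2_eq_square power3_eq_cube)
  show ?thesis
    unfolding gamma_sq_def Let_def \<mu>[symmetric] \<nu>[symmetric] p1 p2 p3 q2 q3 c2
      bern_form_shifted_expectation bern_gram_def[symmetric]
    by (simp add: right_diff_distrib distrib_left mult.assoc)
qed

lemma bern_form_shifted_integrable:
  "integrable M (\<lambda>\<omega>. bern_form d (\<lambda>l. U_proj M d (shifted_kernel d f g \<kappa>) X l (X 0 \<omega>)))"
  unfolding bern_form_def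
  by (intro Bochner_Integration.integrable_sum integrable_mult_right square_integrable_mult
      U_proj_rv U_proj_square_integrable kernel_shifted)

lemma gamma_sq_nonneg: "0 \<le> gamma_sq M d f g X"
  unfolding gamma_sq_eq by (intro mult_nonneg_nonneg Bochner_Integration.integral_nonneg bern_form_nonneg) auto

text \<open>An expectation of nonnegative forms is 0 only if almost every form is, and definiteness
  of the Bernstein form then kills each shifted projection; multiplying by mu gives the stated
  equation.\<close>

lemma gamma_sq_eq_0_iff:
  "gamma_sq M d f g X = 0 \<longleftrightarrow>
    (\<forall>i\<in>{1..d}. AE \<omega> in M. \<mu> * U_proj M d g X i (X 0 \<omega>) = \<nu> * (f (X 0 \<omega>) - \<mu>))"
proof -
  let ?p = "\<lambda>l \<omega>. U_proj M d (shifted_kernel d f g \<kappa>) X l (X 0 \<omega>)"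
  have "gamma_sq M d f g X = 0 \<longleftrightarrow> expectation (\<lambda>\<omega>. bern_form d (\<lambda>l. ?p l \<omega>)) = 0"
    unfolding gamma_sq_eq using \<mu>_pos by simp
  also have "\<dots> \<longleftrightarrow> (AE \<omega> in M. bern_form d (\<lambda>l. ?p l \<omega>) = 0)"
    by (intro integral_nonneg_eq_0_iff_AE bern_form_shifted_integrable AE_I2 bern_form_nonneg)
  also have "\<dots> \<longleftrightarrow> (AE \<omega> in M. \<forall>i\<in>{1..d}. ?p i \<omega> = 0)"
    unfolding bern_form_eq_0_iff ..
  also have "\<dots> \<longleftrightarrow> (\<forall>i\<in>{1..d}. AE \<omega> in M. ?p i \<omega> = 0)"
    by (rule AE_ball_countable) simp
  also have "\<dots> \<longleftrightarrow> (\<forall>i\<in>{1..d}. AE \<omega> in M. \<mu> * U_proj M d g X i (X 0 \<omega>) = \<nu> * (f (X 0 \<omega>) - \<mu>))"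
  proof (rule ball_cong[OF refl])
    fix i assume "i \<in> {1..d}"
    from U_proj_shifted[OF this]
    have "AE \<omega> in M. ?p i \<omega> = 0 \<longleftrightarrow> \<mu> * U_proj M d g X i (X 0 \<omega>) = \<nu> * (f (X 0 \<omega>) - \<mu>)"
    proof eventually_elim
      case (elim \<omega>)
      show ?case unfolding elim using \<mu>_pos by (simp add: \<kappa> field_simps)
    qed
    then show "(AE \<omega> in M. ?p i \<omega> = 0) \<longleftrightarrow> (AE \<omega> in M. \<mu> * U_proj M d g X i (X 0 \<omega>) = \<nu> * (f (X 0 \<omega>) - \<mu>))"
      by (rule eventually_subst)
  qed
  finally show ?thesis .
qed

lemma whp_random_index_error:
  assumes N: "N \<in> {N_minus f X, N_plus f X}" and \<epsilon>: "0 < \<epsilon>"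
  shows "whp (\<lambda>y \<omega>. \<bar>(U_stat d g X (the_enat (N (\<mu> * y) \<omega>)) \<omega> - \<nu> * y ^ d / fact d) / rate d y
    - U_centred d (shifted_kernel d f g \<kappa>) (nat \<lfloor>y\<rfloor>) \<omega> / rate d (real (nat \<lfloor>y\<rfloor>))\<bar> \<le> \<epsilon>)"
proof -
  let ?V = "U_centred d (shifted_kernel d f g \<kappa>)"
  \<comment> \<open>Compensates the factor \<open>\<bar>\<kappa>\<bar>\<close> (2y)^(d-1) in front
    of the overshoot, so that this term takes a quarter of \<open>\<epsilon>\<close>. The summand 1
    keeps the denominator positive when \<open>\<kappa>\<close> is 0.\<close>
  define \<epsilon>' where "\<epsilon>' = \<epsilon> / (4 * (\<bar>\<kappa>\<bar> * 2 ^ (d - 1) + 1))"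
  have den: "0 < 4 * (\<bar>\<kappa>\<bar> * 2 ^ (d - 1) + 1)" by (intro mult_pos_pos add_nonneg_pos) auto
  have \<epsilon>': "0 < \<epsilon>'" unfolding \<epsilon>'_def using \<epsilon> den by (rule divide_pos_pos)
  have \<epsilon>4: "0 < \<epsilon> / 4" using \<epsilon> by simp
  define P where "P L y \<omega> \<longleftrightarrow> (\<exists>n k. N (\<mu> * y) \<omega> = enat n \<and> n \<in> window L y \<and> k \<in> window L y \<and>
      \<bar>U_sum f X n \<omega> - \<mu> * y\<bar> \<le> \<bar>f (X k \<omega>)\<bar>)" for L y \<omega>
  define Q where "Q L y \<omega> \<longleftrightarrow> ((\<forall>n\<in>window L y. \<bar>?V n \<omega> - ?V (nat \<lfloor>y\<rfloor>) \<omega>\<bar> \<le> \<epsilon> / 4 * rate d y) \<and>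
      (\<forall>k\<in>window L y. \<bar>f (X k \<omega>)\<bar> \<le> \<epsilon>' * sqrt y)) \<and>
      \<bar>?V (nat \<lfloor>y\<rfloor>) \<omega> / rate d y - ?V (nat \<lfloor>y\<rfloor>) \<omega> / rate d (real (nat \<lfloor>y\<rfloor>))\<bar> \<le> \<epsilon> / 4" for L y \<omega>
  show ?thesis
  proof (rule whp_localize[where P=P and Q=Q])
    show "\<exists>L\<ge>0. \<forall>\<^sub>F y in at_top. \<exists>A\<in>events. prob A \<le> \<eta> \<and> (\<forall>\<omega>\<in>space M - A. P L y \<omega>)" if "0 < \<eta>" for \<eta>
      unfolding P_def by (rule crossing_window[OF f fsq \<mu> \<mu>_pos N that])
    show "whp (Q L)" if "0 \<le> L" for L
      unfolding Q_def[abs_def]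
      by (intro whp_conj whp_window_oscillation whp_window_small whp_floor_rate kernel_shifted d f fsq that \<epsilon>' \<epsilon>4)
    fix L :: real assume L: "0 \<le> L"
    obtain C where C: "0 \<le> C" "\<forall>\<^sub>F y in at_top. \<forall>n\<in>window L y.
      \<bar>(1 - real d) * real (n choose d) + y * real ((n - 1) choose (d - 1)) - y ^ d / fact d\<bar> \<le> C * y ^ (d - 1)"
      using binomial_tangent_bound[OF d L] by blast
    have half: "0 < (1 / 2 :: real)" by simp
    show "\<forall>\<^sub>F y in at_top. \<forall>\<omega>\<in>space M. P L y \<omega> \<longrightarrow> Q L y \<omega> \<longrightarrow>
      \<bar>(U_stat d g X (the_enat (N (\<mu> * y) \<omega>)) \<omega> - \<nu> * y ^ d / fact d) / rate d y
      - ?V (nat \<lfloor>y\<rfloor>) \<omega> / rate d (real (nat \<lfloor>y\<rfloor>))\<bar> \<le> \<epsilon>"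
      using eventually_ge_at_top[of 1] eventually_const_over_sqrt_le[OF half, of L]
        eventually_const_over_sqrt_le[OF \<epsilon>4, of "\<bar>\<nu>\<bar> * C"] C(2)
    proof eventually_elim
      case (elim y)
      show ?case
      proof (intro ballI impI)
        fix \<omega> assume "\<omega> \<in> space M" and PL: "P L y \<omega>" and QL: "Q L y \<omega>"
        let ?m = "nat \<lfloor>y\<rfloor>" and ?s = "rate d y"
        obtain n k where nk: "N (\<mu> * y) \<omega> = enat n" "n \<in> window L y" "k \<in> window L y"
          "\<bar>U_sum f X n \<omega> - \<mu> * y\<bar> \<le> \<bar>f (X k \<omega>)\<bar>" using PL unfolding P_def by blast
        have sy: "0 < sqrt y" "sqrt y * sqrt y = y" using elim(1) by auto
        have "2 * L \<le> sqrt y" using elim(2) sy by (simp add: field_simps)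
        then have "2 * L * sqrt y \<le> sqrt y * sqrt y" using sy by (intro mult_right_mono) auto
        then have Ly: "2 * (L * sqrt y) \<le> y" using sy by simp
        then have ny: "y \<le> 2 * real n" "real n \<le> 2 * y" using nk(2) elim(1) by (auto simp: window_def abs_le_iff)
        then have n1: "1 \<le> n" using elim(1) by (cases n) auto
        have s: "0 < ?s" using elim(1) by (intro rate_pos) simp
        define b where "b = real ((n - 1) choose (d - 1))"
        define E where "E = (1 - real d) * real (n choose d) + y * b - y ^ d / fact d"
        have b: "0 \<le> b" "b \<le> (2 * y) ^ (d - 1)"
        proof -
          have "b / real n ^ (d - 1) \<le> 1" unfolding b_def by (rule binomial_quotient_bounds) (use n1 in auto)
          then have "b \<le> real n ^ (d - 1)" using n1 by (simp add: divide_le_eq)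
          also have "\<dots> \<le> (2 * y) ^ (d - 1)" using ny by (intro power_mono) auto
          finally show "b \<le> (2 * y) ^ (d - 1)" .
        qed (simp add: b_def)
        have km: "\<kappa> * \<mu> = \<nu>" using \<mu>_pos by (simp add: \<kappa>)
        \<comment> \<open>The terms are the oscillation within the window, the statistic at the
          floor of y, the overshoot, and the deterministic tangent error.\<close>
        have num: "U_stat d g X n \<omega> - \<nu> * y ^ d / fact d
          = (?V n \<omega> - ?V ?m \<omega>) + ?V ?m \<omega> + \<kappa> * b * (U_sum f X n \<omega> - \<mu> * y) + \<nu> * E"
          unfolding U_stat_shifted[OF n1] b_def[symmetric] E_def km[symmetric] by (simp add: algebra_simps)
        have decomp: "(U_stat d g X n \<omega> - \<nu> * y ^ d / fact d) / ?s - ?V ?m \<omega> / rate d (real ?m)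
          = (?V n \<omega> - ?V ?m \<omega>) / ?s + (?V ?m \<omega> / ?s - ?V ?m \<omega> / rate d (real ?m))
            + \<kappa> * b * (U_sum f X n \<omega> - \<mu> * y) / ?s + \<nu> * E / ?s"
          unfolding num add_divide_distrib by linarith
        have t1: "\<bar>(?V n \<omega> - ?V ?m \<omega>) / ?s\<bar> \<le> \<epsilon> / 4"
        proof -
          have "\<bar>?V n \<omega> - ?V ?m \<omega>\<bar> \<le> \<epsilon> / 4 * ?s" using QL nk(2) unfolding Q_def by blast
          then have "\<bar>?V n \<omega> - ?V ?m \<omega>\<bar> / ?s \<le> \<epsilon> / 4" using s by (subst pos_divide_le_eq)
          then show ?thesis using s by (simp add: abs_divide)
        qed
        have t2: "\<bar>?V ?m \<omega> / ?s - ?V ?m \<omega> / rate d (real ?m)\<bar> \<le> \<epsilon> / 4"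
          using QL unfolding Q_def by blast
        have t3: "\<bar>\<kappa> * b * (U_sum f X n \<omega> - \<mu> * y) / ?s\<bar> \<le> \<epsilon> / 4"
        proof -
          have "\<bar>f (X k \<omega>)\<bar> \<le> \<epsilon>' * sqrt y" using QL nk(3) unfolding Q_def by blast
          then have u: "\<bar>U_sum f X n \<omega> - \<mu> * y\<bar> \<le> \<epsilon>' * sqrt y" using nk(4) by linarith
          have "\<bar>\<kappa> * b * (U_sum f X n \<omega> - \<mu> * y)\<bar> = \<bar>\<kappa>\<bar> * (b * \<bar>U_sum f X n \<omega> - \<mu> * y\<bar>)"
            using b by (simp add: abs_mult)
          also have "\<dots> \<le> \<bar>\<kappa>\<bar> * ((2 * y) ^ (d - 1) * (\<epsilon>' * sqrt y))"
            using b u elim(1) by (intro mult_left_mono mult_mono) auto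
          also have "\<dots> = (\<bar>\<kappa>\<bar> * 2 ^ (d - 1)) * \<epsilon>' * ?s"
            by (simp add: rate_def power_mult_distrib)
          also have "\<dots> \<le> (\<bar>\<kappa>\<bar> * 2 ^ (d - 1) + 1) * \<epsilon>' * ?s"
            using s \<epsilon>' by (intro mult_right_mono) auto
          also have "(\<bar>\<kappa>\<bar> * 2 ^ (d - 1) + 1) * \<epsilon>' = \<epsilon> / 4"
          proof -
            have cancel: "w * (\<epsilon> / (4 * w)) = \<epsilon> / 4" if "w \<noteq> 0" for w using that by simp
            have "0 < \<bar>\<kappa>\<bar> * 2 ^ (d - 1) + 1" by (intro add_nonneg_pos) auto
            from cancel[OF less_imp_neq[OF this, symmetric]] show ?thesis unfolding \<epsilon>'_def .
          qed
          finally have "\<bar>\<kappa> * b * (U_sum f X n \<omega> - \<mu> * y)\<bar> / ?s \<le> \<epsilon> / 4" using s by (subst pos_divide_le_eq)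
          then show ?thesis using s by (simp only: abs_divide abs_of_pos)
        qed
        have t4: "\<bar>\<nu> * E / ?s\<bar> \<le> \<epsilon> / 4"
        proof -
          have "\<bar>E\<bar> \<le> C * y ^ (d - 1)" using elim(4) nk(2) unfolding E_def b_def by blast
          then have "\<bar>\<nu>\<bar> * \<bar>E\<bar> \<le> \<bar>\<nu>\<bar> * (C * y ^ (d - 1))" by (intro mult_left_mono) auto
          then have "\<bar>\<nu> * E\<bar> / ?s \<le> \<bar>\<nu>\<bar> * (C * y ^ (d - 1)) / ?s"
            using s by (intro divide_right_mono) (auto simp: abs_mult)
          also have "\<dots> = \<bar>\<nu>\<bar> * C / sqrt y" using elim(1) by (simp add: rate_def)
          also have "\<dots> \<le> \<epsilon> / 4" by (rule elim(3))
          finally show ?thesis using s by (simp only: abs_divide abs_of_pos)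
        qed
        show "\<bar>(U_stat d g X (the_enat (N (\<mu> * y) \<omega>)) \<omega> - \<nu> * y ^ d / fact d) / ?s
          - ?V ?m \<omega> / rate d (real ?m)\<bar> \<le> \<epsilon>"
        proof -
          have four: "\<bar>p + q + r + u\<bar> \<le> \<epsilon>"
            if "\<bar>p\<bar> \<le> \<epsilon> / 4" "\<bar>q\<bar> \<le> \<epsilon> / 4" "\<bar>r\<bar> \<le> \<epsilon> / 4" "\<bar>u\<bar> \<le> \<epsilon> / 4" for p q r u
            using that by linarith
          show ?thesis unfolding nk(1) the_enat.simps decomp by (rule four[OF t1 t2 t3 t4])
        qed
      qed
    qed
  qed
qed

lemma weak_conv_random_index:
  assumes N: "N \<in> {N_minus f X, N_plus f X}"
  shows "weak_conv_along
    (\<lambda>x. distr M borel (\<lambda>\<omega>.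
       (U_stat d g X (the_enat (N x \<omega>)) \<omega> - \<mu> powi (- int d) * \<nu> * inverse (fact d) * x ^ d)
         / x powr (real d - 1 / 2)))
    (normal_law 0 (gamma_sq M d f g X)) at_top"
proof -
  let ?V = "U_centred d (shifted_kernel d f g \<kappa>)"
  \<comment> \<open>x^(d-1/2) equals mu^(d-1/2) times the rate at y = x / mu, and \<open>c\<close>
    is the inverse of that power of mu.\<close>
  define c where "c = 1 / (\<mu> ^ (d - 1) * sqrt \<mu>)"
  have c: "0 < c" using \<mu>_pos by (simp add: c_def)
  define W where "W = (\<lambda>x \<omega>. (U_stat d g X (the_enat (N x \<omega>)) \<omega> - \<mu> powi (- int d) * \<nu> * inverse (fact d) * x ^ d)
         / x powr (real d - 1 / 2))"
  define Z where "Z = (\<lambda>n \<omega>. c * ?V n \<omega> / rate d (real n))"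
  have W_eq: "W x \<omega> = c * ((U_stat d g X (the_enat (N (\<mu> * y) \<omega>)) \<omega> - \<nu> * y ^ d / fact d) / rate d y)"
    if x: "0 < x" and y: "y = x / \<mu>" for x y \<omega>
  proof -
    have x_eq: "x = \<mu> * y" and y0: "0 < y" using x \<mu>_pos by (auto simp: y)
    have "x powr (real d - 1 / 2) = x powr (real (d - 1) + 1 / 2)" using d by (simp add: of_nat_diff)
    also have "\<dots> = x ^ (d - 1) * sqrt x" using x by (simp add: powr_add powr_realpow powr_half_sqrt)
    also have "\<dots> = \<mu> ^ (d - 1) * sqrt \<mu> * rate d y"
      unfolding x_eq by (simp add: rate_def power_mult_distrib real_sqrt_mult)
    finally have den: "x powr (real d - 1 / 2) = \<mu> ^ (d - 1) * sqrt \<mu> * rate d y" .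
    have num: "\<mu> powi (- int d) * \<nu> * inverse (fact d) * x ^ d = \<nu> * y ^ d / fact d"
      using \<mu>_pos unfolding x_eq by (simp add: power_int_minus power_mult_distrib field_simps)
    show ?thesis unfolding W_def den num c_def x_eq[symmetric] by simp
  qed
  have lim: "weak_conv_along (\<lambda>x. distr M borel (Z (nat \<lfloor>x / \<mu>\<rfloor>))) (normal_law 0 (gamma_sq M d f g X)) at_top"
  proof -
    have A: "weak_conv_along (\<lambda>n. distr M borel (Z n)) (normal_law 0 (gamma_sq M d f g X)) sequentially"
      using U_statistic_clt[OF kernel_shifted d, of c]
      unfolding weak_conv_along_sequentially Z_def rate_def gamma_sq_eq c_def .
    \<comment> \<open>Convergence along the integers carries over to real \<open>x\<close> because
      the deterministic index tends to infinity with \<open>x\<close>.\<close>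
    have B: "filterlim (\<lambda>x. nat \<lfloor>x / \<mu>\<rfloor>) sequentially at_top"
    proof -
      have "filterlim (\<lambda>x. x / \<mu>) at_top at_top"
        using \<mu>_pos by (simp add: filterlim_at_top_mult_tendsto_pos[OF tendsto_const _ filterlim_ident, of "inverse \<mu>"] divide_inverse)
      then have "filterlim (\<lambda>x. \<lfloor>x / \<mu>\<rfloor>) at_top at_top" by (rule filterlim_compose[OF filterlim_floor_sequentially])
      then show ?thesis by (rule filterlim_compose[OF filterlim_nat_sequentially])
    qed
    show ?thesis
      unfolding weak_conv_along_def
    proof (intro allI impI)
      fix t assume "isCont (cdf (normal_law 0 (gamma_sq M d f g X))) t"
      then have "(\<lambda>n. cdf (distr M borel (Z n)) t) \<longlonglongrightarrow> cdf (normal_law 0 (gamma_sq M d f g X)) t"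
        using A unfolding weak_conv_along_def by blast
      from filterlim_compose[OF this B]
      show "((\<lambda>x. cdf (distr M borel (Z (nat \<lfloor>x / \<mu>\<rfloor>))) t) \<longlongrightarrow> cdf (normal_law 0 (gamma_sq M d f g X)) t) at_top" .
    qed
  qed
  have "weak_conv_along (\<lambda>x. distr M borel (W x)) (normal_law 0 (gamma_sq M d f g X)) at_top"
  proof (rule weak_conv_along_perturb[OF _ _ real_distribution_normal_law[OF gamma_sq_nonneg] lim])
    show "random_variable borel (Z (nat \<lfloor>x / \<mu>\<rfloor>))" for x
      unfolding Z_def using U_centred_rv[OF kernel_shifted] by measurable
    show "random_variable borel (W x)" for x
      unfolding W_def using U_stat_random_index_rv[OF g f N] by measurable
    fix \<epsilon> :: real assume "0 < \<epsilon>"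
    then have "0 < \<epsilon> / c" using c by simp
    define D where "D = (\<lambda>y \<omega>. (U_stat d g X (the_enat (N (\<mu> * y) \<omega>)) \<omega> - \<nu> * y ^ d / fact d) / rate d y
      - ?V (nat \<lfloor>y\<rfloor>) \<omega> / rate d (real (nat \<lfloor>y\<rfloor>)))"
    have "((\<lambda>y. prob {\<omega> \<in> space M. \<epsilon> / c < \<bar>D y \<omega>\<bar>}) \<longlongrightarrow> 0) at_top"
      unfolding D_def by (intro whp_imp_tendsto whp_random_index_error N \<open>0 < \<epsilon> / c\<close>)
    moreover have "filterlim (\<lambda>x. x / \<mu>) at_top at_top"
      using \<mu>_pos by (simp add: filterlim_at_top_mult_tendsto_pos[OF tendsto_const _ filterlim_ident, of "inverse \<mu>"] divide_inverse)
    ultimately have "((\<lambda>x. prob {\<omega> \<in> space M. \<epsilon> / c < \<bar>D (x / \<mu>) \<omega>\<bar>}) \<longlongrightarrow> 0) at_top"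
      by (rule filterlim_compose)
    moreover have "\<forall>\<^sub>F x in at_top. prob {\<omega> \<in> space M. \<epsilon> / c < \<bar>D (x / \<mu>) \<omega>\<bar>}
        = prob {\<omega> \<in> space M. \<epsilon> < \<bar>W x \<omega> - Z (nat \<lfloor>x / \<mu>\<rfloor>) \<omega>\<bar>}"
      using eventually_gt_at_top[of 0]
    proof eventually_elim
      case (elim x)
      have "W x \<omega> - Z (nat \<lfloor>x / \<mu>\<rfloor>) \<omega> = c * D (x / \<mu>) \<omega>" for \<omega>
        unfolding W_eq[OF elim refl] Z_def D_def by (simp add: right_diff_distrib)
      then have "\<epsilon> < \<bar>W x \<omega> - Z (nat \<lfloor>x / \<mu>\<rfloor>) \<omega>\<bar> \<longleftrightarrow> \<epsilon> / c < \<bar>D (x / \<mu>) \<omega>\<bar>" for \<omega>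
        using c by (simp add: abs_mult divide_less_eq mult.commute)
      then show ?case by simp
    qed
    ultimately show "((\<lambda>x. prob {\<omega> \<in> space M. \<epsilon> < \<bar>W x \<omega> - Z (nat \<lfloor>x / \<mu>\<rfloor>) \<omega>\<bar>}) \<longlongrightarrow> 0) at_top"
      by (rule Lim_transform_eventually)
  qed
  then show ?thesis unfolding W_def .
qed

end

end

theorem theorem3p11:
  fixes M :: "'a measure" and S :: "'s measure" and X :: "nat \<Rightarrow> 'a \<Rightarrow> 's"
    and d :: nat and f :: "'s \<Rightarrow> real" and g :: "(nat \<Rightarrow> 's) \<Rightarrow> real" and \<mu> \<nu> :: real
  assumes "prob_space M"
    and "prob_space.indep_vars M (\<lambda>_. S) X UNIV"
    and "\<And>n. distr M S (X n) = distr M S (X 0)"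
    and "d \<ge> 1"
    and "f \<in> borel_measurable S"
    and "g \<in> borel_measurable (Pi\<^sub>M {1..d} (\<lambda>_. S))"
    and "integrable M (\<lambda>\<omega>. (f (X 0 \<omega>))\<^sup>2)"
    and "integrable M (\<lambda>\<omega>. (g (\<lambda>k\<in>{1..d}. X k \<omega>))\<^sup>2)"
    and "\<mu> = integral\<^sup>L M (\<lambda>\<omega>. f (X 0 \<omega>))"
    and "\<nu> = U_mean M d g X"
    and "\<mu> > 0"
  shows "0 \<le> gamma_sq M d f g X \<and>
    (\<forall>N \<in> {N_minus f X, N_plus f X}.
       weak_conv_along
         (\<lambda>x. distr M borel (\<lambda>\<omega>.
            (U_stat d g X (the_enat (N x \<omega>)) \<omega> - \<mu> powi (- int d) * \<nu> * inverse (fact d) * x ^ d)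
              / x powr (real d - 1 / 2)))
         (normal_law 0 (gamma_sq M d f g X)) at_top) \<and>
    (gamma_sq M d f g X = 0 \<longleftrightarrow>
       (\<forall>i\<in>{1..d}. AE \<omega> in M. \<mu> * U_proj M d g X i (X 0 \<omega>) = \<nu> * (f (X 0 \<omega>) - \<mu>)))"
proof -
  interpret iid_sequence M S X
    using assms(1-3) by (intro iid_sequence.intro iid_sequence_axioms.intro)
  have g: "kernel d g" using assms(6,8) by (simp add: kernel_def)
  note setting = assms(4,5) g assms(7,9,10,11) refl
  show ?thesis
    by (intro conjI ballI gamma_sq_nonneg[OF setting] weak_conv_random_index[OF setting]
        gamma_sq_eq_0_iff[OF setting])
qed

end
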